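(* Consider a noisy quantum circuit with circuit locations $a$, in the noise model described in the context (each location has its own local bath, refreshed at the beginning of the location). For a location $a$ of duration $T$ let $\tilde H(t)=\sum_\alpha S_\alpha(t)\otimes B_\alpha(t)$, $t\in[0,T]$, be the interaction-picture noise Hamiltonian at that location (the label $a$ on $\tilde H$, $S_\alpha$, $B_\alpha$ and on quantities derived from them is suppressed), with $\|\tilde H(t)\|=\|H_{\rm err}\|\le J$ at every location, and let $\tilde U(T)$ be the interaction-picture time evolution operator it generates. Let $|\Phi_a\rangle$ be (a purification of) the initial state of the bath at the beginning of location $a$, and let the noise strength $\bar\eta\ge 0$ be given by $$\bar\eta^2=\max_{a,|\Psi\rangle}\left\langle(\tilde U^\dagger(T)-\mathbb I)(\tilde U(T)-\mathbb I)\right\rangle=\max_{a,|\Psi\rangle}\left\langle 2\,\mathbb I-\tilde U(T)-\tilde U^\dagger(T)\right\rangle,$$ where $\langle\cdot\rangle$ is the expectation value in $|\Psi\rangle\otimes|\Phi_a\rangle$ and the maximum is over all circuit locations $a$ and all (normalized) pure system states $|\Psi\rangle$. Then $$\bar\eta^2\le\max_{a,|\Psi\rangle}\int_0^Tdt_1\int_0^Tdt_2\left\langle\tilde H(t_1)\tilde H(t_2)\right\rangle+2\left(e^{JT}-1-JT-\tfrac12(JT)^2\right),$$ and, since the expectation value factorizes in the product state, $$\bar\eta^2\le\max_{a,|\Psi\rangle}\int_0^Tdt_1\int_0^Tdt_2\sum_{\alpha,\beta}\left\langle S_\alpha(t_1)S_\beta(t_2)\right\rangle_S\left\langle B_\alpha(t_1)B_\beta(t_2)\right\rangle_B+2\left(e^{JT}-1-JT-\tfrac12(JT)^2\right).$$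 Consequently, if the bath's time correlations are stationary, i.e. $\langle B_\alpha(t_1)B_\beta(t_2)\rangle_B$ is a function of $t_1-t_2$, expressed as $$\langle B_\alpha(t_1)B_\beta(t_2)\rangle_B=\int_{-\infty}^\infty\frac{d\omega}{2\pi}\,e^{-i\omega(t_1-t_2)}K_{\alpha\beta}(\omega),$$ then, with $\tilde S_\alpha(\omega)=\int_0^Tdt\,e^{-i\omega t}S_\alpha(t)$, $$\bar\eta^2\le\max_{a,|\Psi\rangle}\int_{-\infty}^\infty\frac{d\omega}{2\pi}\sum_{\alpha,\beta}\left\langle\tilde S_\alpha(\omega)\tilde S_\beta(-\omega)\right\rangle_S K_{\alpha\beta}(\omega)+2\left(e^{JT}-1-JT-\tfrac12(JT)^2\right);$$ and with the bath's spectral function $J^2_{\alpha\beta,i}$ defined by $K_{\alpha\beta}(\omega)=2\pi\sum_iJ^2_{\alpha\beta,i}\,\delta(\omega-\omega_i)$, $$\bar\eta^2\le\max_{a,|\Psi\rangle}\sum_{i,\alpha,\beta}J^2_{\alpha\beta,i}\left\langle\tilde S_\alpha(\omega_i)\tilde S_\beta(-\omega_i)\right\rangle_S+2\left(e^{JT}-1-JT-\tfrac12(JT)^2\right).$$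
   Context: A circuit location is an operation (gate, preparation, measurement, or idle step) performed on a set of qubits (the system at that location) in a single time step. In the local-bath noise model, the noise Hamiltonians of distinct simultaneous locations act on disjoint sets of qubits and on distinct baths; in addition it is assumed that the state of the bath is discarded at the end of each location and replaced by a fresh bath state at the beginning of the next, so that the initial bath state at location $a$ does not depend on earlier noisy operations and the joint initial state at a location is a product state. At a location the noise Hamiltonian is $H=\mathbb I\otimes B_0+H_{\rm err}$, with $H_{\rm err}=\sum_\alpha S_\alpha\otimes B_\alpha$, where $S_\alpha$ act on the system and $B_0,B_\alpha$ on the bath; $J$ is an upper bound on the operator norm $\|H_{\rm err}\|$ over all locations. $U_c(t)$ is the control unitary, acting on the system only. The interaction picture removes both the control and the free bath evolution: $S_\alpha(t)=U_c(t)^\dagger S_\alpha U_c(t)$, $B_\alpha(t)=e^{itB_0}B_\alpha e^{-itB_0}$, and $\tilde U(T)=\mathcal T\exp\left(-i\int_0^T\tilde H(t)\,dt\right)$ with $\mathcal T$ denoting time ordering. A purifying reference system of the bath, if used, is acted on trivially. $\langle\cdot\rangle_S$ and $\langle\cdot\rangle_B$ denote expectation values in $|\Psi\rangle$ and in the initial bath state of the location, respectively. $J^2_{\alpha\beta,i}$ is a single symbol denoting the spectral weight at frequency $\omega_i$. *)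

theory Defs
  imports "HOL-Analysis.Analysis" "HOL-Library.Complex_Order"
begin

section \<open>Complex Hilbert spaces\<close>

text \<open>The inner product is antilinear in its first argument (bra-ket convention).\<close>

class complex_hilbert = real_inner + banach +
  fixes scaleC :: "complex \<Rightarrow> 'a \<Rightarrow> 'a" (infixr "*\<^sub>C" 75)
    and cinner :: "'a \<Rightarrow> 'a \<Rightarrow> complex"
  assumes scaleC_add_right: "c *\<^sub>C (x + y) = c *\<^sub>C x + c *\<^sub>C y"
    and scaleC_add_left: "(c + d) *\<^sub>C x = c *\<^sub>C x + d *\<^sub>C x"
    and scaleC_scaleC: "c *\<^sub>C (d *\<^sub>C x) = (c * d) *\<^sub>C x"
    and scaleC_of_real: "complex_of_real r *\<^sub>C x = r *\<^sub>R x"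
    and cinner_commute: "cinner x y = cnj (cinner y x)"
    and cinner_add_right: "cinner x (y + z) = cinner x y + cinner x z"
    and cinner_scaleC_right: "cinner x (c *\<^sub>C y) = c * cinner x y"
    and Re_cinner: "Re (cinner x y) = inner x y"

instantiation complex :: complex_hilbert
begin

definition scaleC_complex :: "complex \<Rightarrow> complex \<Rightarrow> complex"
  where "scaleC_complex c x = c * x"

definition cinner_complex :: "complex \<Rightarrow> complex \<Rightarrow> complex"
  where "cinner_complex x y = cnj x * y"

instance
  by standard
    (simp_all add: scaleC_complex_def cinner_complex_def algebra_simps scaleR_conv_of_real
      inner_complex_def)

end

instantiation vec :: (complex_hilbert, finite) complex_hilbert
begin

definition scaleC_vec :: "complex \<Rightarrow> ('a, 'b) vec \<Rightarrow> ('a, 'b) vec"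
  where "scaleC_vec c x = (\<chi> i. c *\<^sub>C (x $ i))"

definition cinner_vec :: "('a, 'b) vec \<Rightarrow> ('a, 'b) vec \<Rightarrow> complex"
  where "cinner_vec x y = (\<Sum>i\<in>UNIV. cinner (x $ i) (y $ i))"

instance
proof
  fix x y z :: "('a, 'b) vec" and c d :: complex and r :: real
  show "c *\<^sub>C (x + y) = c *\<^sub>C x + c *\<^sub>C y"
    by (simp add: scaleC_vec_def vec_eq_iff scaleC_add_right)
  show "(c + d) *\<^sub>C x = c *\<^sub>C x + d *\<^sub>C x"
    by (simp add: scaleC_vec_def vec_eq_iff scaleC_add_left)
  show "c *\<^sub>C (d *\<^sub>C x) = (c * d) *\<^sub>C x"
    by (simp add: scaleC_vec_def vec_eq_iff scaleC_scaleC)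
  show "complex_of_real r *\<^sub>C x = r *\<^sub>R x"
    by (simp add: scaleC_vec_def vec_eq_iff scaleC_of_real)
  show "cinner x y = cnj (cinner y x)"
    unfolding cinner_vec_def cnj_sum by (intro sum.cong refl cinner_commute)
  show "cinner x (y + z) = cinner x y + cinner x z"
    by (simp add: cinner_vec_def cinner_add_right sum.distrib)
  show "cinner x (c *\<^sub>C y) = c * cinner x y"
    by (simp add: cinner_vec_def scaleC_vec_def cinner_scaleC_right sum_distrib_left)
  show "Re (cinner x y) = inner x y"
    by (simp add: cinner_vec_def inner_vec_def Re_cinner)
qed

end


section \<open>Operators on a closed subspace of an ambient Hilbert space\<close>

text \<open>
  Different circuit locations have different system and bath Hilbert spaces. They are represented
  as closed subspaces \<open>W\<close> of a common ambient space; an operator on \<open>W\<close> is a function of which only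
  the values on \<open>W\<close> matter.
\<close>

definition csubspace :: "'h::complex_hilbert set \<Rightarrow> bool" where
  "csubspace W \<longleftrightarrow> 0 \<in> W \<and> (\<forall>x\<in>W. \<forall>y\<in>W. x + y \<in> W) \<and> (\<forall>c. \<forall>x\<in>W. c *\<^sub>C x \<in> W)"

definition clinear_on :: "'h::complex_hilbert set \<Rightarrow> ('h \<Rightarrow> 'h) \<Rightarrow> bool" where
  "clinear_on W X \<longleftrightarrow>
     (\<forall>x\<in>W. \<forall>y\<in>W. X (x + y) = X x + X y) \<and> (\<forall>c. \<forall>x\<in>W. X (c *\<^sub>C x) = c *\<^sub>C X x)"

definition bounded_op :: "'h::complex_hilbert set \<Rightarrow> ('h \<Rightarrow> 'h) \<Rightarrow> bool" where
  "bounded_op W X \<longleftrightarrow>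
     clinear_on W X \<and> X ` W \<subseteq> W \<and> (\<exists>K. \<forall>x\<in>W. norm (X x) \<le> K * norm x)"

definition op_norm :: "'h::complex_hilbert set \<Rightarrow> ('h \<Rightarrow> 'h) \<Rightarrow> real" where
  "op_norm W X = (SUP x\<in>W. norm (X x) / norm x)"

definition adj :: "'h::complex_hilbert set \<Rightarrow> ('h \<Rightarrow> 'h) \<Rightarrow> 'h \<Rightarrow> 'h" where
  "adj W X x = (THE y. y \<in> W \<and> (\<forall>z\<in>W. cinner y z = cinner x (X z)))"

definition hermitian_op :: "'h::complex_hilbert set \<Rightarrow> ('h \<Rightarrow> 'h) \<Rightarrow> bool" where
  "hermitian_op W X \<longleftrightarrow>
     bounded_op W X \<and> (\<forall>x\<in>W. \<forall>y\<in>W. cinner (X x) y = cinner x (X y))"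

definition unitary_op :: "'h::complex_hilbert set \<Rightarrow> ('h \<Rightarrow> 'h) \<Rightarrow> bool" where
  "unitary_op W X \<longleftrightarrow>
     clinear_on W X \<and> X ` W = W \<and> (\<forall>x\<in>W. \<forall>y\<in>W. cinner (X x) (X y) = cinner x y)"

text \<open>
  Self-adjointness of a possibly unbounded operator \<open>X\<close> with dense domain \<open>D\<close>; the last conjunct says
  that the graph of the adjoint of \<open>X\<close> is the graph of \<open>X\<close>.
\<close>

definition selfadjoint_op :: "'h::complex_hilbert set \<Rightarrow> 'h set \<Rightarrow> ('h \<Rightarrow> 'h) \<Rightarrow> bool" where
  "selfadjoint_op W D X \<longleftrightarrow>
     csubspace D \<and> D \<subseteq> W \<and> W \<subseteq> closure D \<and> clinear_on D X \<and> X ` D \<subseteq> W \<and>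
     (\<forall>y\<in>W. \<forall>z\<in>W. (\<forall>x\<in>D. cinner (X x) y = cinner x z) \<longleftrightarrow> y \<in> D \<and> X y = z)"

text \<open>
  \<open>V t\<close> is \<open>exp (i t X)\<close>: the strongly continuous one-parameter unitary group whose generator is
  exactly \<open>i X\<close>. By Stone's theorem every self-adjoint \<open>X\<close> has exactly one such group, so the
  predicate characterises the exponential also for unbounded \<open>X\<close>, where no power series is available.
\<close>

definition is_exp_i ::
  "'h::complex_hilbert set \<Rightarrow> 'h set \<Rightarrow> ('h \<Rightarrow> 'h) \<Rightarrow> (real \<Rightarrow> 'h \<Rightarrow> 'h) \<Rightarrow> bool" where
  "is_exp_i W D X V \<longleftrightarrow>
     (\<forall>t. unitary_op W (V t)) \<and>
     (\<forall>s t. \<forall>x\<in>W. V (s + t) x = V s (V t x)) \<and>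
     (\<forall>x\<in>W. continuous_on UNIV (\<lambda>t. V t x)) \<and>
     (\<forall>x\<in>W. \<forall>y\<in>W.
        x \<in> D \<and> X x = y \<longleftrightarrow> ((\<lambda>t. V t x) has_vector_derivative (\<i> *\<^sub>C y)) (at 0))"

text \<open>\<open>expect v X\<close> is the expectation value of \<open>X\<close> in the state \<open>v\<close>.\<close>

definition expect :: "'h::complex_hilbert \<Rightarrow> ('h \<Rightarrow> 'h) \<Rightarrow> complex" where
  "expect v X = cinner v (X v)"

text \<open>
  The time-ordered exponential of \<open>-i H\<close>: \<open>dyson H n t\<close> is \<open>(-i)^n\<close> times the integral of
  \<open>H(t_1) ... H(t_n)\<close> over \<open>t \<ge> t_1 \<ge> ... \<ge> t_n \<ge> 0\<close>; the factor \<open>1 / n!\<close> of the exponential series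
  cancels against the \<open>n!\<close> orderings. Integrals and sum are taken in the strong sense.
\<close>

primrec dyson :: "(real \<Rightarrow> 'h::complex_hilbert \<Rightarrow> 'h) \<Rightarrow> nat \<Rightarrow> real \<Rightarrow> 'h \<Rightarrow> 'h" where
  "dyson H 0 t x = x"
| "dyson H (Suc n) t x = (- \<i>) *\<^sub>C integral {0..t} (\<lambda>s. H s (dyson H n s x))"

definition time_ordered_exp :: "(real \<Rightarrow> 'h::complex_hilbert \<Rightarrow> 'h) \<Rightarrow> real \<Rightarrow> 'h \<Rightarrow> 'h" where
  "time_ordered_exp H t x = (\<Sum>n. dyson H n t x)"


section \<open>Circuit locations\<close>

text \<open>
  A computational basis state of the qubits is encoded by the set of qubits whose bit is 1; the
  system at a location with qubits \<open>Q\<close> is spanned by the basis states \<open>s \<subseteq> Q\<close>.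
\<close>

definition qubit_space :: "'q set \<Rightarrow> (complex, 'q::finite set) vec set" where
  "qubit_space Q = {\<psi>. \<forall>s. \<not> s \<subseteq> Q \<longrightarrow> \<psi> $ s = 0}"

text \<open>
  \<open>joint_space Q W\<close> is the tensor product of \<open>qubit_space Q\<close> and \<open>W\<close>: a vector is given by its
  \<open>W\<close>-valued components in the computational basis.
\<close>

definition joint_space :: "'q set \<Rightarrow> 'b set \<Rightarrow> ('b::complex_hilbert, 'q::finite set) vec set" where
  "joint_space Q W = {\<psi>. (\<forall>s. s \<subseteq> Q \<longrightarrow> \<psi> $ s \<in> W) \<and> (\<forall>s. \<not> s \<subseteq> Q \<longrightarrow> \<psi> $ s = 0)}"

definition product_state ::
  "(complex, 'q::finite set) vec \<Rightarrow> 'b::complex_hilbert \<Rightarrow> ('b, 'q set) vec" where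
  "product_state \<Psi> \<Phi> = (\<chi> s. (\<Psi> $ s) *\<^sub>C \<Phi>)"

text \<open>\<open>S (axis s' 1) $ s\<close> is the matrix element of \<open>S\<close> between the basis states \<open>s\<close> and \<open>s'\<close>.\<close>

definition tensor_op ::
  "'q set \<Rightarrow> ((complex, 'q::finite set) vec \<Rightarrow> (complex, 'q set) vec) \<Rightarrow>
   ('b::complex_hilbert \<Rightarrow> 'b) \<Rightarrow> ('b, 'q set) vec \<Rightarrow> ('b, 'q set) vec" where
  "tensor_op Q S B \<psi> = (\<chi> s. \<Sum>s'\<in>Pow Q. (S (axis s' 1) $ s) *\<^sub>C B (\<psi> $ s'))"

text \<open>
  \<open>bath\<close> is the Hilbert space of the location's own bath, including the purifying reference system
  if there is one; \<open>bath_ham\<close> (with domain \<open>bath_dom\<close>) is the free bath Hamiltonian and \<open>bath_exp t\<close>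
  is \<open>exp (i t bath_ham)\<close>; \<open>bath_init\<close> is the fresh initial bath state.
\<close>

record ('q, 'b, 'k) location =
  time_step :: nat
  qubits :: "'q set"
  control :: "real \<Rightarrow> (complex, 'q set) vec \<Rightarrow> (complex, 'q set) vec"
  bath :: "'b set"
  bath_dom :: "'b set"
  bath_ham :: "'b \<Rightarrow> 'b"
  bath_exp :: "real \<Rightarrow> 'b \<Rightarrow> 'b"
  bath_init :: 'b
  labels :: "'k set"
  sys_op :: "'k \<Rightarrow> (complex, 'q set) vec \<Rightarrow> (complex, 'q set) vec"
  bath_op :: "'k \<Rightarrow> 'b \<Rightarrow> 'b"

definition sys_space :: "('q::finite, 'b, 'k) location \<Rightarrow> (complex, 'q set) vec set" where
  "sys_space l = qubit_space (qubits l)"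

definition loc_space ::
  "('q::finite, 'b::complex_hilbert, 'k) location \<Rightarrow> ('b, 'q set) vec set" where
  "loc_space l = joint_space (qubits l) (bath l)"

definition H_err ::
  "('q::finite, 'b::complex_hilbert, 'k) location \<Rightarrow> ('b, 'q set) vec \<Rightarrow> ('b, 'q set) vec" where
  "H_err l \<psi> = (\<Sum>\<alpha>\<in>labels l. tensor_op (qubits l) (sys_op l \<alpha>) (bath_op l \<alpha>) \<psi>)"

text \<open>Interaction picture: \<open>S_int\<close>, \<open>B_int\<close>, \<open>H_int\<close>, \<open>U_int\<close> are the paper's
  \<open>S\<^sub>\<alpha>(t)\<close>, \<open>B\<^sub>\<alpha>(t)\<close> and the operators \<open>H(t)\<close>, \<open>U(T)\<close> with a tilde.\<close>

definition S_int ::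
  "('q::finite, 'b, 'k) location \<Rightarrow> 'k \<Rightarrow> real \<Rightarrow> (complex, 'q set) vec \<Rightarrow> (complex, 'q set) vec" where
  "S_int l \<alpha> t \<psi> = adj (sys_space l) (control l t) (sys_op l \<alpha> (control l t \<psi>))"

definition B_int :: "('q, 'b, 'k) location \<Rightarrow> 'k \<Rightarrow> real \<Rightarrow> 'b \<Rightarrow> 'b" where
  "B_int l \<alpha> t \<phi> = bath_exp l t (bath_op l \<alpha> (bath_exp l (- t) \<phi>))"

definition H_int ::
  "('q::finite, 'b::complex_hilbert, 'k) location \<Rightarrow> real \<Rightarrow> ('b, 'q set) vec \<Rightarrow> ('b, 'q set) vec" where
  "H_int l t \<psi> = (\<Sum>\<alpha>\<in>labels l. tensor_op (qubits l) (S_int l \<alpha> t) (B_int l \<alpha> t) \<psi>)"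

definition U_int ::
  "('q::finite, 'b::complex_hilbert, 'k) location \<Rightarrow> real \<Rightarrow> ('b, 'q set) vec \<Rightarrow> ('b, 'q set) vec" where
  "U_int l t = time_ordered_exp (H_int l) t"

definition S_fourier ::
  "('q::finite, 'b, 'k) location \<Rightarrow> real \<Rightarrow> 'k \<Rightarrow> real \<Rightarrow>
   (complex, 'q set) vec \<Rightarrow> (complex, 'q set) vec" where
  "S_fourier l T \<alpha> \<omega> \<psi> =
     integral {0..T} (\<lambda>t. exp (- \<i> * complex_of_real (\<omega> * t)) *\<^sub>C S_int l \<alpha> t \<psi>)"

text \<open>
  The control may jump at finitely many times (ideal pulses). Only the sum \<open>H_err\<close> is required
  to be Hermitian, not the individual system and bath operators.
\<close>

definition noisy_location :: "real \<Rightarrow> ('q::finite, 'b::complex_hilbert, 'k) location \<Rightarrow> bool" where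
  "noisy_location T l \<longleftrightarrow>
     (\<forall>t\<in>{0..T}. unitary_op (sys_space l) (control l t)) \<and>
     (\<exists>F. finite F \<and> (\<forall>\<psi>\<in>sys_space l. continuous_on ({0..T} - F) (\<lambda>t. control l t \<psi>))) \<and>
     csubspace (bath l) \<and> closed (bath l) \<and>
     selfadjoint_op (bath l) (bath_dom l) (bath_ham l) \<and>
     is_exp_i (bath l) (bath_dom l) (bath_ham l) (bath_exp l) \<and>
     bath_init l \<in> bath l \<and> norm (bath_init l) = 1 \<and>
     finite (labels l) \<and>
     (\<forall>\<alpha>\<in>labels l. bounded_op (sys_space l) (sys_op l \<alpha>) \<and> bounded_op (bath l) (bath_op l \<alpha>)) \<and>
     hermitian_op (loc_space l) (H_err l)"

text \<open>
  The baths of distinct locations are distinct because each location carries its own bath Hilbert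
  space; the position of these spaces inside the ambient space has no physical meaning.
\<close>

definition noisy_circuit ::
  "real \<Rightarrow> real \<Rightarrow> 'l set \<Rightarrow> ('l \<Rightarrow> ('q::finite, 'b::complex_hilbert, 'k) location) \<Rightarrow> bool" where
  "noisy_circuit T J A C \<longleftrightarrow>
     finite A \<and> A \<noteq> {} \<and>
     (\<forall>a\<in>A. noisy_location T (C a) \<and> op_norm (loc_space (C a)) (H_err (C a)) \<le> J) \<and>
     (\<forall>a\<in>A. \<forall>b\<in>A. a \<noteq> b \<and> time_step (C a) = time_step (C b) \<longrightarrow>
        qubits (C a) \<inter> qubits (C b) = {})"


section \<open>Maxima and spectral functions\<close>

text \<open>
  The maximum over all locations and all normalised pure states of the system at the location.
  \<open>GREATEST\<close> refers to the order of \<open>HOL-Library.Complex_Order\<close>, in which \<open>z \<le> w\<close> means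
  \<open>Re z \<le> Re w\<close> and \<open>Im z = Im w\<close>. Hence such a maximum is an attained one, and an inequality between
  a real number and the maximum entails that the maximised quantity is real there.
\<close>

definition max_over ::
  "'l set \<Rightarrow> ('l \<Rightarrow> ('q::finite, 'b, 'k) location) \<Rightarrow>
   ('l \<Rightarrow> (complex, 'q set) vec \<Rightarrow> complex) \<Rightarrow> complex" where
  "max_over A C f =
     (GREATEST z. \<exists>a\<in>A. \<exists>\<Psi>\<in>sys_space (C a). norm \<Psi> = 1 \<and> z = f a \<Psi>)"

text \<open>
  A spectral function \<open>K(\<omega>)\<close> may contain delta functions, so \<open>K(\<omega>) d\<omega>\<close> is a complex Borel measure,
  represented as \<open>k(\<omega>) dM(\<omega>)\<close> with a positive measure \<open>M\<close>, as is always possible by the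
  Radon-Nikodym theorem. An ordinary function \<open>K\<close> is the case \<open>M = lborel\<close>, \<open>k = K\<close>.
\<close>

definition spectral_function :: "real measure \<Rightarrow> (real \<Rightarrow> complex) \<Rightarrow> bool" where
  "spectral_function M k \<longleftrightarrow> sigma_finite_measure M \<and> sets M = sets borel \<and> integrable M k"

definition spectral_integral ::
  "real measure \<Rightarrow> (real \<Rightarrow> complex) \<Rightarrow> complex" where
  "spectral_integral M f = (\<integral>\<omega>. f \<omega> / (2 * complex_of_real pi) \<partial>M)"

text \<open>
  \<open>K(\<omega>) = 2 \<pi> \<Sum>\<^sub>i c\<^sub>i \<delta>(\<omega> - w\<^sub>i)\<close> as an identity of complex measures.
\<close>

definition is_delta_comb ::
  "real measure \<Rightarrow> (real \<Rightarrow> complex) \<Rightarrow> 'i set \<Rightarrow> ('i \<Rightarrow> complex) \<Rightarrow> ('i \<Rightarrow> real) \<Rightarrow> bool" where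
  "is_delta_comb M k I c w \<longleftrightarrow>
     (\<lambda>i. norm (c i)) summable_on I \<and>
     (\<forall>E\<in>sets borel. (\<integral>\<omega>\<in>E. k \<omega> \<partial>M) =
        2 * complex_of_real pi * (\<Sum>\<^sub>\<infinity>i\<in>{i\<in>I. w i \<in> E}. c i))"

definition stationary_correlations ::
  "real \<Rightarrow> ('q, 'b::complex_hilbert, 'k) location \<Rightarrow> real measure \<Rightarrow>
   ('k \<Rightarrow> 'k \<Rightarrow> real \<Rightarrow> complex) \<Rightarrow> bool" where
  "stationary_correlations T l M K \<longleftrightarrow>
     (\<forall>\<alpha>\<in>labels l. \<forall>\<beta>\<in>labels l. spectral_function M (K \<alpha> \<beta>) \<and>
       (\<forall>t\<^sub>1\<in>{0..T}. \<forall>t\<^sub>2\<in>{0..T}.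
          expect (bath_init l) (\<lambda>\<phi>. B_int l \<alpha> t\<^sub>1 (B_int l \<beta> t\<^sub>2 \<phi>)) =
          spectral_integral M (\<lambda>\<omega>. exp (- \<i> * complex_of_real (\<omega> * (t\<^sub>1 - t\<^sub>2))) * K \<alpha> \<beta> \<omega>)))"

definition tail_bound :: "real \<Rightarrow> complex" where
  "tail_bound x = complex_of_real (2 * (exp x - 1 - x - x\<^sup>2 / 2))"

end

theory Submission
  imports Defs
begin

text \<open>
  With \<open>V(t) = U\<^sub>c(t) \<otimes> exp(- i t B\<^sub>0)\<close> the interaction-picture Hamiltonian is \<open>V(t)\<^sup>* H\<^sub>e\<^sub>r\<^sub>r V(t)\<close>: it is
  Hermitian, bounded by \<open>J\<close> and strongly continuous up to finitely many jumps. Any two solutions of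
  the Schroedinger equation keep their inner product, so \<open>U(T)\<close> is isometric and the noise in a
  state \<open>v\<close> equals \<open>2 - 2 Re \<langle>v, U(T) v\<rangle>\<close>. In the Dyson series the first-order term is imaginary, the
  second-order term contributes exactly \<open>\<parallel>w\<parallel>\<^sup>2\<close> with \<open>w = \<integral> H(t) v dt\<close>, and the orders from three on are
  at most the tail of the exponential series. All four maximised quantities are equal to \<open>\<parallel>w\<parallel>\<^sup>2\<close>:
  the first by expanding the square, the second since \<open>v\<close> is a product state, the third by Fubini,
  and the fourth by approximating the Fourier factor uniformly by functions with finite range. In
  particular they are real and continuous on a compact set of states, so the maxima are attained.
\<close>

section \<open>Complex Hilbert spaces\<close>

text \<open>The free bath Hamiltonian may be unbounded, so the interaction picture is continuous in
  time only strongly, and the control adds finitely many jumps. The evolution is therefore studied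
  vector by vector: integrals are gauge integrals with values in a Banach space, and the
  differential equation and the conservation laws tolerate a finite exceptional set of times.
  Adjoints are given by a description operator, so each one has to be exhibited: the inverse for a
  unitary, the time-reversed evolution for \<open>U(T)\<close>. The factor 2 of the tail is that of
  \<open>2 - 2 Re\<close>; the second-order term is a perfect square because the real part of the
  time-ordered double integral is half of the integral over the full square. On the frequency side
  Fubini needs Lebesgue integrable scalar functions; inserting the computational basis between the
  two system operators splits each correlation into products of functions of one time. Compactness
  of the set of states rests on the finite number of qubits; the bath may be infinite-dimensional,
  but it enters through a fixed initial state.\<close>

lemma cinner_add_left: "cinner (x + y) z = cinner x z + cinner y (z::'a::complex_hilbert)"
  by (metis cinner_add_right cinner_commute complex_cnj_add)

lemma cinner_scaleC_left: "cinner (c *\<^sub>C x) y = cnj c * cinner x (y::'a::complex_hilbert)"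
  by (metis cinner_scaleC_right cinner_commute complex_cnj_mult)

lemma cinner_self: "cinner x x = complex_of_real ((norm (x::'a::complex_hilbert))\<^sup>2)"
proof (rule complex_eqI)
  show "Re (cinner x x) = Re (complex_of_real ((norm x)\<^sup>2))"
    by (simp add: Re_cinner power2_norm_eq_inner)
  have "Im (cinner x x) = - Im (cinner x x)"
    by (metis cinner_commute cnj.simps(2))
  then show "Im (cinner x x) = Im (complex_of_real ((norm x)\<^sup>2))"
    by simp
qed

lemma norm_scaleC: "norm (c *\<^sub>C (x::'a::complex_hilbert)) = cmod c * norm x"
proof -
  have "complex_of_real ((norm (c *\<^sub>C x))\<^sup>2) = (c * cnj c) * complex_of_real ((norm x)\<^sup>2)"
    unfolding cinner_self[symmetric] by (simp add: cinner_scaleC_left cinner_scaleC_right)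
  also have "\<dots> = complex_of_real ((cmod c * norm x)\<^sup>2)"
    by (simp add: complex_norm_square[symmetric] power_mult_distrib)
  finally have "complex_of_real ((norm (c *\<^sub>C x))\<^sup>2) = complex_of_real ((cmod c * norm x)\<^sup>2)" .
  then have "(norm (c *\<^sub>C x))\<^sup>2 = (cmod c * norm x)\<^sup>2"
    by (simp only: of_real_eq_iff)
  then show ?thesis
    by (simp add: power2_eq_iff_nonneg)
qed

text \<open>A phase \<open>c\<close> rotates the inner product onto the positive real axis, where it
  is the real inner product and the real Cauchy-Schwarz inequality applies.\<close>

lemma norm_cinner_le: "cmod (cinner x y) \<le> norm x * norm (y::'a::complex_hilbert)"
proof (cases "cinner x y = 0")
  case False
  define c where "c = cnj (cinner x y) / cmod (cinner x y)"
  have c: "cmod c = 1"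
    using False by (simp add: c_def norm_divide)
  have "c * cinner x y = complex_of_real (cmod (cinner x y))"
    using False complex_norm_square[of "cinner x y"]
    by (simp add: c_def power2_eq_square divide_eq_eq mult.commute)
  then have "cmod (cinner x y) = Re (cinner x (c *\<^sub>C y))"
    by (simp add: cinner_scaleC_right)
  also have "\<dots> \<le> norm x * norm (c *\<^sub>C y)"
    by (simp add: Re_cinner norm_cauchy_schwarz)
  finally show ?thesis
    by (simp add: norm_scaleC c)
qed simp

lemma scaleC_one: "1 *\<^sub>C x = (x::'a::complex_hilbert)"
  using scaleC_of_real[of 1 x] by simp

lemma scaleC_zero: "0 *\<^sub>C x = (0::'a::complex_hilbert)"
  using scaleC_of_real[of 0 x] by simp

lemma scaleC_minus_one: "(- 1) *\<^sub>C x = - (x::'a::complex_hilbert)"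
  using scaleC_of_real[of "- 1" x] by simp

lemma scaleR_scaleC: "r *\<^sub>R x = complex_of_real r *\<^sub>C (x::'a::complex_hilbert)"
  by (simp add: scaleC_of_real)

lemma scaleC_left_commute: "a *\<^sub>C b *\<^sub>C x = b *\<^sub>C a *\<^sub>C (x::'a::complex_hilbert)"
  by (simp add: scaleC_scaleC mult.commute)

text \<open>Over the reals the antilinear argument is linear as well, so the general facts on
  limits, derivatives and integrals under bounded bilinear maps become available for
  \<open>cinner\<close>.\<close>

lemma bounded_bilinear_cinner: "bounded_bilinear (cinner :: 'a::complex_hilbert \<Rightarrow> _)"
proof
  show "\<exists>K. \<forall>a b::'a. cmod (cinner a b) \<le> norm a * norm b * K"
    by (rule exI[of _ 1]) (simp add: norm_cinner_le)
qed (simp_all add: cinner_add_left cinner_add_right scaleR_scaleC cinner_scaleC_left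
    cinner_scaleC_right scaleC_complex_def)

lemma bounded_bilinear_scaleC: "bounded_bilinear (scaleC :: complex \<Rightarrow> 'a::complex_hilbert \<Rightarrow> 'a)"
proof
  show "\<exists>K. \<forall>a. \<forall>b::'a. norm (a *\<^sub>C b) \<le> norm a * norm b * K"
    by (rule exI[of _ 1]) (simp add: norm_scaleC)
qed (simp_all add: scaleC_add_left scaleC_add_right scaleR_scaleC scaleC_scaleC
    scaleC_complex_def mult.commute)

interpretation cinner: bounded_bilinear "cinner :: 'a::complex_hilbert \<Rightarrow> _"
  by (rule bounded_bilinear_cinner)

interpretation scaleC: bounded_bilinear "scaleC :: complex \<Rightarrow> 'a::complex_hilbert \<Rightarrow> 'a"
  by (rule bounded_bilinear_scaleC)

lemma csubspaceD:
  assumes "csubspace W"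
  shows "0 \<in> W" "x \<in> W \<Longrightarrow> y \<in> W \<Longrightarrow> x + y \<in> W" "x \<in> W \<Longrightarrow> c *\<^sub>C x \<in> W"
    "x \<in> W \<Longrightarrow> - x \<in> W" "x \<in> W \<Longrightarrow> y \<in> W \<Longrightarrow> x - y \<in> W" "x \<in> W \<Longrightarrow> r *\<^sub>R x \<in> W"
proof -
  show *: "0 \<in> W" "x \<in> W \<Longrightarrow> y \<in> W \<Longrightarrow> x + y \<in> W" "x \<in> W \<Longrightarrow> c *\<^sub>C x \<in> W" for x y c
    using assms by (auto simp: csubspace_def)
  then show **: "x \<in> W \<Longrightarrow> - x \<in> W" for x
    by (metis scaleC_minus_one)
  show "x \<in> W \<Longrightarrow> y \<in> W \<Longrightarrow> x - y \<in> W" "x \<in> W \<Longrightarrow> r *\<^sub>R x \<in> W"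
    using *(2)[of x "- y"] ** *(3) by (auto simp: scaleR_scaleC)
qed

lemma csubspace_sum: "csubspace W \<Longrightarrow> (\<And>i. i \<in> I \<Longrightarrow> f i \<in> W) \<Longrightarrow> sum f I \<in> W"
  by (induction I rule: infinite_finite_induct) (auto simp: csubspaceD)

lemma csubspace_imp_subspace: "csubspace W \<Longrightarrow> subspace W"
  by (simp add: subspace_def csubspaceD)

lemma clinear_onD:
  assumes "clinear_on W X"
  shows "x \<in> W \<Longrightarrow> y \<in> W \<Longrightarrow> X (x + y) = X x + X y" "x \<in> W \<Longrightarrow> X (c *\<^sub>C x) = c *\<^sub>C X x"
  using assms by (auto simp: clinear_on_def)

lemma clinear_on_more:
  assumes "clinear_on W X" "csubspace W"
  shows "X 0 = 0" "x \<in> W \<Longrightarrow> X (- x) = - X x" "x \<in> W \<Longrightarrow> y \<in> W \<Longrightarrow> X (x - y) = X x - X y"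
    "x \<in> W \<Longrightarrow> X (r *\<^sub>R x) = r *\<^sub>R X x"
proof -
  show "X 0 = 0"
    using clinear_onD(2)[OF assms(1) csubspaceD(1)[OF assms(2)], of 0] by (simp add: scaleC_zero)
  show *: "x \<in> W \<Longrightarrow> X (- x) = - X x" for x
    using clinear_onD(2)[OF assms(1), of x "- 1"] by (simp add: scaleC_minus_one)
  show "x \<in> W \<Longrightarrow> y \<in> W \<Longrightarrow> X (x - y) = X x - X y"
    using clinear_onD(1)[OF assms(1), of x "- y"] * csubspaceD[OF assms(2)] by auto
  show "x \<in> W \<Longrightarrow> X (r *\<^sub>R x) = r *\<^sub>R X x"
    using clinear_onD(2)[OF assms(1), of x r] by (simp add: scaleR_scaleC)
qed

lemma clinear_on_sum:
  assumes "clinear_on W X" "csubspace W" "\<And>i. i \<in> I \<Longrightarrow> f i \<in> W"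
  shows "X (sum f I) = (\<Sum>i\<in>I. X (f i))"
  using assms(3)
  by (induction I rule: infinite_finite_induct)
    (auto simp: clinear_on_more[OF assms(1,2)] clinear_onD[OF assms(1)] csubspace_sum[OF assms(2)])

text \<open>Two candidates differ by a vector of \<open>W\<close> that is orthogonal to itself.
  Existence is never derived abstractly: every use supplies the value \<open>y\<close>.\<close>

lemma adj_eqI:
  assumes "csubspace W" "y \<in> W" "\<And>z. z \<in> W \<Longrightarrow> cinner y z = cinner x (X z)"
  shows "adj W X x = y"
  unfolding adj_def
proof (rule the_equality)
  fix y' assume y': "y' \<in> W \<and> (\<forall>z\<in>W. cinner y' z = cinner x (X z))"
  then have "cinner (y' - y) (y' - y) = 0"
    using assms by (simp add: cinner.diff_left csubspaceD)
  then show "y' = y"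
    by (simp add: cinner_self)
qed (use assms in auto)

lemma unitary_op_norm: "unitary_op W X \<Longrightarrow> x \<in> W \<Longrightarrow> norm (X x) = norm x"
proof -
  assume "unitary_op W X" "x \<in> W"
  then have "cinner (X x) (X x) = cinner x x"
    by (auto simp: unitary_op_def)
  then have "(norm (X x))\<^sup>2 = (norm x)\<^sup>2"
    unfolding cinner_self of_real_eq_iff .
  then show ?thesis
    by (simp add: power2_eq_iff_nonneg)
qed

text \<open>Surjectivity on \<open>W\<close> supplies a preimage of \<open>x\<close>, and
  preservation of inner products makes this preimage the adjoint.\<close>

lemma unitary_op_adj:
  assumes "csubspace W" "unitary_op W X" "x \<in> W"
  shows "adj W X x \<in> W" "X (adj W X x) = x" "adj W X (X x) = x"
    "z \<in> W \<Longrightarrow> cinner (adj W X x) z = cinner x (X z)"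
proof -
  have *: "adj W X (X y) = y" if "y \<in> W" for y
    using assms that by (intro adj_eqI) (auto simp: unitary_op_def)
  obtain y where y: "y \<in> W" "x = X y"
    using assms(2,3) unfolding unitary_op_def by (metis imageE)
  show "adj W X x \<in> W" "X (adj W X x) = x" "adj W X (X x) = x"
    using y * assms(3) by auto
  show "z \<in> W \<Longrightarrow> cinner (adj W X x) z = cinner x (X z)"
    using y * assms(2) by (auto simp: unitary_op_def)
qed

section \<open>Integrals of piecewise continuous functions\<close>

text \<open>\<open>f\<close> may oscillate at \<open>a\<close>, so it need not extend continuously
  to \<open>{a..b}\<close>. Its primitive is Lipschitz with constant \<open>B\<close> and does
  extend; the fundamental theorem with derivatives in the interior only then yields integrability,
  for values in any Banach space.\<close>

lemma integrable_continuous_Ioc: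
  fixes f :: "real \<Rightarrow> 'a::banach"
  assumes cont: "continuous_on {a<..b} f" and bnd: "\<And>t. t \<in> {a<..b} \<Longrightarrow> norm (f t) \<le> B"
  shows "f integrable_on {a..b}"
proof (cases "a < b")
  case True
  have B: "0 \<le> B"
    using order_trans[OF norm_ge_zero bnd[of b]] True by auto
  have int: "f integrable_on {x..y}" if "a < x" "y \<le> b" for x y
    using that by (intro integrable_continuous_interval continuous_on_subset[OF cont]) auto
  \<comment> \<open>The primitive is anchored at \<open>b\<close>, the end point at which
    \<open>f\<close> is continuous.\<close>
  define G where "G x = - integral {x..b} f" for x
  have diff: "G y - G x = integral {x..y} f" if "a < x" "x \<le> y" "y \<le> b" for x y
    using Henstock_Kurzweil_Integration.integral_combine[of x y b f] int that by (auto simp: G_def algebra_simps)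
  have le: "norm (G y - G x) \<le> B * (y - x)" if "a < x" "x \<le> y" "y \<le> b" for x y
    unfolding diff[OF that] using that
    by (intro integral_bound continuous_on_subset[OF cont] bnd) auto
  have "B-lipschitz_on {a<..b} G"
  proof (rule lipschitz_onI)
    fix x y assume "x \<in> {a<..b}" "y \<in> {a<..b}"
    then show "dist (G x) (G y) \<le> B * dist x y"
      using le[of x y] le[of y x]
      by (cases "x \<le> y") (auto simp: dist_norm norm_minus_commute)
  qed fact
  then obtain g where g: "B-lipschitz_on (closure {a<..b}) g" "\<And>x. x \<in> {a<..b} \<Longrightarrow> g x = G x"
    using lipschitz_extend_closure by blast
  have "continuous_on {a..b} g"
    using lipschitz_on_continuous_on[OF g(1)] True by simp
  moreover have "(g has_vector_derivative f x) (at x)" if x: "x \<in> {a<..<b}" for x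
  proof -
    define c where "c = (a + x) / 2"
    have c: "a < c" "c < x" "x < b" using x by (auto simp: c_def)
    have "((\<lambda>u. integral {c..u} f) has_vector_derivative f x) (at x within {c..b})"
      using c by (intro integral_has_vector_derivative continuous_on_subset[OF cont]) auto
    then have "((\<lambda>u. integral {c..u} f) has_vector_derivative f x) (at x)"
      using c by (simp add: at_within_Icc_at)
    then have "((\<lambda>u. G c + integral {c..u} f) has_vector_derivative f x) (at x)"
      by (auto intro!: derivative_eq_intros)
    then show ?thesis
    proof (rule has_vector_derivative_transform_within_open[of _ _ _ "{c<..<b}"])
      fix u assume u: "u \<in> {c<..<b}"
      then show "G c + integral {c..u} f = g u"
        using diff[of c u] g(2)[of u] c by (simp add: algebra_simps)
    qed (use c in auto)
  qed
  ultimately have "(f has_integral (g b - g a)) {a..b}"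
    using True by (intro fundamental_theorem_of_calculus_interior) auto
  then show ?thesis by blast
next
  case False
  then have "negligible {a..b}"
    by (cases "a = b") auto
  then show ?thesis
    by (rule integrable_negligible)
qed

text \<open>Integrability is a local property. Near each point an interval is chosen that meets
  \<open>F\<close> at most in that point and is cut there, so both halves are half-open intervals of
  continuity.\<close>

lemma integrable_piecewise_continuous:
  fixes f :: "real \<Rightarrow> 'a::banach"
  assumes F: "finite F" and cont: "continuous_on ({a..b} - F) f"
    and bnd: "\<And>t. t \<in> {a..b} - F \<Longrightarrow> norm (f t) \<le> B"
  shows "f integrable_on {a..b}"
proof -
  have r: "f integrable_on {x..v}" if "{x<..v} \<subseteq> {a..b} - F" for x v
    using that bnd by (intro integrable_continuous_Ioc[where B=B] continuous_on_subset[OF cont]) auto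
  \<comment> \<open>Reflection of time turns a left half into a right half.\<close>
  have l: "f integrable_on {u..x}" if s: "{u..<x} \<subseteq> {a..b} - F" for x u
  proof -
    have "(\<lambda>t. f (- t)) integrable_on {- x..- u}"
    proof (rule integrable_continuous_Ioc[where B=B])
      show "continuous_on {- x<..- u} (\<lambda>t. f (- t))"
        by (rule continuous_on_compose2[OF continuous_on_subset[OF cont s]])
          (auto intro!: continuous_intros)
      fix t assume "t \<in> {- x<..- u}"
      then have "- t \<in> {u..<x}" by auto
      then show "norm (f (- t)) \<le> B" using s bnd by blast
    qed
    then show ?thesis by simp
  qed
  have "f integrable_on cbox a b"
  proof (rule integrable_on_little_subintervals, rule ballI)
    fix x assume "x \<in> cbox a b"
    obtain d where d: "d > 0" "\<And>y. y \<in> F \<Longrightarrow> y \<noteq> x \<Longrightarrow> d \<le> dist x y"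
      using finite_set_avoid[OF F, of x] by auto
    show "\<exists>d>0. \<forall>u v. x \<in> cbox u v \<and> cbox u v \<subseteq> ball x d \<and> cbox u v \<subseteq> cbox a b \<longrightarrow>
      f integrable_on cbox u v"
    proof (intro exI conjI allI impI, rule d(1), elim conjE)
      fix u v assume x: "x \<in> cbox u v" and b: "cbox u v \<subseteq> ball x d" and ab: "cbox u v \<subseteq> cbox a b"
      have n: "t \<in> {a..b} - F" if "t \<in> {u..v}" "t \<noteq> x" for t
      proof -
        have "dist x t < d" using b that by auto
        then show ?thesis using d(2)[of t] that ab by auto
      qed
      have "f integrable_on {u..x}" "f integrable_on {x..v}"
        by (rule l, use n x in auto) (rule r, use n x in auto)
      then show "f integrable_on cbox u v"
        using x Henstock_Kurzweil_Integration.integrable_combine[of u x v f] by auto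
    qed
  qed
  then show ?thesis by simp
qed

text \<open>Riemann sums stay in \<open>S\<close>, and \<open>S\<close> is closed. For a
  non-integrable \<open>f\<close> the convention that its \<open>integral\<close> is 0 is
  used.\<close>

lemma integral_in_subspace:
  fixes f :: "real \<Rightarrow> 'a::real_normed_vector"
  assumes S: "subspace S" "closed S" and f: "\<And>t. t \<in> {a..b} \<Longrightarrow> f t \<in> S"
  shows "integral {a..b} f \<in> S"
proof (cases "f integrable_on {a..b}")
  case True
  then have I: "(f has_integral integral {a..b} f) {a..b}"
    by (rule integrable_integral)
  have "integral {a..b} f \<in> closure S"
    unfolding closure_approachable
  proof (intro allI impI)
    fix e :: real assume "e > 0"
    then obtain g where g: "gauge g" "\<And>p. p tagged_division_of {a..b} \<Longrightarrow> g fine p \<Longrightarrow>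
        norm ((\<Sum>(x,k)\<in>p. measure lborel k *\<^sub>R f x) - integral {a..b} f) < e"
      using I unfolding has_integral_real by meson
    obtain p where p: "p tagged_division_of {a..b}" "g fine p"
      using fine_division_exists_real[OF g(1)] by blast
    have "(\<Sum>(x,k)\<in>p. measure lborel k *\<^sub>R f x) \<in> S"
    proof (rule subspace_sum[OF S(1)], clarify)
      fix x k assume "(x, k) \<in> p"
      then have "x \<in> {a..b}" using tagged_division_ofD(2,3)[OF p(1)] by (meson subsetD)
      then show "measure lborel k *\<^sub>R f x \<in> S" using f S(1) by (simp add: subspace_mul)
    qed
    then show "\<exists>y\<in>S. dist y (integral {a..b} f) < e"
      using g(2)[OF p] unfolding dist_norm by (rule bexI[rotated])
  qed
  then show ?thesis using S(2) by simp
next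
  case False
  then show ?thesis using S(1) by (simp add: not_integrable_integral subspace_0)
qed

lemma norm_integral_le_const:
  fixes f :: "real \<Rightarrow> 'a::banach"
  assumes "f integrable_on {a..b}" "a \<le> b" "\<And>t. t \<in> {a..b} \<Longrightarrow> norm (f t) \<le> B"
  shows "norm (integral {a..b} f) \<le> B * (b - a)"
proof -
  have "0 \<le> B" using assms(2) order_trans[OF norm_ge_zero assms(3)[of a]] by auto
  then show ?thesis
    using has_integral_bound_real[of B "{}" f "integral {a..b} f" a b] assms by (simp add: integrable_integral)
qed

lemma constant_if_derivative_zero:
  fixes f :: "real \<Rightarrow> 'a::banach"
  assumes "finite F" "a \<le> b" "continuous_on {a..b} f"
    "\<And>t. t \<in> {a<..<b} - F \<Longrightarrow> (f has_vector_derivative 0) (at t)"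
  shows "f b = f a"
proof -
  have "((\<lambda>_. 0) has_integral (f b - f a)) {a..b}"
    by (rule fundamental_theorem_of_calculus_interior_strong[OF assms(1,2)]) (use assms in auto)
  then show ?thesis
    by (metis has_integral_0_eq right_minus_eq)
qed

section \<open>Time evolution generated by a bounded, piecewise continuous Hamiltonian\<close>

text \<open>Strong continuity concerns a fixed vector. For a moving one, \<open>X t (y t)\<close> is
  split into \<open>X t (y t - y s) + X t (y s)\<close>: the uniform bound \<open>J\<close> controls
  the first term, strong continuity the second.\<close>

lemma strongly_continuous_apply:
  fixes X :: "real \<Rightarrow> 'h::complex_hilbert \<Rightarrow> 'k::real_normed_vector"
  assumes W: "csubspace W" and y: "continuous_on A y" "\<And>t. t \<in> A \<Longrightarrow> y t \<in> W"
    and diff: "\<And>t u v. t \<in> A \<Longrightarrow> u \<in> W \<Longrightarrow> v \<in> W \<Longrightarrow> X t (u - v) = X t u - X t v"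
    and bnd: "\<And>t u. t \<in> A \<Longrightarrow> u \<in> W \<Longrightarrow> norm (X t u) \<le> J * norm u"
    and cont: "\<And>u. u \<in> W \<Longrightarrow> continuous_on A (\<lambda>t. X t u)"
  shows "continuous_on A (\<lambda>t. X t (y t))"
  unfolding continuous_on_def
proof
  fix s assume s: "s \<in> A"
  let ?G = "at s within A"
  have ev: "\<forall>\<^sub>F t in ?G. t \<in> A"
    by (simp add: eventually_at_filter)
  have ys: "(y \<longlongrightarrow> y s) ?G"
    using y(1) s by (auto simp: continuous_on_def)
  have "((\<lambda>t. X t (y t - y s)) \<longlongrightarrow> 0) ?G"
  proof (rule Lim_null_comparison)
    show "\<forall>\<^sub>F t in ?G. norm (X t (y t - y s)) \<le> J * norm (y t - y s)"
      using ev by eventually_elim (use y(2) s in \<open>simp add: bnd csubspaceD(5)[OF W]\<close>)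
    show "((\<lambda>t. J * norm (y t - y s)) \<longlongrightarrow> 0) ?G"
      using tendsto_mult[OF tendsto_const[of J] tendsto_norm[OF tendsto_diff[OF ys tendsto_const[of "y s"]]]]
      by simp
  qed
  moreover have "((\<lambda>t. X t (y s)) \<longlongrightarrow> X s (y s)) ?G"
    using cont[of "y s"] s y(2) by (auto simp: continuous_on_def)
  ultimately have "((\<lambda>t. X t (y t - y s) + X t (y s)) \<longlongrightarrow> 0 + X s (y s)) ?G"
    by (rule tendsto_add)
  then have "((\<lambda>t. X t (y t - y s) + X t (y s)) \<longlongrightarrow> X s (y s)) ?G"
    by simp
  moreover have "\<forall>\<^sub>F t in ?G. X t (y t - y s) + X t (y s) = X t (y t)"
    using ev by eventually_elim (use y(2) s in \<open>simp add: diff\<close>)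
  ultimately show "((\<lambda>t. X t (y t)) \<longlongrightarrow> X s (y s)) ?G"
    by (rule Lim_transform_eventually)
qed

text \<open>\<open>F\<close> collects the jump times. Continuity is strong only, since conjugation
  by \<open>exp (i t B)\<close> with unbounded \<open>B\<close> is in general not continuous in
  operator norm.\<close>

locale evolution =
  fixes W :: "'h::complex_hilbert set" and H :: "real \<Rightarrow> 'h \<Rightarrow> 'h" and T J :: real
    and F :: "real set"
  assumes W: "csubspace W" "closed W"
    and nonneg: "0 \<le> T" "0 \<le> J"
    and F: "finite F"
    and lin: "t \<in> {0..T} \<Longrightarrow> clinear_on W (H t)"
    and mem: "t \<in> {0..T} \<Longrightarrow> x \<in> W \<Longrightarrow> H t x \<in> W"
    and bnd: "t \<in> {0..T} \<Longrightarrow> x \<in> W \<Longrightarrow> norm (H t x) \<le> J * norm x"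
    and herm: "t \<in> {0..T} \<Longrightarrow> x \<in> W \<Longrightarrow> y \<in> W \<Longrightarrow> cinner (H t x) y = cinner x (H t y)"
    and cont: "x \<in> W \<Longrightarrow> continuous_on ({0..T} - F) (\<lambda>t. H t x)"
begin

lemma continuous_on_H:
  assumes "continuous_on {0..T} \<psi>" "\<forall>t\<in>{0..T}. \<psi> t \<in> W"
  shows "continuous_on ({0..T} - F) (\<lambda>t. H t (\<psi> t))"
  by (rule strongly_continuous_apply[where W = W and J = J])
    (use assms W bnd cont clinear_on_more(3)[OF lin W(1)] in \<open>auto intro: continuous_on_subset\<close>)

lemma integrable_H:
  assumes "continuous_on {0..T} \<psi>" "\<forall>t\<in>{0..T}. \<psi> t \<in> W" "t \<in> {0..T}"
  shows "(\<lambda>s. H s (\<psi> s)) integrable_on {0..t}"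
proof -
  have "bounded (\<psi> ` {0..T})"
    by (intro compact_imp_bounded compact_continuous_image assms(1)) simp
  then obtain B where B: "\<forall>t\<in>{0..T}. norm (\<psi> t) \<le> B"
    by (auto simp: bounded_iff)
  have "(\<lambda>s. H s (\<psi> s)) integrable_on {0..T}"
  proof (rule integrable_piecewise_continuous[OF F continuous_on_H[OF assms(1,2)]])
    fix s assume s: "s \<in> {0..T} - F"
    then have "norm (H s (\<psi> s)) \<le> J * norm (\<psi> s)"
      using assms(2) by (intro bnd) auto
    also have "\<dots> \<le> J * B"
      using B s nonneg by (intro mult_left_mono) auto
    finally show "norm (H s (\<psi> s)) \<le> J * B" .
  qed
  then show ?thesis
    using assms(3) by (elim integrable_subinterval_real) auto
qed

lemma primitive_H:
  assumes "continuous_on {0..T} \<psi>" "\<forall>t\<in>{0..T}. \<psi> t \<in> W"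
  defines "w \<equiv> \<lambda>t. integral {0..t} (\<lambda>s. H s (\<psi> s))"
  shows "continuous_on {0..T} w" "\<forall>t\<in>{0..T}. w t \<in> W"
    "t \<in> {0<..<T} - F \<Longrightarrow> (w has_vector_derivative H t (\<psi> t)) (at t)"
proof -
  have int: "(\<lambda>s. H s (\<psi> s)) integrable_on {0..T}"
    using nonneg by (intro integrable_H[OF assms(1,2)]) simp_all
  then show "continuous_on {0..T} w"
    unfolding w_def by (rule indefinite_integral_continuous_1)
  show "\<forall>t\<in>{0..T}. w t \<in> W"
    unfolding w_def
    by (intro ballI integral_in_subspace[OF csubspace_imp_subspace[OF W(1)] W(2)])
      (use assms(2) in \<open>simp add: mem\<close>)
  assume t: "t \<in> {0<..<T} - F"
  \<comment> \<open>Openness upgrades the derivative relative to \<open>{0..T} - F\<close> to a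
    two-sided one.\<close>
  have o: "open ({0<..<T} - F)"
    by (intro open_Diff finite_imp_closed F) auto
  have "(w has_vector_derivative H t (\<psi> t)) (at t within ({0..T} - F))"
    unfolding w_def
  proof (rule integral_has_vector_derivative_continuous_at[OF int _ F])
    show "continuous (at t within {0..T} - F) (\<lambda>s. H s (\<psi> s))"
      unfolding continuous_within
      by (rule bspec[OF continuous_on_H[OF assms(1,2), unfolded continuous_on_def]]) (use t in simp)
  qed (use t in simp)
  moreover
  have "{0<..<T} - F \<subseteq> {0..T} - F"
    by auto
  ultimately
  have "(w has_vector_derivative H t (\<psi> t)) (at t within ({0<..<T} - F))"
    by (rule has_vector_derivative_within_subset)
  then show "(w has_vector_derivative H t (\<psi> t)) (at t)"
    unfolding at_within_open[OF t o] .
qed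

section \<open>Convergence of the Dyson series and its integral equation\<close>

lemma dyson_cont_mem:
  assumes x: "x \<in> W"
  shows "continuous_on {0..T} (\<lambda>t. dyson H n t x) \<and> (\<forall>t\<in>{0..T}. dyson H n t x \<in> W)"
proof (induction n)
  case (Suc n)
  then have "continuous_on {0..T} (\<lambda>t. dyson H n t x)" "\<forall>t\<in>{0..T}. dyson H n t x \<in> W"
    by auto
  note w = primitive_H(1,2)[OF this]
  show ?case
    unfolding dyson.simps
    using scaleC.continuous_on[OF continuous_on_const w(1)] csubspaceD(3)[OF W(1)] w(2) by blast
qed (simp add: x)

lemmas dyson_cont = dyson_cont_mem[THEN conjunct1]
lemmas dyson_mem = dyson_cont_mem[THEN conjunct2]
lemmas dyson_mem' = dyson_mem[rule_format]

text \<open>\<open>t ^ n / fact n\<close> is the volume of the simplex of ordered times; it builds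
  up because each order integrates the bound of the previous one.\<close>

lemma norm_dyson_le:
  assumes x: "x \<in> W" and t: "t \<in> {0..T}"
  shows "norm (dyson H n t x) \<le> (J * t) ^ n / fact n * norm x"
  using t
proof (induction n arbitrary: t)
  case (Suc n)
  have "((\<lambda>s. J * ((J * s) ^ n / fact n * norm x)) has_integral
      ((J * t) ^ Suc n / fact (Suc n) * norm x - (J * 0) ^ Suc n / fact (Suc n) * norm x)) {0..t}"
  proof (rule fundamental_theorem_of_calculus)
    fix s assume "s \<in> {0..t}"
    have "((\<lambda>s. s ^ Suc n * (J ^ Suc n / fact (Suc n) * norm x)) has_real_derivative
       (real (Suc n) * s ^ n) * (J ^ Suc n / fact (Suc n) * norm x)) (at s within {0..t})"
      using DERIV_pow[of "Suc n" s "{0..t}"] by (intro DERIV_cmult_right) simp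
    also have "(\<lambda>s. s ^ Suc n * (J ^ Suc n / fact (Suc n) * norm x)) =
        (\<lambda>s. (J * s) ^ Suc n / fact (Suc n) * norm x)"
      by (simp only: power_mult_distrib) (simp add: ac_simps)
    also have "(real (Suc n) * s ^ n) * (J ^ Suc n / fact (Suc n) * norm x) =
        J * ((J * s) ^ n / fact n * norm x)"
      by (simp add: power_mult_distrib del: of_nat_Suc)
    finally show "((\<lambda>s. (J * s) ^ Suc n / fact (Suc n) * norm x) has_vector_derivative
       J * ((J * s) ^ n / fact n * norm x)) (at s within {0..t})"
      by (simp add: has_real_derivative_iff_has_vector_derivative)
  qed (use Suc in auto)
  then have I: "((\<lambda>s. J * ((J * s) ^ n / fact n * norm x)) has_integral
      ((J * t) ^ Suc n / fact (Suc n) * norm x)) {0..t}"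
    by simp
  have "norm (integral {0..t} (\<lambda>s. H s (dyson H n s x)))
      \<le> integral {0..t} (\<lambda>s. J * ((J * s) ^ n / fact n * norm x))"
  proof (rule integral_norm_bound_integral)
    show "(\<lambda>s. H s (dyson H n s x)) integrable_on {0..t}"
      by (rule integrable_H) (use Suc x in \<open>auto intro: dyson_cont dyson_mem'\<close>)
    fix s assume s: "s \<in> {0..t}"
    then have "norm (H s (dyson H n s x)) \<le> J * norm (dyson H n s x)"
      using Suc x by (intro bnd dyson_mem') auto
    also have "\<dots> \<le> J * ((J * s) ^ n / fact n * norm x)"
      using Suc s nonneg by (intro mult_left_mono Suc.IH) auto
    finally show "norm (H s (dyson H n s x)) \<le> J * ((J * s) ^ n / fact n * norm x)" .
  qed (use I in blast)
  then show ?case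
    using integral_unique[OF I] by (simp add: norm_scaleC)
qed simp

lemma norm_dyson_le_uniform:
  assumes "x \<in> W" "t \<in> {0..T}"
  shows "norm (dyson H n t x) \<le> (J * T) ^ n / fact n * norm x"
proof -
  have "(J * t) ^ n \<le> (J * T) ^ n"
    using assms nonneg by (intro power_mono mult_left_mono) auto
  then have "(J * t) ^ n / fact n * norm x \<le> (J * T) ^ n / fact n * norm x"
    by (intro mult_right_mono divide_right_mono) auto
  then show ?thesis
    using norm_dyson_le[OF assms, of n] by linarith
qed

lemma summable_exp_terms: "summable (\<lambda>n. (J * T) ^ n / fact n * (c::real))"
  using summable_exp[of "J * T"] by (intro summable_mult2) (simp add: field_simps)

lemma dyson_sums:
  assumes "x \<in> W" "t \<in> {0..T}"
  shows "(\<lambda>n. dyson H n t x) sums time_ordered_exp H t x"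
  unfolding time_ordered_exp_def
  by (rule summable_sums, rule summable_comparison_test[OF _ summable_exp_terms[of "norm x"]])
    (use norm_dyson_le_uniform[OF assms] in blast)

lemma dyson_uniform_limit:
  assumes "x \<in> W"
  shows "uniform_limit {0..T} (\<lambda>n t. \<Sum>k<n. dyson H k t x) (\<lambda>t. time_ordered_exp H t x) sequentially"
  unfolding time_ordered_exp_def
  by (rule Weierstrass_m_test[OF _ summable_exp_terms[of "norm x"]])
    (use norm_dyson_le_uniform[OF assms] in blast)

text \<open>The last part identifies the partial sums with the Picard iterates of the integral
  equation; one application of \<open>H\<close> raises the order by one, hence the
  \<open>Suc n\<close>.\<close>

lemma dyson_partial_sum:
  assumes x: "x \<in> W"
  shows "continuous_on {0..T} (\<lambda>t. \<Sum>k<n. dyson H k t x)"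
    and "\<forall>t\<in>{0..T}. (\<Sum>k<n. dyson H k t x) \<in> W"
    and "t \<in> {0..T} \<Longrightarrow> (\<Sum>k<Suc n. dyson H k t x) =
      x + (- \<i>) *\<^sub>C integral {0..t} (\<lambda>s. H s (\<Sum>k<n. dyson H k s x))"
proof -
  show "continuous_on {0..T} (\<lambda>t. \<Sum>k<n. dyson H k t x)"
    by (intro continuous_on_sum dyson_cont x)
  show "\<forall>t\<in>{0..T}. (\<Sum>k<n. dyson H k t x) \<in> W"
    using dyson_mem'[OF x] by (auto intro: csubspace_sum[OF W(1)])
  assume t: "t \<in> {0..T}"
  have "integral {0..t} (\<lambda>s. H s (\<Sum>k<n. dyson H k s x)) =
      integral {0..t} (\<lambda>s. \<Sum>k<n. H s (dyson H k s x))"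
    by (rule Henstock_Kurzweil_Integration.integral_cong, rule clinear_on_sum[OF lin W(1)]) (use t x in \<open>auto intro: dyson_mem'\<close>)
  also have "\<dots> = (\<Sum>k<n. integral {0..t} (\<lambda>s. H s (dyson H k s x)))"
    by (rule Henstock_Kurzweil_Integration.integral_sum) (intro integrable_H dyson_cont dyson_mem x t finite_lessThan)+
  finally show "(\<Sum>k<Suc n. dyson H k t x) =
      x + (- \<i>) *\<^sub>C integral {0..t} (\<lambda>s. H s (\<Sum>k<n. dyson H k s x))"
    by (simp only: sum.lessThan_Suc_shift dyson.simps scaleC.sum_right)
qed

lemma time_ordered_exp_cont_mem:
  assumes x: "x \<in> W"
  shows "continuous_on {0..T} (\<lambda>t. time_ordered_exp H t x)"
    and "\<forall>t\<in>{0..T}. time_ordered_exp H t x \<in> W"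
proof -
  show "continuous_on {0..T} (\<lambda>t. time_ordered_exp H t x)"
    by (rule uniform_limit_theorem[OF _ dyson_uniform_limit[OF x]])
      (auto intro!: always_eventually dyson_partial_sum x)
  show "\<forall>t\<in>{0..T}. time_ordered_exp H t x \<in> W"
  proof
    fix t assume t: "t \<in> {0..T}"
    show "time_ordered_exp H t x \<in> W"
      by (rule closed_sequentially[OF W(2) _ dyson_sums[OF x t, unfolded sums_def]])
        (rule dyson_partial_sum(2)[OF x, rule_format, OF t])
  qed
qed

text \<open>The limit of the Picard iteration. Uniform convergence of the partial sums survives
  \<open>H s\<close> and the integral because the bound \<open>J\<close> does not depend on
  \<open>s\<close>.\<close>

lemma time_ordered_exp_integral_eq:
  assumes x: "x \<in> W" and t: "t \<in> {0..T}"
  shows "time_ordered_exp H t x =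
    x + (- \<i>) *\<^sub>C integral {0..t} (\<lambda>s. H s (time_ordered_exp H s x))"
proof -
  let ?P = "\<lambda>n s. \<Sum>k<n. dyson H k s x" and ?U = "\<lambda>s. time_ordered_exp H s x"
  note P = dyson_partial_sum[OF x] and U = time_ordered_exp_cont_mem[OF x]
  have "(\<lambda>n. integral {0..t} (\<lambda>s. H s (?P n s))) \<longlonglongrightarrow> integral {0..t} (\<lambda>s. H s (?U s))"
  proof (rule LIMSEQ_I)
    fix r :: real assume r: "r > 0"
    \<comment> \<open>The \<open>+ 1\<close> covers \<open>J * T = 0\<close> and makes the final
      estimate \<open>J * e * T < r\<close> strict.\<close>
    define e where "e = r / (J * T + 1)"
    have JT: "J * T \<ge> 0" using nonneg by simp
    then have e: "e > 0" using r by (simp add: e_def)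
    obtain N where N: "\<And>n s. n \<ge> N \<Longrightarrow> s \<in> {0..T} \<Longrightarrow> dist (?P n s) (?U s) < e"
      using dyson_uniform_limit[OF x] e unfolding uniform_limit_sequentially_iff by meson
    show "\<exists>N. \<forall>n\<ge>N. norm (integral {0..t} (\<lambda>s. H s (?P n s)) - integral {0..t} (\<lambda>s. H s (?U s))) < r"
    proof (intro exI allI impI)
      fix n assume n: "n \<ge> N"
      have "integral {0..t} (\<lambda>s. H s (?P n s)) - integral {0..t} (\<lambda>s. H s (?U s))
          = integral {0..t} (\<lambda>s. H s (?P n s) - H s (?U s))"
        by (rule Henstock_Kurzweil_Integration.integral_diff[symmetric]) (intro integrable_H P U t)+
      also have "norm \<dots> \<le> J * e * (t - 0)"
      proof (rule norm_integral_le_const)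
        show "(\<lambda>s. H s (?P n s) - H s (?U s)) integrable_on {0..t}"
          by (rule Henstock_Kurzweil_Integration.integrable_diff) (intro integrable_H P U t)+
        fix s assume "s \<in> {0..t}"
        then have s: "s \<in> {0..T}" using t by auto
        have "norm (H s (?P n s) - H s (?U s)) = norm (H s (?P n s - ?U s))"
          using clinear_on_more(3)[OF lin[OF s] W(1)] bspec[OF P(2) s] bspec[OF U(2) s] by simp
        also have "\<dots> \<le> J * norm (?P n s - ?U s)"
          by (rule bnd[OF s csubspaceD(5)[OF W(1) bspec[OF P(2) s] bspec[OF U(2) s]]])
        also have "\<dots> \<le> J * e"
          using N[OF n s] nonneg by (intro mult_left_mono) (auto simp: dist_norm)
        finally show "norm (H s (?P n s) - H s (?U s)) \<le> J * e" .
      qed (use t in auto)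
      also have "\<dots> \<le> J * e * T"
        using t e nonneg by (intro mult_left_mono) auto
      also have "\<dots> < r"
        using JT r by (simp add: e_def field_simps)
      finally show "norm (integral {0..t} (\<lambda>s. H s (?P n s)) - integral {0..t} (\<lambda>s. H s (?U s))) < r" .
    qed
  qed
  then have "(\<lambda>n. x + (- \<i>) *\<^sub>C integral {0..t} (\<lambda>s. H s (?P n s)))
      \<longlonglongrightarrow> x + (- \<i>) *\<^sub>C integral {0..t} (\<lambda>s. H s (?U s))"
    by (intro tendsto_add tendsto_const scaleC.tendsto)
  then have "(\<lambda>n. ?P (Suc n) t) \<longlonglongrightarrow> x + (- \<i>) *\<^sub>C integral {0..t} (\<lambda>s. H s (?U s))"
    unfolding P(3)[OF t] .
  moreover have "(\<lambda>n. ?P (Suc n) t) \<longlonglongrightarrow> ?U t"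
    using dyson_sums[OF x t] unfolding sums_def by (rule LIMSEQ_Suc)
  ultimately show ?thesis
    using LIMSEQ_unique by blast
qed

text \<open>The Schroedinger equation is imposed only between the jumps; continuity on all of
  \<open>{0..T}\<close> bridges them, which is enough for conserved quantities.\<close>

definition solution :: "(real \<Rightarrow> 'h) \<Rightarrow> bool" where
  "solution \<psi> \<longleftrightarrow> continuous_on {0..T} \<psi> \<and> (\<forall>t\<in>{0..T}. \<psi> t \<in> W) \<and>
     (\<forall>t\<in>{0<..<T} - F. (\<psi> has_vector_derivative (- \<i>) *\<^sub>C H t (\<psi> t)) (at t))"

lemma solution_time_ordered_exp:
  assumes x: "x \<in> W"
  shows "solution (\<lambda>t. time_ordered_exp H t x)" "time_ordered_exp H 0 x = x"
proof -
  let ?U = "\<lambda>s. time_ordered_exp H s x"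
  note U = time_ordered_exp_cont_mem[OF x] and eq = time_ordered_exp_integral_eq[OF x]
  have "(?U has_vector_derivative (- \<i>) *\<^sub>C H t (?U t)) (at t)" if t: "t \<in> {0<..<T} - F" for t
  proof -
    have "((\<lambda>t. x + (- \<i>) *\<^sub>C integral {0..t} (\<lambda>s. H s (?U s))) has_vector_derivative
        (- \<i>) *\<^sub>C H t (?U t)) (at t)"
      using bounded_linear.has_vector_derivative[OF scaleC.bounded_linear_right primitive_H(3)[OF U t]]
      by (auto intro!: derivative_eq_intros)
    then show ?thesis
      by (rule has_vector_derivative_transform_within_open[of _ _ _ "{0<..<T}"])
        (use t eq[symmetric] in auto)
  qed
  then show "solution ?U"
    using U by (auto simp: solution_def)
  show "?U 0 = x"
    using eq[of 0] nonneg by (simp add: scaleC.zero_right)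
qed

lemma solution_diff:
  assumes "solution \<psi>" "solution \<phi>"
  shows "solution (\<lambda>t. \<psi> t - \<phi> t)"
  unfolding solution_def
proof (intro conjI ballI)
  fix t assume t: "t \<in> {0<..<T} - F"
  have "((\<lambda>t. \<psi> t - \<phi> t) has_vector_derivative (- \<i>) *\<^sub>C H t (\<psi> t) - (- \<i>) *\<^sub>C H t (\<phi> t)) (at t)"
    using assms t by (intro has_vector_derivative_diff) (auto simp: solution_def)
  also have "(- \<i>) *\<^sub>C H t (\<psi> t) - (- \<i>) *\<^sub>C H t (\<phi> t) = (- \<i>) *\<^sub>C H t (\<psi> t - \<phi> t)"
    using assms t clinear_on_more(3)[OF lin[of t] W(1)] by (simp add: scaleC.diff_right solution_def)
  finally show "((\<lambda>t. \<psi> t - \<phi> t) has_vector_derivative (- \<i>) *\<^sub>C H t (\<psi> t - \<phi> t)) (at t)" .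
qed (use assms csubspaceD(5)[OF W(1)] in \<open>auto simp: solution_def intro!: continuous_intros\<close>)

text \<open>The factors \<open>- \<i>\<close> in the two arguments produce opposite signs, so
  Hermiticity cancels the two terms of the derivative.\<close>

lemma solution_cinner:
  assumes "solution \<phi>" "solution \<psi>"
  shows "cinner (\<phi> T) (\<psi> T) = cinner (\<phi> 0) (\<psi> 0)"
proof (rule constant_if_derivative_zero[OF F nonneg(1)])
  show "continuous_on {0..T} (\<lambda>t. cinner (\<phi> t) (\<psi> t))"
    using assms by (intro cinner.continuous_on) (auto simp: solution_def)
  fix t assume t: "t \<in> {0<..<T} - F"
  have "((\<lambda>t. cinner (\<phi> t) (\<psi> t)) has_vector_derivative
      cinner (\<phi> t) ((- \<i>) *\<^sub>C H t (\<psi> t)) + cinner ((- \<i>) *\<^sub>C H t (\<phi> t)) (\<psi> t)) (at t)"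
    using assms t by (intro cinner.has_vector_derivative) (auto simp: solution_def)
  moreover have "cinner (H t (\<phi> t)) (\<psi> t) = cinner (\<phi> t) (H t (\<psi> t))"
    using assms t by (intro herm) (auto simp: solution_def)
  ultimately show "((\<lambda>t. cinner (\<phi> t) (\<psi> t)) has_vector_derivative 0) (at t)"
    by (simp add: cinner_scaleC_left cinner_scaleC_right)
qed

text \<open>The difference of two solutions is a solution, so its norm is conserved. This isometry
  later gives continuity of the noise in the initial state.\<close>

lemma dist_time_ordered_exp:
  assumes "x \<in> W" "y \<in> W"
  shows "norm (time_ordered_exp H T x - time_ordered_exp H T y) = norm (x - y)"
proof -
  let ?d = "\<lambda>t. time_ordered_exp H t x - time_ordered_exp H t y"
  have "cinner (?d T) (?d T) = cinner (?d 0) (?d 0)"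
    using assms by (intro solution_cinner solution_diff solution_time_ordered_exp)
  then have "(norm (?d T))\<^sup>2 = (norm (x - y))\<^sup>2"
    unfolding cinner_self of_real_eq_iff using assms by (simp add: solution_time_ordered_exp)
  then show ?thesis
    by (simp add: power2_eq_iff_nonneg)
qed

lemma cinner_time_ordered_exp_self:
  assumes "x \<in> W" "y \<in> W"
  shows "cinner (time_ordered_exp H T x) (time_ordered_exp H T y) = cinner x y"
  using solution_cinner[OF solution_time_ordered_exp(1)[OF assms(1)] solution_time_ordered_exp(1)[OF assms(2)]]
    assms by (simp add: solution_time_ordered_exp)

text \<open>The adjoint of \<open>U(T)\<close> is the evolution backwards in time, generated by \<open>- H(T - t)\<close>.\<close>

lemma adj_time_ordered_exp:
  assumes x: "x \<in> W"
  shows "adj W (time_ordered_exp H T) x \<in> W"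
    and "z \<in> W \<Longrightarrow> cinner (adj W (time_ordered_exp H T) x) z = cinner x (time_ordered_exp H T z)"
proof -
  \<comment> \<open>The jump times are reflected together with time.\<close>
  interpret rev: evolution W "\<lambda>t x. - H (T - t) x" T J "(\<lambda>t. T - t) ` F"
  proof
    fix t x y assume t: "t \<in> {0..T}"
    then have t': "T - t \<in> {0..T}" by auto
    show "clinear_on W (\<lambda>x. - H (T - t) x)"
      using lin[OF t'] by (auto simp: clinear_on_def scaleC.minus_right)
    assume x: "x \<in> W"
    show "- H (T - t) x \<in> W" "norm (- H (T - t) x) \<le> J * norm x"
      using mem[OF t' x] bnd[OF t' x] csubspaceD[OF W(1)] by auto
    assume "y \<in> W"
    then show "cinner (- H (T - t) x) y = cinner x (- H (T - t) y)"
      using herm[OF t' x] by (simp add: cinner.minus_left cinner.minus_right)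
  next
    fix x assume "x \<in> W"
    have "T - t \<in> {0..T} - F" if "t \<in> {0..T} - (\<lambda>t. T - t) ` F" for t
      using that by (auto intro: image_eqI[of _ _ "T - t"])
    then show "continuous_on ({0..T} - (\<lambda>t. T - t) ` F) (\<lambda>t. - H (T - t) x)"
      by (intro continuous_on_minus continuous_on_compose2[OF cont[OF \<open>x \<in> W\<close>]] continuous_intros) blast
  qed (use W nonneg F in auto)
  let ?G = "\<lambda>t x. - H (T - t) x"
  let ?y = "time_ordered_exp ?G T x"
  \<comment> \<open>Read backwards, the reversed evolution solves the original equation and runs
    from \<open>?y\<close> at time 0 to \<open>x\<close> at time \<open>T\<close>. Its conserved
    inner product with the evolution of \<open>z\<close>, evaluated at both ends, is the adjoint
    relation.\<close>
  have "solution (\<lambda>t. time_ordered_exp ?G (T - t) x)"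
    unfolding solution_def
  proof (intro conjI ballI)
    note sol = rev.solution_time_ordered_exp(1)[OF x, unfolded rev.solution_def]
    show "continuous_on {0..T} (\<lambda>t. time_ordered_exp ?G (T - t) x)"
      by (rule continuous_on_compose2[OF sol[THEN conjunct1]]) (auto intro!: continuous_intros)
    fix t assume "t \<in> {0..T}"
    then show "time_ordered_exp ?G (T - t) x \<in> W"
      using sol by auto
  next
    note sol = rev.solution_time_ordered_exp(1)[OF x, unfolded rev.solution_def]
    fix t assume t: "t \<in> {0<..<T} - F"
    have 1: "((\<lambda>s. T - s) has_vector_derivative (- 1)) (at t)"
      by (auto intro!: derivative_eq_intros)
    have "((\<lambda>t. time_ordered_exp ?G t x) has_vector_derivative
        (- \<i>) *\<^sub>C ?G (T - t) (time_ordered_exp ?G (T - t) x)) (at (T - t))"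
      by (rule bspec[OF sol[THEN conjunct2, THEN conjunct2]]) (use t in auto)
    from vector_diff_chain_at[OF 1 this]
    show "((\<lambda>t. time_ordered_exp ?G (T - t) x) has_vector_derivative
        (- \<i>) *\<^sub>C H t (time_ordered_exp ?G (T - t) x)) (at t)"
      by (simp add: o_def scaleC.minus_right)
  qed
  note rsol = this
  have yW: "?y \<in> W"
    using rev.time_ordered_exp_cont_mem(2)[OF x] nonneg by auto
  have eq: "cinner ?y z = cinner x (time_ordered_exp H T z)" if z: "z \<in> W" for z
    using solution_cinner[OF rsol solution_time_ordered_exp(1)[OF z]] z x
    by (simp add: rev.solution_time_ordered_exp(2) solution_time_ordered_exp(2))
  have "adj W (time_ordered_exp H T) x = ?y"
    by (rule adj_eqI[OF W(1) yW eq])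
  then show "adj W (time_ordered_exp H T) x \<in> W"
    "z \<in> W \<Longrightarrow> cinner (adj W (time_ordered_exp H T) x) z = cinner x (time_ordered_exp H T z)"
    using yW eq by auto
qed

section \<open>The noise in a single state\<close>

lemma expect_noise:
  assumes v: "v \<in> W"
  defines "U \<equiv> time_ordered_exp H T"
  shows "expect v (\<lambda>v. adj W U (U v - v) - (U v - v)) = complex_of_real ((norm (U v - v))\<^sup>2)"
    and "expect v (\<lambda>v. 2 *\<^sub>C v - U v - adj W U v) = complex_of_real ((norm (U v - v))\<^sup>2)"
proof -
  have U: "U v \<in> W"
    using time_ordered_exp_cont_mem(2)[OF v] nonneg by (auto simp: U_def)
  then have d: "U v - v \<in> W"
    using v by (rule csubspaceD(5)[OF W(1)])
  have a: "cinner v (adj W U x) = cinner (U v) x" if "x \<in> W" for x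
    using adj_time_ordered_exp(2)[OF that v] unfolding U_def[symmetric]
    by (metis cinner_commute)
  \<comment> \<open>For the second form: it lets one of the two copies of \<open>cinner v v\<close>
    stand for \<open>cinner (U v) (U v)\<close>, so that the square can be completed.\<close>
  have i: "cinner (U v) (U v) = cinner v v"
    using cinner_time_ordered_exp_self[OF v v] by (simp add: U_def)
  show "expect v (\<lambda>v. adj W U (U v - v) - (U v - v)) = complex_of_real ((norm (U v - v))\<^sup>2)"
    unfolding expect_def cinner_self[symmetric]
    by (simp add: cinner.diff_right cinner.diff_left a[OF d])
  show "expect v (\<lambda>v. 2 *\<^sub>C v - U v - adj W U v) = complex_of_real ((norm (U v - v))\<^sup>2)"
    unfolding expect_def cinner_self[symmetric]
    by (simp add: cinner.diff_right cinner.diff_left a[OF v] i cinner_scaleC_right)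
qed

lemma norm_noise_le:
  assumes v: "v \<in> W" "norm v = 1"
  defines "U \<equiv> time_ordered_exp H T"
  shows "(norm (U v - v))\<^sup>2 \<le> (norm (integral {0..T} (\<lambda>t. H t v)))\<^sup>2
    + 2 * (exp (J * T) - 1 - J * T - (J * T)\<^sup>2 / 2)"
proof -
  have T: "T \<in> {0..T}" using nonneg by simp
  \<comment> \<open>\<open>inner\<close> is the real part of \<open>cinner\<close>, so
    \<open>d n\<close> is the real part of the amplitude of order \<open>n\<close>.\<close>
  define d where "d n = inner v (dyson H n T v)" for n
  define w where "w t = integral {0..t} (\<lambda>s. H s v)" for t
  have cv: "continuous_on {0..T} (\<lambda>_. v)" by simp
  have mv: "\<forall>t\<in>{0..T}. v \<in> W" using v by simp
  note w = primitive_H[OF cv mv, folded w_def]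
  have intH: "(\<lambda>t. H t v) integrable_on {0..T}"
    by (rule integrable_H[OF cv mv T])
  have d0: "d 0 = 1"
    using v by (simp add: d_def power2_norm_eq_inner[symmetric])
  \<comment> \<open>Hermiticity makes this number equal to its conjugate, hence real; the factor
    \<open>- \<i>\<close> of the first order then leaves no real part.\<close>
  have "cinner v (w T) = integral {0..T} (\<lambda>t. cinner v (H t v))"
    using integral_linear[OF intH cinner.bounded_linear_right[of v]] by (simp add: w_def o_def)
  also have "\<dots> = integral {0..T} (\<lambda>t. cinner (H t v) v)"
    by (rule Henstock_Kurzweil_Integration.integral_cong) (use herm v in auto)
  also have "\<dots> = cinner (w T) v"
    using integral_linear[OF intH cinner.bounded_linear_left[of v]] by (simp add: w_def o_def)
  finally have "Im (cinner v (w T)) = 0"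
    by (metis cinner_commute complex_cnj_cancel_iff Reals_cnj_iff complex_is_Real_iff)
  then have d1: "d 1 = 0"
    by (simp add: d_def Re_cinner[symmetric] cinner_scaleC_right w_def)
  \<comment> \<open>The second-order term is \<open>- \<integral> \<langle>w'(s), w(s)\<rangle> ds\<close>, and \<open>2 Re \<langle>w', w\<rangle>\<close> is the derivative of \<open>\<parallel>w\<parallel>\<^sup>2\<close>.\<close>
  have int2: "(\<lambda>s. H s (w s)) integrable_on {0..T}"
    by (rule integrable_H[OF w(1,2) T])
  have "dyson H 2 T v = (- \<i>) *\<^sub>C integral {0..T} (\<lambda>s. H s ((- \<i>) *\<^sub>C w s))"
    by (simp add: numeral_2_eq_2 w_def)
  also have "integral {0..T} (\<lambda>s. H s ((- \<i>) *\<^sub>C w s)) = integral {0..T} (\<lambda>s. (- \<i>) *\<^sub>C H s (w s))"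
    by (rule Henstock_Kurzweil_Integration.integral_cong) (rule clinear_onD(2)[OF lin], use w in auto)
  also have "\<dots> = (- \<i>) *\<^sub>C integral {0..T} (\<lambda>s. H s (w s))"
    using integral_linear[OF int2 scaleC.bounded_linear_right[of "- \<i>"]] by (simp add: o_def)
  finally have "dyson H 2 T v = - integral {0..T} (\<lambda>s. H s (w s))"
    by (simp add: scaleC_scaleC scaleC_minus_one)
  then have "d 2 = - integral {0..T} (\<lambda>s. inner v (H s (w s)))"
    using integral_linear[OF int2 bounded_linear_inner_right[of v]] by (simp add: d_def o_def)
  also have "integral {0..T} (\<lambda>s. inner v (H s (w s))) = integral {0..T} (\<lambda>s. inner (H s v) (w s))"
    by (rule Henstock_Kurzweil_Integration.integral_cong)
      (use herm v w in \<open>simp add: Re_cinner[symmetric]\<close>)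
  finally have d2: "d 2 = - integral {0..T} (\<lambda>s. inner (H s v) (w s))" .
  have "((\<lambda>s. 2 * inner (H s v) (w s)) has_integral (inner (w T) (w T) - inner (w 0) (w 0))) {0..T}"
  proof (rule fundamental_theorem_of_calculus_interior_strong[OF F nonneg(1)])
    show "continuous_on {0..T} (\<lambda>s. inner (w s) (w s))"
      by (intro continuous_on_inner w)
    fix t assume t: "t \<in> {0<..<T} - F"
    show "((\<lambda>s. inner (w s) (w s)) has_vector_derivative 2 * inner (H t v) (w t)) (at t)"
      using bounded_bilinear.has_vector_derivative[OF bounded_bilinear_inner w(3)[OF t] w(3)[OF t]]
      by (simp add: inner_commute)
  qed
  from integral_unique[OF this] have "2 * d 2 = - (norm (w T))\<^sup>2"
    by (simp add: d2 w_def power2_norm_eq_inner)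
  moreover have ds: "d sums inner v (U v)"
    unfolding d_def U_def using dyson_sums[OF v(1) T] by (rule bounded_linear.sums[OF bounded_linear_inner_right])
  \<comment> \<open>Orders 0, 1 and 2 contribute 1, 0 and minus half the square of
    \<open>norm (w T)\<close>; the remaining series starts at order 3, as does the tail of the
    exponential.\<close>
  then have "inner v (U v) = (\<Sum>n. d (n + 3)) + (\<Sum>n<3. d n)"
    using suminf_split_initial_segment[of d 3] by (auto simp: sums_iff)
  ultimately have split: "inner v (U v) = (\<Sum>n. d (n + 3)) + 1 - (norm (w T))\<^sup>2 / 2"
    using d0 d1 by (simp add: numeral_3_eq_3 numeral_2_eq_2)
  let ?e = "\<lambda>n. (J * T) ^ n / fact n"
  have es: "?e sums exp (J * T)"
    using exp_converges[of "J * T"] by (simp add: field_simps)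
  then have e3: "(\<Sum>n. ?e (n + 3)) = exp (J * T) - 1 - J * T - (J * T)\<^sup>2 / 2"
    using suminf_split_initial_segment[of ?e 3]
    by (auto simp: sums_iff numeral_3_eq_3 numeral_2_eq_2)
  have es3: "summable (\<lambda>n. ?e (n + 3))"
    using es by (intro summable_ignore_initial_segment) (auto simp: sums_iff)
  have "norm (d n) \<le> ?e n" for n
    using norm_dyson_le[OF v(1) T, of n] Cauchy_Schwarz_ineq2[of v "dyson H n T v"] v(2)
    by (simp add: d_def)
  then have "norm (\<Sum>n. d (n + 3)) \<le> (\<Sum>n. ?e (n + 3))"
    by (intro norm_suminf_le es3) auto
  then have "- (\<Sum>n. d (n + 3)) \<le> exp (J * T) - 1 - J * T - (J * T)\<^sup>2 / 2"
    using e3 by simp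
  moreover have "norm (U v) = norm v"
    using cinner_time_ordered_exp_self[OF v(1) v(1)]
    unfolding cinner_self of_real_eq_iff U_def by (simp add: power2_eq_iff_nonneg)
  \<comment> \<open>This doubles the second-order half square into a full one and puts the factor 2
    in front of the tail.\<close>
  then have "(norm (U v - v))\<^sup>2 = 2 - 2 * inner v (U v)"
    using v(2) by (simp add: power2_norm_eq_inner inner_diff inner_commute norm_eq_1)
  ultimately show ?thesis
    using split by (simp add: w_def)
qed

end

section \<open>Tensor products\<close>

lemma csubspace_qubit_space: "csubspace (qubit_space Q)"
  by (auto simp: csubspace_def qubit_space_def scaleC_vec_def scaleC_complex_def)

lemma axis_in_qubit_space: "s \<subseteq> Q \<Longrightarrow> axis s 1 \<in> qubit_space Q"
  by (auto simp: qubit_space_def axis_def)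

lemma qubit_space_expand:
  assumes "\<psi> \<in> qubit_space Q"
  shows "\<psi> = (\<Sum>s\<in>Pow Q. (\<psi> $ s) *\<^sub>C axis s 1)"
proof -
  have "(\<Sum>s\<in>Pow Q. (\<psi> $ s) *\<^sub>C axis s 1) $ r = \<psi> $ r" for r
  proof -
    have "(\<Sum>s\<in>Pow Q. (\<psi> $ s) *\<^sub>C axis s 1) $ r = (\<Sum>s\<in>Pow Q. if s = r then \<psi> $ s else 0)"
      unfolding sum_component
      by (rule sum.cong) (auto simp: scaleC_vec_def axis_def scaleC_complex_def)
    also have "\<dots> = \<psi> $ r"
      using assms by (auto simp: sum.delta' qubit_space_def)
    finally show ?thesis .
  qed
  then show ?thesis
    by (simp add: vec_eq_iff)
qed

lemma clinear_on_qubit_expand: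
  assumes "clinear_on (qubit_space Q) X" "\<psi> \<in> qubit_space Q"
  shows "X \<psi> = (\<Sum>s\<in>Pow Q. (\<psi> $ s) *\<^sub>C X (axis s 1))"
proof -
  have "X \<psi> = X (\<Sum>s\<in>Pow Q. (\<psi> $ s) *\<^sub>C axis s 1)"
    using qubit_space_expand[OF assms(2)] by simp
  also have "\<dots> = (\<Sum>s\<in>Pow Q. X ((\<psi> $ s) *\<^sub>C axis s 1))"
    by (intro clinear_on_sum[OF assms(1)] csubspace_qubit_space csubspaceD(3) axis_in_qubit_space) auto
  also have "\<dots> = (\<Sum>s\<in>Pow Q. (\<psi> $ s) *\<^sub>C X (axis s 1))"
    by (intro sum.cong refl clinear_onD(2)[OF assms(1)] axis_in_qubit_space) auto
  finally show ?thesis .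
qed

lemma clinear_on_qubit_component:
  assumes "clinear_on (qubit_space Q) X" "\<psi> \<in> qubit_space Q"
  shows "X \<psi> $ r = (\<Sum>s\<in>Pow Q. \<psi> $ s * X (axis s 1) $ r)"
  using arg_cong[OF clinear_on_qubit_expand[OF assms], of "\<lambda>x. x $ r"]
  by (simp add: scaleC_vec_def scaleC_complex_def)

text \<open>Reads components as inner products, so that adjoint relations pass to matrix
  elements.\<close>

lemma cinner_axis: "cinner (axis s 1) \<psi> = (\<psi> :: (complex, _::finite) vec) $ s"
proof -
  have "cinner (axis s 1) \<psi> = (\<Sum>i\<in>UNIV. if i = s then \<psi> $ i else 0)"
    unfolding cinner_vec_def by (intro sum.cong) (auto simp: axis_def cinner_complex_def)
  then show ?thesis by simp
qed

lemma csubspace_joint_space: "csubspace W \<Longrightarrow> csubspace (joint_space Q W)"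
  by (auto simp: csubspace_def joint_space_def scaleC_vec_def scaleC.zero_right)

lemma closed_joint_space:
  assumes "closed W"
  shows "closed (joint_space Q W)"
proof -
  have "joint_space Q W = (\<Inter>s. (\<lambda>\<psi>. \<psi> $ s) -` (if s \<subseteq> Q then W else {0}))"
    unfolding joint_space_def set_eq_iff by (simp split: if_split) blast
  moreover have "closed \<dots>"
    using assms by (intro closed_INT ballI closed_vimage continuous_on_component continuous_on_id) auto
  ultimately show ?thesis by simp
qed

lemma cinner_joint_space:
  assumes "\<psi> \<in> joint_space Q W"
  shows "cinner \<psi> \<phi> = (\<Sum>s\<in>Pow Q. cinner (\<psi> $ s) (\<phi> $ s))"
  unfolding cinner_vec_def using assms
  by (intro sum.mono_neutral_right) (auto simp: joint_space_def cinner.zero_left)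

lemma cinner_joint_space':
  assumes "\<phi> \<in> joint_space Q W"
  shows "cinner \<psi> \<phi> = (\<Sum>s\<in>Pow Q. cinner (\<psi> $ s) (\<phi> $ s))"
  unfolding cinner_vec_def using assms
  by (intro sum.mono_neutral_right) (auto simp: joint_space_def cinner.zero_right)

lemma joint_spaceD: "\<psi> \<in> joint_space Q W \<Longrightarrow> s \<in> Pow Q \<Longrightarrow> \<psi> $ s \<in> W"
  by (auto simp: joint_space_def)

lemma tensor_op_nth: "tensor_op Q S B \<psi> $ s = (\<Sum>s'\<in>Pow Q. (S (axis s' 1) $ s) *\<^sub>C B (\<psi> $ s'))"
  by (simp add: tensor_op_def)

lemma tensor_op_mem:
  assumes W: "csubspace W" and S: "S ` qubit_space Q \<subseteq> qubit_space Q" and B: "B ` W \<subseteq> W"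
    and \<psi>: "\<psi> \<in> joint_space Q W"
  shows "tensor_op Q S B \<psi> \<in> joint_space Q W"
  unfolding joint_space_def
proof (intro CollectI conjI allI impI)
  fix s assume "s \<subseteq> Q"
  then show "tensor_op Q S B \<psi> $ s \<in> W"
    unfolding tensor_op_nth
    using B joint_spaceD[OF \<psi>] by (intro csubspace_sum csubspaceD(3) W) auto
next
  fix s assume s: "\<not> s \<subseteq> Q"
  have "S (axis s' 1) $ s = 0" if "s' \<in> Pow Q" for s'
    using that S axis_in_qubit_space[of s' Q] s by (auto simp: qubit_space_def)
  then show "tensor_op Q S B \<psi> $ s = 0"
    unfolding tensor_op_nth by (simp add: scaleC_zero)
qed

lemma clinear_on_tensor_op:
  assumes "clinear_on W B"
  shows "clinear_on (joint_space Q W) (tensor_op Q S B)"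
  unfolding clinear_on_def
  by (auto simp: vec_eq_iff tensor_op_nth scaleC_vec_def joint_spaceD clinear_onD[OF assms]
      scaleC_add_right sum.distrib scaleC.sum_right scaleC_left_commute)

text \<open>Matrix multiplication in the system factor: the sum over intermediate basis states
  \<open>s'\<close> is the expansion of \<open>S (S' (axis r 1))\<close> by linearity of
  \<open>S\<close>.\<close>

lemma tensor_op_compose:
  assumes W: "csubspace W" and S: "clinear_on (qubit_space Q) S" and B: "clinear_on W B"
    and S': "S' ` qubit_space Q \<subseteq> qubit_space Q" and B': "B' ` W \<subseteq> W"
    and \<psi>: "\<psi> \<in> joint_space Q W"
  shows "tensor_op Q S B (tensor_op Q S' B' \<psi>) = tensor_op Q (\<lambda>x. S (S' x)) (\<lambda>x. B (B' x)) \<psi>"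
  unfolding vec_eq_iff
proof
  fix s
  have B\<psi>: "B' (\<psi> $ r) \<in> W" if "r \<in> Pow Q" for r
    using B' joint_spaceD[OF \<psi> that] by auto
  have "tensor_op Q S B (tensor_op Q S' B' \<psi>) $ s =
      (\<Sum>s'\<in>Pow Q. (S (axis s' 1) $ s) *\<^sub>C B (\<Sum>r\<in>Pow Q. (S' (axis r 1) $ s') *\<^sub>C B' (\<psi> $ r)))"
    by (simp add: tensor_op_nth)
  also have "\<dots> = (\<Sum>s'\<in>Pow Q. \<Sum>r\<in>Pow Q. (S (axis s' 1) $ s * S' (axis r 1) $ s') *\<^sub>C B (B' (\<psi> $ r)))"
  proof (rule sum.cong[OF refl])
    fix s' assume "s' \<in> Pow Q"
    have "B (\<Sum>r\<in>Pow Q. (S' (axis r 1) $ s') *\<^sub>C B' (\<psi> $ r)) =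
        (\<Sum>r\<in>Pow Q. B ((S' (axis r 1) $ s') *\<^sub>C B' (\<psi> $ r)))"
      by (intro clinear_on_sum[OF B W] csubspaceD(3)[OF W] B\<psi>)
    also have "\<dots> = (\<Sum>r\<in>Pow Q. (S' (axis r 1) $ s') *\<^sub>C B (B' (\<psi> $ r)))"
      by (intro sum.cong refl clinear_onD(2)[OF B] B\<psi>)
    finally show "(S (axis s' 1) $ s) *\<^sub>C B (\<Sum>r\<in>Pow Q. (S' (axis r 1) $ s') *\<^sub>C B' (\<psi> $ r)) =
        (\<Sum>r\<in>Pow Q. (S (axis s' 1) $ s * S' (axis r 1) $ s') *\<^sub>C B (B' (\<psi> $ r)))"
      by (simp add: scaleC.sum_right scaleC_scaleC)
  qed
  also have "\<dots> = (\<Sum>r\<in>Pow Q. \<Sum>s'\<in>Pow Q. (S (axis s' 1) $ s * S' (axis r 1) $ s') *\<^sub>C B (B' (\<psi> $ r)))"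
    by (rule sum.swap)
  also have "\<dots> = (\<Sum>r\<in>Pow Q. (S (S' (axis r 1)) $ s) *\<^sub>C B (B' (\<psi> $ r)))"
  proof (rule sum.cong[OF refl])
    fix r assume "r \<in> Pow Q"
    then have "S' (axis r 1) \<in> qubit_space Q"
      using S' axis_in_qubit_space[of r Q] by auto
    then have "S (S' (axis r 1)) $ s = (\<Sum>s'\<in>Pow Q. S (axis s' 1) $ s * S' (axis r 1) $ s')"
      by (subst clinear_on_qubit_component[OF S]) (simp_all add: mult.commute)
    then show "(\<Sum>s'\<in>Pow Q. (S (axis s' 1) $ s * S' (axis r 1) $ s') *\<^sub>C B (B' (\<psi> $ r))) =
        (S (S' (axis r 1)) $ s) *\<^sub>C B (B' (\<psi> $ r))"
      by (simp add: scaleC.sum_left)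
  qed
  finally show "tensor_op Q S B (tensor_op Q S' B' \<psi>) $ s =
      tensor_op Q (\<lambda>x. S (S' x)) (\<lambda>x. B (B' x)) \<psi> $ s"
    by (simp add: tensor_op_nth)
qed

lemma tensor_op_identity:
  assumes \<psi>: "\<psi> \<in> joint_space Q W" and S: "\<And>x. x \<in> qubit_space Q \<Longrightarrow> S x = x"
    and B: "\<And>x. x \<in> W \<Longrightarrow> B x = x"
  shows "tensor_op Q S B \<psi> = \<psi>"
  unfolding vec_eq_iff
proof
  fix s
  have "tensor_op Q S B \<psi> $ s = (\<Sum>s'\<in>Pow Q. if s' = s then \<psi> $ s' else 0)"
    unfolding tensor_op_nth
  proof (rule sum.cong[OF refl])
    fix r assume r: "r \<in> Pow Q"
    have "S (axis r 1) = axis r 1" "B (\<psi> $ r) = \<psi> $ r"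
      using r by (auto intro!: S B axis_in_qubit_space joint_spaceD[OF \<psi>])
    then show "(S (axis r 1) $ s) *\<^sub>C B (\<psi> $ r) = (if r = s then \<psi> $ r else 0)"
      by (simp add: axis_def scaleC_one scaleC_zero)
  qed
  also have "\<dots> = \<psi> $ s"
    using \<psi> by (auto simp: sum.delta' joint_space_def)
  finally show "tensor_op Q S B \<psi> $ s = \<psi> $ s" .
qed

text \<open>On matrix elements the assumption on \<open>S\<close> and \<open>S'\<close> is conjugate
  transposition; the bath operators are moved across component by component.\<close>

lemma cinner_tensor_op:
  assumes \<psi>: "\<psi> \<in> joint_space Q W" and \<phi>: "\<phi> \<in> joint_space Q W"
    and S: "\<And>x y. x \<in> qubit_space Q \<Longrightarrow> y \<in> qubit_space Q \<Longrightarrow> cinner (S x) y = cinner x (S' y)"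
    and B: "\<And>x y. x \<in> W \<Longrightarrow> y \<in> W \<Longrightarrow> cinner (B x) y = cinner x (B' y)"
  shows "cinner (tensor_op Q S B \<psi>) \<phi> = cinner \<psi> (tensor_op Q S' B' \<phi>)"
proof -
  have m: "cnj (S (axis r 1) $ s) = S' (axis s 1) $ r" if "r \<in> Pow Q" "s \<in> Pow Q" for r s
  proof -
    have "cnj (S (axis r 1) $ s) = cinner (S (axis r 1)) (axis s 1)"
      by (metis cinner_axis cinner_commute)
    also have "\<dots> = cinner (axis r 1) (S' (axis s 1))"
      using that by (intro S axis_in_qubit_space) auto
    also have "\<dots> = S' (axis s 1) $ r"
      by (rule cinner_axis)
    finally show ?thesis .
  qed
  have "cinner (tensor_op Q S B \<psi>) \<phi> =
      (\<Sum>s\<in>Pow Q. \<Sum>r\<in>Pow Q. cnj (S (axis r 1) $ s) * cinner (B (\<psi> $ r)) (\<phi> $ s))"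
    by (simp add: cinner_joint_space'[OF \<phi>] tensor_op_nth cinner.sum_left cinner_scaleC_left)
  also have "\<dots> = (\<Sum>r\<in>Pow Q. \<Sum>s\<in>Pow Q. cnj (S (axis r 1) $ s) * cinner (B (\<psi> $ r)) (\<phi> $ s))"
    by (rule sum.swap)
  also have "\<dots> = (\<Sum>r\<in>Pow Q. \<Sum>s\<in>Pow Q. S' (axis s 1) $ r * cinner (\<psi> $ r) (B' (\<phi> $ s)))"
    by (intro sum.cong refl) (simp add: m B joint_spaceD[OF \<psi>] joint_spaceD[OF \<phi>])
  also have "\<dots> = cinner \<psi> (tensor_op Q S' B' \<phi>)"
    by (simp add: cinner_joint_space[OF \<psi>] tensor_op_nth cinner.sum_right cinner_scaleC_right)
  finally show ?thesis .
qed

lemma product_state_mem: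
  "csubspace W \<Longrightarrow> \<Psi> \<in> qubit_space Q \<Longrightarrow> \<Phi> \<in> W \<Longrightarrow> product_state \<Psi> \<Phi> \<in> joint_space Q W"
  by (auto simp: product_state_def joint_space_def qubit_space_def csubspaceD scaleC_zero)

lemma cinner_product_state:
  "cinner (product_state \<Psi> \<Phi>) (product_state \<Psi>' \<Phi>') = cinner \<Psi> \<Psi>' * cinner \<Phi> \<Phi>'"
  by (simp add: product_state_def cinner_vec_def cinner_scaleC_left cinner_scaleC_right
      cinner_complex_def sum_distrib_left ac_simps)

lemma norm_product_state: "norm (product_state \<Psi> \<Phi>) = norm \<Psi> * norm \<Phi>"
proof -
  have "complex_of_real ((norm (product_state \<Psi> \<Phi>))\<^sup>2) = complex_of_real ((norm \<Psi> * norm \<Phi>)\<^sup>2)"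
    unfolding cinner_self[symmetric] cinner_product_state
    by (simp add: cinner_self power_mult_distrib)
  then show ?thesis
    unfolding of_real_eq_iff by (simp add: power2_eq_iff_nonneg)
qed

lemma continuous_on_product_state: "continuous_on A (\<lambda>\<Psi>. product_state \<Psi> \<Phi>)"
  unfolding product_state_def
  by (intro continuous_on_vec_lambda scaleC.continuous_on continuous_on_component continuous_on_id
      continuous_on_const)

lemma tensor_op_product_state:
  assumes "clinear_on (qubit_space Q) S" "clinear_on W B" "\<Psi> \<in> qubit_space Q" "\<Phi> \<in> W"
  shows "tensor_op Q S B (product_state \<Psi> \<Phi>) = product_state (S \<Psi>) (B \<Phi>)"
  unfolding vec_eq_iff
  by (simp add: tensor_op_nth product_state_def clinear_onD(2)[OF assms(2,4)] scaleC_scaleC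
      clinear_on_qubit_component[OF assms(1,3)] scaleC.sum_left mult.commute)

section \<open>The interaction picture at a location\<close>

lemma clinear_on_compose:
  assumes "clinear_on A X" "clinear_on A Y" "Y ` A \<subseteq> A"
  shows "clinear_on A (\<lambda>x. X (Y x))"
  using assms by (simp add: clinear_on_def image_subset_iff)

lemma clinear_on_sum_op:
  assumes "\<And>i. i \<in> I \<Longrightarrow> clinear_on W (X i)"
  shows "clinear_on W (\<lambda>x. \<Sum>i\<in>I. X i x)"
  using clinear_onD[OF assms]
  by (simp add: clinear_on_def sum.distrib scaleC.sum_right)

lemma unitary_op_mem: "unitary_op W X \<Longrightarrow> x \<in> W \<Longrightarrow> X x \<in> W"
  unfolding unitary_op_def by (metis imageI)

lemma bounded_op_mem: "bounded_op W X \<Longrightarrow> x \<in> W \<Longrightarrow> X x \<in> W"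
  unfolding bounded_op_def by blast

lemma clinear_on_adj:
  assumes W: "csubspace W" and X: "unitary_op W X"
  shows "clinear_on W (adj W X)"
proof -
  note a = unitary_op_adj[OF W X]
  have "adj W X (x + y) = adj W X x + adj W X y" if "x \<in> W" "y \<in> W" for x y
    using that by (intro adj_eqI) (auto simp: W a cinner_add_left csubspaceD[OF W])
  moreover have "adj W X (c *\<^sub>C x) = c *\<^sub>C adj W X x" if "x \<in> W" for c x
    using that by (intro adj_eqI) (auto simp: W a cinner_scaleC_left csubspaceD[OF W])
  ultimately show ?thesis
    by (auto simp: clinear_on_def)
qed

text \<open>The supremum in \<open>op_norm\<close> includes the zero vector, where the quotient is 0
  by the convention for division; the inequality at 0 itself comes from linearity.\<close>

lemma bounded_op_norm_le:
  assumes "bounded_op W X" "x \<in> W"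
  shows "norm (X x) \<le> op_norm W X * norm x"
proof (cases "x = 0")
  case True
  then have "X x = 0"
    using assms clinear_onD(2)[of W X x 0] by (simp add: bounded_op_def scaleC_zero)
  then show ?thesis using True by simp
next
  case False
  obtain K where K: "\<And>x. x \<in> W \<Longrightarrow> norm (X x) \<le> K * norm x"
    using assms(1) unfolding bounded_op_def by blast
  have "bdd_above ((\<lambda>x. norm (X x) / norm x) ` W)"
  \<comment> \<open>\<open>K\<close> can be negative when \<open>W\<close> is trivial, while the
    quotient at 0 is 0; hence the maximum with 0.\<close>
  proof (rule bdd_aboveI2[where M = "max K 0"])
    fix y assume "y \<in> W"
    then show "norm (X y) / norm y \<le> max K 0"
      using K[of y] by (cases "y = 0") (auto simp: divide_le_eq intro: order_trans mult_right_mono)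
  qed
  then have "norm (X x) / norm x \<le> op_norm W X"
    unfolding op_norm_def using assms(2) by (intro cSUP_upper)
  then show ?thesis
    using False by (simp add: divide_le_eq)
qed

lemma op_norm_nonneg:
  assumes "bounded_op W X" "0 \<in> W"
  shows "0 \<le> op_norm W X"
proof (rule ccontr)
  assume neg: "\<not> 0 \<le> op_norm W X"
  have "norm (X x) / norm x = 0" if "x \<in> W" for x
  proof -
    have "norm (X x) \<le> op_norm W X * norm x" by (rule bounded_op_norm_le[OF assms(1) that])
    moreover have "op_norm W X * norm x \<le> 0" using neg by (intro mult_nonpos_nonneg) auto
    ultimately have "norm (X x) \<le> 0" by linarith
    then show ?thesis by simp
  qed
  then have "(\<lambda>x. norm (X x) / norm x) ` W = {0}"
    using assms(2) by auto
  then show False using neg by (simp add: op_norm_def)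
qed

text \<open>\<open>noisy_location\<close> only asserts that a finite set of jump times exists.
  Fixing one as \<open>F\<close> lets the control, the interaction picture and the evolution share
  it.\<close>

locale noisy_loc =
  fixes T J :: real and l :: "('q::finite, 'b::complex_hilbert, 'k) location" and F :: "real set"
  assumes T: "0 \<le> T" and noisy: "noisy_location T l"
    and J: "op_norm (loc_space l) (H_err l) \<le> J"
    and F: "finite F"
    and cont_control: "\<psi> \<in> sys_space l \<Longrightarrow> continuous_on ({0..T} - F) (\<lambda>t. control l t \<psi>)"
begin

abbreviation "Q \<equiv> qubits l"
abbreviation "W \<equiv> bath l"
abbreviation "L \<equiv> loc_space l"
abbreviation "U \<equiv> control l"
abbreviation "E \<equiv> bath_exp l"
abbreviation "U' t \<equiv> adj (qubit_space Q) (U t)"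

lemma W: "csubspace W" "closed W" and init: "bath_init l \<in> W" "norm (bath_init l) = 1"
  and labels: "finite (labels l)" and herm_H_err: "hermitian_op L (H_err l)"
  using noisy by (auto simp: noisy_location_def)

lemma L: "csubspace L" "closed L"
  unfolding loc_space_def using W by (auto intro: csubspace_joint_space closed_joint_space)

lemma U: "t \<in> {0..T} \<Longrightarrow> unitary_op (qubit_space Q) (U t)"
  using noisy by (auto simp: noisy_location_def sys_space_def)

lemmas U_adj = unitary_op_adj[OF csubspace_qubit_space U]

lemma U_lin: "t \<in> {0..T} \<Longrightarrow> clinear_on (qubit_space Q) (U t)"
  and U_mem: "t \<in> {0..T} \<Longrightarrow> x \<in> qubit_space Q \<Longrightarrow> U t x \<in> qubit_space Q"
  using U[of t] by (auto simp: unitary_op_def intro: unitary_op_mem)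

lemma sys_op:
  assumes "\<alpha> \<in> labels l"
  shows "bounded_op (qubit_space Q) (sys_op l \<alpha>)" "clinear_on (qubit_space Q) (sys_op l \<alpha>)"
    "x \<in> qubit_space Q \<Longrightarrow> sys_op l \<alpha> x \<in> qubit_space Q"
proof -
  show *: "bounded_op (qubit_space Q) (sys_op l \<alpha>)"
    using noisy assms by (simp add: noisy_location_def sys_space_def)
  then show "clinear_on (qubit_space Q) (sys_op l \<alpha>)"
    by (simp add: bounded_op_def)
  show "x \<in> qubit_space Q \<Longrightarrow> sys_op l \<alpha> x \<in> qubit_space Q"
    by (rule bounded_op_mem[OF *])
qed

lemma bath_op:
  assumes "\<alpha> \<in> labels l"
  shows "bounded_op W (bath_op l \<alpha>)" "clinear_on W (bath_op l \<alpha>)" "x \<in> W \<Longrightarrow> bath_op l \<alpha> x \<in> W"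
proof -
  show *: "bounded_op W (bath_op l \<alpha>)"
    using noisy assms by (simp add: noisy_location_def)
  then show "clinear_on W (bath_op l \<alpha>)"
    by (simp add: bounded_op_def)
  show "x \<in> W \<Longrightarrow> bath_op l \<alpha> x \<in> W"
    by (rule bounded_op_mem[OF *])
qed

lemma E: "unitary_op W (E t)" "x \<in> W \<Longrightarrow> E (s + t) x = E s (E t x)"
  "x \<in> W \<Longrightarrow> continuous_on UNIV (\<lambda>t. E t x)"
  using noisy by (auto simp: noisy_location_def is_exp_i_def)

lemma E_lin: "clinear_on W (E t)" and E_mem: "x \<in> W \<Longrightarrow> E t x \<in> W"
  using E(1)[of t] by (auto simp: unitary_op_def intro: unitary_op_mem)

text \<open>That \<open>E 0\<close> is the identity has to be extracted: the group law gives
  \<open>E 0 (E 0 x - x) = 0\<close>, and an isometry has trivial kernel.\<close>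

lemma E_inverse: "x \<in> W \<Longrightarrow> E t (E (- t) x) = x"
proof -
  assume x: "x \<in> W"
  have "E 0 (E 0 x - x) = E 0 (E 0 x) - E 0 x"
    using x E_mem by (intro clinear_on_more(3)[OF E_lin W(1)])
  also have "\<dots> = 0"
    using E(2)[OF x, of 0 0] by simp
  finally have "norm (E 0 x - x) = 0"
    using unitary_op_norm[OF E(1)[of 0], of "E 0 x - x"] csubspaceD(5)[OF W(1) E_mem[OF x] x] by simp
  then have "E 0 x = x" by simp
  then show ?thesis
    using E(2)[OF x, of t "- t"] by simp
qed

lemma cinner_E: "x \<in> W \<Longrightarrow> y \<in> W \<Longrightarrow> cinner (E (- t) x) y = cinner x (E t y)"
  using E(1)[of t] E_mem[of x "- t"] E_inverse[of x t] by (auto simp: unitary_op_def)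

lemma S_int_mem:
  assumes "\<alpha> \<in> labels l" "t \<in> {0..T}" "x \<in> qubit_space Q"
  shows "S_int l \<alpha> t x \<in> qubit_space Q"
  unfolding S_int_def sys_space_def using assms by (intro U_adj sys_op U_mem)

lemma S_int_lin:
  assumes "\<alpha> \<in> labels l" "t \<in> {0..T}"
  shows "clinear_on (qubit_space Q) (S_int l \<alpha> t)"
proof -
  have "clinear_on (qubit_space Q) (\<lambda>x. sys_op l \<alpha> (U t x))"
    by (rule clinear_on_compose[OF sys_op(2)[OF assms(1)] U_lin[OF assms(2)]])
      (auto intro: U_mem[OF assms(2)])
  then show ?thesis
    unfolding S_int_def sys_space_def
    by (rule clinear_on_compose[OF clinear_on_adj[OF csubspace_qubit_space U[OF assms(2)]]])
      (auto intro!: sys_op(3)[OF assms(1)] U_mem[OF assms(2)])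
qed

lemma B_int_mem:
  assumes "\<alpha> \<in> labels l" "x \<in> W"
  shows "B_int l \<alpha> t x \<in> W"
  unfolding B_int_def using assms by (intro E_mem bath_op)

lemma B_int_lin:
  assumes "\<alpha> \<in> labels l"
  shows "clinear_on W (B_int l \<alpha> t)"
proof -
  have "clinear_on W (\<lambda>x. bath_op l \<alpha> (E (- t) x))"
    by (rule clinear_on_compose[OF bath_op(2)[OF assms] E_lin]) (auto intro: E_mem)
  then show ?thesis
    unfolding B_int_def
    by (rule clinear_on_compose[OF E_lin]) (auto intro!: bath_op(3)[OF assms] E_mem)
qed

section \<open>Conjugation by the free evolution\<close>

definition V :: "real \<Rightarrow> ('b, 'q set) vec \<Rightarrow> ('b, 'q set) vec" where
  "V t = tensor_op Q (U t) (E (- t))"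

text \<open>The adjoint of \<open>V t\<close>, written down as a tensor product instead of through
  \<open>adj\<close> on the joint space.\<close>

definition V' :: "real \<Rightarrow> ('b, 'q set) vec \<Rightarrow> ('b, 'q set) vec" where
  "V' t = tensor_op Q (U' t) (E t)"

context
  fixes t assumes t: "t \<in> {0..T}"
begin

lemma V_mem: "\<psi> \<in> L \<Longrightarrow> V t \<psi> \<in> L" and V'_mem: "\<psi> \<in> L \<Longrightarrow> V' t \<psi> \<in> L"
  unfolding V_def V'_def loc_space_def using t
  by (auto intro!: tensor_op_mem W U_mem U_adj E_mem)

lemma V'_V: "\<psi> \<in> L \<Longrightarrow> V' t (V t \<psi>) = \<psi>" and V_V': "\<psi> \<in> L \<Longrightarrow> V t (V' t \<psi>) = \<psi>"
proof -
  assume \<psi>: "\<psi> \<in> L"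
  note \<psi>' = \<psi>[unfolded loc_space_def]
  have "V' t (V t \<psi>) = tensor_op Q (\<lambda>x. U' t (U t x)) (\<lambda>x. E t (E (- t) x)) \<psi>"
    unfolding V_def V'_def using t \<psi>'
    by (intro tensor_op_compose[where W = W] W clinear_on_adj csubspace_qubit_space U E_lin)
      (auto intro!: U_mem E_mem)
  also have "\<dots> = \<psi>"
    using t by (intro tensor_op_identity[OF \<psi>']) (auto intro: U_adj(3) E_inverse)
  finally show "V' t (V t \<psi>) = \<psi>" .
  have "V t (V' t \<psi>) = tensor_op Q (\<lambda>x. U t (U' t x)) (\<lambda>x. E (- t) (E t x)) \<psi>"
    unfolding V_def V'_def using t \<psi>'
    by (intro tensor_op_compose[where W = W] W U_lin E_lin) (auto intro!: U_adj E_mem)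
  also have "\<dots> = \<psi>"
    using t E_inverse[of _ "- t"] by (intro tensor_op_identity[OF \<psi>']) (auto intro: U_adj(2))
  finally show "V t (V' t \<psi>) = \<psi>" .
qed

lemma cinner_V: "\<psi> \<in> L \<Longrightarrow> \<phi> \<in> L \<Longrightarrow> cinner (V t \<psi>) \<phi> = cinner \<psi> (V' t \<phi>)"
  unfolding V_def V'_def loc_space_def
proof (rule cinner_tensor_op[where W = W])
  fix x y assume "x \<in> qubit_space Q" "y \<in> qubit_space Q"
  then have "cinner (U' t y) x = cinner y (U t x)"
    using t by (intro U_adj)
  then show "cinner (U t x) y = cinner x (U' t y)"
    by (metis cinner_commute)
qed (use cinner_E in auto)

lemma norm_V: "\<psi> \<in> L \<Longrightarrow> norm (V t \<psi>) = norm \<psi>"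
  and norm_V': "\<psi> \<in> L \<Longrightarrow> norm (V' t \<psi>) = norm \<psi>"
proof -
  show *: "norm (V t \<psi>) = norm \<psi>" if "\<psi> \<in> L" for \<psi>
  proof -
    have "cinner (V t \<psi>) (V t \<psi>) = cinner \<psi> \<psi>"
      using cinner_V[OF that V_mem[OF that]] by (simp add: V'_V[OF that])
    then show ?thesis
      unfolding cinner_self of_real_eq_iff by (simp add: power2_eq_iff_nonneg)
  qed
  show "\<psi> \<in> L \<Longrightarrow> norm (V' t \<psi>) = norm \<psi>"
    using *[of "V' t \<psi>"] V'_mem V_V' by simp
qed

lemma V'_lin: "clinear_on L (V' t)" and V_lin: "clinear_on L (V t)"
  unfolding V_def V'_def loc_space_def by (intro clinear_on_tensor_op E_lin)+

text \<open>Term by term this is composition of tensor products. Its purpose is to return to the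
  sum: Hermiticity and the bound \<open>J\<close> are known for \<open>H_err\<close> as a whole, not
  for its single terms.\<close>

lemma H_int_conj:
  assumes \<psi>: "\<psi> \<in> L"
  shows "H_int l t \<psi> = V' t (H_err l (V t \<psi>))"
proof -
  note \<psi>' = \<psi>[unfolded loc_space_def]
  have 1: "tensor_op Q (sys_op l \<alpha>) (bath_op l \<alpha>) (V t \<psi>) =
      tensor_op Q (\<lambda>x. sys_op l \<alpha> (U t x)) (\<lambda>x. bath_op l \<alpha> (E (- t) x)) \<psi>"
    if "\<alpha> \<in> labels l" for \<alpha>
    unfolding V_def using t that
    by (intro tensor_op_compose[OF W(1) _ _ _ _ \<psi>'] sys_op bath_op) (auto intro!: U_mem E_mem)
  have 2: "V' t (tensor_op Q (\<lambda>x. sys_op l \<alpha> (U t x)) (\<lambda>x. bath_op l \<alpha> (E (- t) x)) \<psi>) =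
      tensor_op Q (S_int l \<alpha> t) (B_int l \<alpha> t) \<psi>" if "\<alpha> \<in> labels l" for \<alpha>
    unfolding V'_def S_int_def B_int_def sys_space_def using t that
    by (intro tensor_op_compose[OF W(1) _ _ _ _ \<psi>'] clinear_on_adj csubspace_qubit_space U E_lin)
      (auto intro!: sys_op bath_op U_mem E_mem)
  have 3: "tensor_op Q (sys_op l \<alpha>) (bath_op l \<alpha>) (V t \<psi>) \<in> L" if "\<alpha> \<in> labels l" for \<alpha>
    using that V_mem[OF \<psi>] unfolding loc_space_def
    by (intro tensor_op_mem[OF W(1)]) (auto intro!: sys_op bath_op)
  have "V' t (H_err l (V t \<psi>)) = (\<Sum>\<alpha>\<in>labels l. V' t (tensor_op Q (sys_op l \<alpha>) (bath_op l \<alpha>) (V t \<psi>)))"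
    unfolding H_err_def by (intro clinear_on_sum[OF V'_lin L(1)] 3)
  also have "\<dots> = (\<Sum>\<alpha>\<in>labels l. tensor_op Q (S_int l \<alpha> t) (B_int l \<alpha> t) \<psi>)"
    by (intro sum.cong refl) (simp add: 1 2)
  finally show ?thesis
    by (simp add: H_int_def)
qed

lemma H_err_mem: "\<psi> \<in> L \<Longrightarrow> H_err l \<psi> \<in> L"
  using herm_H_err by (auto simp: hermitian_op_def intro: bounded_op_mem)

lemma H_int_mem: "\<psi> \<in> L \<Longrightarrow> H_int l t \<psi> \<in> L"
  by (simp add: H_int_conj V'_mem V_mem H_err_mem)

lemma H_int_lin: "clinear_on L (H_int l t)"
  unfolding H_int_def loc_space_def
  by (intro clinear_on_sum_op clinear_on_tensor_op B_int_lin)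

lemma H_int_herm: "\<psi> \<in> L \<Longrightarrow> \<phi> \<in> L \<Longrightarrow> cinner (H_int l t \<psi>) \<phi> = cinner \<psi> (H_int l t \<phi>)"
proof -
  assume \<psi>: "\<psi> \<in> L" and \<phi>: "\<phi> \<in> L"
  have "cinner (H_int l t \<psi>) \<phi> = cinner (V t (V' t (H_err l (V t \<psi>)))) (V t \<phi>)"
    using \<psi> \<phi> by (subst cinner_V) (simp_all add: H_int_conj V'_V V_mem V'_mem H_err_mem)
  also have "\<dots> = cinner (H_err l (V t \<psi>)) (V t \<phi>)"
    using \<psi> by (simp add: V_V' H_err_mem V_mem)
  also have "\<dots> = cinner (V t \<psi>) (H_err l (V t \<phi>))"
    using herm_H_err V_mem[OF \<psi>] V_mem[OF \<phi>] by (simp add: hermitian_op_def)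
  also have "\<dots> = cinner \<psi> (H_int l t \<phi>)"
    using \<psi> \<phi> by (subst cinner_V) (simp_all add: H_int_conj V_mem H_err_mem)
  finally show ?thesis .
qed

lemma H_int_bound: "\<psi> \<in> L \<Longrightarrow> norm (H_int l t \<psi>) \<le> J * norm \<psi>"
proof -
  assume \<psi>: "\<psi> \<in> L"
  have "norm (H_int l t \<psi>) = norm (H_err l (V t \<psi>))"
    using \<psi> by (simp add: H_int_conj norm_V' H_err_mem V_mem)
  also have "\<dots> \<le> op_norm L (H_err l) * norm (V t \<psi>)"
    using herm_H_err by (intro bounded_op_norm_le V_mem \<psi>) (auto simp: hermitian_op_def)
  also have "\<dots> \<le> J * norm \<psi>"
    using J by (simp add: norm_V \<psi> mult_right_mono)
  finally show ?thesis .
qed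

text \<open>\<open>V t\<close> maps \<open>L\<close> onto itself and keeps norms, so both suprema
  run over the same set of quotients.\<close>

lemma op_norm_H_int: "op_norm L (H_int l t) = op_norm L (H_err l)"
proof -
  have "(\<lambda>x. norm (H_int l t x) / norm x) ` L = (\<lambda>x. norm (H_err l x) / norm x) ` V t ` L"
    unfolding image_image
    by (intro image_cong refl) (simp add: H_int_conj norm_V' norm_V H_err_mem V_mem)
  also have "V t ` L = L"
    using V_mem V_V' V'_mem by (auto intro: image_eqI[where x = "V' t _"] simp: image_iff) metis
  finally show ?thesis
    by (simp add: op_norm_def)
qed

end

section \<open>Strong continuity of the interaction-picture operators\<close>

lemma continuous_on_sys_op:
  fixes f :: "real \<Rightarrow> _"
  assumes "\<alpha> \<in> labels l" "continuous_on A f" "f ` A \<subseteq> qubit_space Q"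
  shows "continuous_on A (\<lambda>t. sys_op l \<alpha> (f t))"
  by (rule strongly_continuous_apply[OF csubspace_qubit_space[of Q] assms(2)])
    (use assms bounded_op_norm_le[OF sys_op(1)] clinear_on_more(3)[OF sys_op(2) csubspace_qubit_space]
     in auto)

text \<open>In each component the adjoint of the control is moved to the other side of the inner
  product; what remains is built from the control itself, whose continuity is given.\<close>

lemma S_int_cont:
  assumes \<alpha>: "\<alpha> \<in> labels l" and \<psi>: "\<psi> \<in> qubit_space Q"
  shows "continuous_on ({0..T} - F) (\<lambda>t. S_int l \<alpha> t \<psi>)"
proof -
  have c: "continuous_on ({0..T} - F) (\<lambda>t. S_int l \<alpha> t \<psi> $ s)" for s
  proof (cases "s \<subseteq> Q")
    case True
    have eq: "S_int l \<alpha> t \<psi> $ s = cinner (U t (axis s 1)) (sys_op l \<alpha> (U t \<psi>))"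
      if "t \<in> {0..T} - F" for t
    proof -
      have t: "t \<in> {0..T}" using that by auto
      have "cinner (S_int l \<alpha> t \<psi>) (axis s 1) = cinner (sys_op l \<alpha> (U t \<psi>)) (U t (axis s 1))"
        unfolding S_int_def sys_space_def using t \<alpha> \<psi> True
        by (intro U_adj(4) sys_op U_mem axis_in_qubit_space)
      then show ?thesis
        by (metis cinner_axis cinner_commute)
    qed
    have "continuous_on ({0..T} - F) (\<lambda>t. cinner (U t (axis s 1)) (sys_op l \<alpha> (U t \<psi>)))"
      using \<alpha> \<psi> True
      by (intro cinner.continuous_on continuous_on_sys_op cont_control)
        (auto simp: sys_space_def axis_in_qubit_space intro!: U_mem)
    then show ?thesis
      by (rule continuous_on_eq) (use eq in simp)
  next
    case False
    then have eq: "0 = S_int l \<alpha> t \<psi> $ s" if "t \<in> {0..T} - F" for t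
      using S_int_mem[OF \<alpha> _ \<psi>, of t] that by (auto simp: qubit_space_def)
    show ?thesis
      by (rule continuous_on_eq[OF continuous_on_const eq])
  qed
  show ?thesis
    using continuous_on_vec_lambda[of "{0..T} - F" "\<lambda>s t. S_int l \<alpha> t \<psi> $ s"] c by simp
qed

lemma S_int_bound:
  assumes \<alpha>: "\<alpha> \<in> labels l" and t: "t \<in> {0..T}" and \<psi>: "\<psi> \<in> qubit_space Q"
  shows "norm (S_int l \<alpha> t \<psi>) \<le> op_norm (qubit_space Q) (sys_op l \<alpha>) * norm \<psi>"
proof -
  have m: "sys_op l \<alpha> (U t \<psi>) \<in> qubit_space Q"
    by (intro sys_op \<alpha> U_mem t \<psi>)
  have "norm (S_int l \<alpha> t \<psi>) = norm (U t (S_int l \<alpha> t \<psi>))"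
    using unitary_op_norm[OF U[OF t] S_int_mem[OF \<alpha> t \<psi>]] by simp
  also have "U t (S_int l \<alpha> t \<psi>) = sys_op l \<alpha> (U t \<psi>)"
    unfolding S_int_def sys_space_def by (rule U_adj(2)[OF t m])
  also have "norm \<dots> \<le> op_norm (qubit_space Q) (sys_op l \<alpha>) * norm (U t \<psi>)"
    by (intro bounded_op_norm_le sys_op \<alpha> U_mem t \<psi>)
  finally show ?thesis
    by (simp add: unitary_op_norm[OF U[OF t] \<psi>])
qed

lemma continuous_on_E:
  fixes f :: "real \<Rightarrow> _"
  assumes "continuous_on A f" "f ` A \<subseteq> W" "continuous_on A g"
  shows "continuous_on A (\<lambda>t. E (g t) (f t))"
proof (rule strongly_continuous_apply[OF W(1) assms(1), where J = 1])
  fix x assume "x \<in> W"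
  show "continuous_on A (\<lambda>t. E (g t) x)"
    by (rule continuous_on_compose2[OF E(3)[OF \<open>x \<in> W\<close>] assms(3)]) simp
qed (use assms E_mem clinear_on_more(3)[OF E_lin W(1)] unitary_op_norm[OF E(1)] in auto)

lemma B_int_cont:
  assumes \<alpha>: "\<alpha> \<in> labels l" and \<phi>: "\<phi> \<in> W"
  shows "continuous_on A (\<lambda>t. B_int l \<alpha> t \<phi>)"
  unfolding B_int_def
proof (rule continuous_on_E)
  have c: "continuous_on A (\<lambda>t. E (- t) \<phi>)"
    using \<phi> by (intro continuous_on_E continuous_intros) auto
  show "continuous_on A (\<lambda>t. bath_op l \<alpha> (E (- t) \<phi>))"
    by (rule strongly_continuous_apply[OF W(1) c])
      (use \<phi> E_mem bounded_op_norm_le[OF bath_op(1)[OF \<alpha>]] clinear_on_more(3)[OF bath_op(2)[OF \<alpha>] W(1)]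
       in auto)
qed (use \<alpha> \<phi> in \<open>auto intro!: bath_op E_mem\<close>)

lemma H_int_cont:
  assumes \<psi>: "\<psi> \<in> L"
  shows "continuous_on ({0..T} - F) (\<lambda>t. H_int l t \<psi>)"
proof -
  have "continuous_on ({0..T} - F) (\<lambda>t. S_int l \<alpha> t (axis s' 1) $ s)"
    if "\<alpha> \<in> labels l" "s' \<in> Pow Q" for \<alpha> s s'
    using that by (intro continuous_on_component S_int_cont axis_in_qubit_space) auto
  moreover have "continuous_on ({0..T} - F) (\<lambda>t. B_int l \<alpha> t (\<psi> $ s'))"
    if "\<alpha> \<in> labels l" "s' \<in> Pow Q" for \<alpha> s'
    using that \<psi> by (intro B_int_cont joint_spaceD[where Q = Q]) (auto simp: loc_space_def)
  ultimately show ?thesis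
    unfolding H_int_def tensor_op_def
    by (intro continuous_on_sum continuous_on_vec_lambda scaleC.continuous_on)
qed

sublocale evol: evolution L "H_int l" T J F
proof
  have "0 \<le> op_norm L (H_err l)"
    using herm_H_err csubspaceD(1)[OF L(1)] by (intro op_norm_nonneg) (auto simp: hermitian_op_def)
  then show "0 \<le> J" using J by simp
qed (use L T F H_int_lin H_int_mem H_int_bound H_int_herm H_int_cont in auto)

section \<open>Correlations in a product state\<close>

lemma H_int_product_state:
  assumes "t \<in> {0..T}" "\<Psi> \<in> qubit_space Q" "\<Phi> \<in> W"
  shows "H_int l t (product_state \<Psi> \<Phi>) =
    (\<Sum>\<alpha>\<in>labels l. product_state (S_int l \<alpha> t \<Psi>) (B_int l \<alpha> t \<Phi>))"
  unfolding H_int_def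
  using assms by (intro sum.cong refl tensor_op_product_state[where W = W] S_int_lin B_int_lin)

lemma expect_H_H:
  assumes t: "t\<^sub>1 \<in> {0..T}" "t\<^sub>2 \<in> {0..T}" and \<Psi>: "\<Psi> \<in> qubit_space Q"
  shows "expect (product_state \<Psi> (bath_init l)) (\<lambda>v. H_int l t\<^sub>1 (H_int l t\<^sub>2 v)) =
    (\<Sum>\<alpha>\<in>labels l. \<Sum>\<beta>\<in>labels l. expect \<Psi> (\<lambda>\<psi>. S_int l \<alpha> t\<^sub>1 (S_int l \<beta> t\<^sub>2 \<psi>)) *
          expect (bath_init l) (\<lambda>\<phi>. B_int l \<alpha> t\<^sub>1 (B_int l \<beta> t\<^sub>2 \<phi>)))"
proof -
  let ?\<Phi> = "bath_init l"
  have "H_int l t\<^sub>1 (H_int l t\<^sub>2 (product_state \<Psi> ?\<Phi>)) =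
      (\<Sum>\<beta>\<in>labels l. H_int l t\<^sub>1 (product_state (S_int l \<beta> t\<^sub>2 \<Psi>) (B_int l \<beta> t\<^sub>2 ?\<Phi>)))"
    unfolding H_int_product_state[OF t(2) \<Psi> init(1)]
    using t \<Psi> init by (intro clinear_on_sum[OF H_int_lin[OF t(1)] L(1)])
      (auto simp: loc_space_def intro!: product_state_mem W S_int_mem B_int_mem)
  also have "\<dots> = (\<Sum>\<beta>\<in>labels l. \<Sum>\<alpha>\<in>labels l.
      product_state (S_int l \<alpha> t\<^sub>1 (S_int l \<beta> t\<^sub>2 \<Psi>)) (B_int l \<alpha> t\<^sub>1 (B_int l \<beta> t\<^sub>2 ?\<Phi>)))"
    using t \<Psi> init by (intro sum.cong refl H_int_product_state S_int_mem B_int_mem)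
  finally show ?thesis
    by (subst sum.swap) (simp add: expect_def cinner.sum_right cinner_product_state)
qed

text \<open>Hermiticity moves the Hamiltonian at \<open>t\<^sub>1\<close> to the bra. The integrand
  is then an inner product of two functions of one time each, and each integral passes through a
  bounded linear map.\<close>

lemma expect_H_H_integral:
  assumes v: "v \<in> L"
  shows "integral {0..T} (\<lambda>t\<^sub>1. integral {0..T} (\<lambda>t\<^sub>2. expect v (\<lambda>v. H_int l t\<^sub>1 (H_int l t\<^sub>2 v)))) =
    complex_of_real ((norm (integral {0..T} (\<lambda>t. H_int l t v)))\<^sup>2)"
proof -
  let ?w = "integral {0..T} (\<lambda>t. H_int l t v)"
  have int: "(\<lambda>t. H_int l t v) integrable_on {0..T}"
    using v T by (intro evol.integrable_H) auto
  have "integral {0..T} (\<lambda>t\<^sub>2. expect v (\<lambda>v. H_int l t\<^sub>1 (H_int l t\<^sub>2 v))) = cinner (H_int l t\<^sub>1 v) ?w"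
    if t: "t\<^sub>1 \<in> {0..T}" for t\<^sub>1
  proof -
    have "integral {0..T} (\<lambda>t\<^sub>2. expect v (\<lambda>v. H_int l t\<^sub>1 (H_int l t\<^sub>2 v))) =
        integral {0..T} (\<lambda>t\<^sub>2. cinner (H_int l t\<^sub>1 v) (H_int l t\<^sub>2 v))"
      unfolding expect_def
      by (rule Henstock_Kurzweil_Integration.integral_cong) (simp add: H_int_herm[OF t v] H_int_mem v)
    also have "\<dots> = cinner (H_int l t\<^sub>1 v) ?w"
      using integral_linear[OF int cinner.bounded_linear_right] by (simp add: o_def)
    finally show ?thesis .
  qed
  then have "integral {0..T} (\<lambda>t\<^sub>1. integral {0..T} (\<lambda>t\<^sub>2. expect v (\<lambda>v. H_int l t\<^sub>1 (H_int l t\<^sub>2 v)))) =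
      integral {0..T} (\<lambda>t\<^sub>1. cinner (H_int l t\<^sub>1 v) ?w)"
    by (rule Henstock_Kurzweil_Integration.integral_cong)
  also have "\<dots> = cinner ?w ?w"
    using integral_linear[OF int cinner.bounded_linear_left] by (simp add: o_def)
  finally show ?thesis
    by (simp only: cinner_self)
qed

end

section \<open>Maxima over locations and states\<close>

lemma closed_qubit_space: "closed (qubit_space Q)"
proof -
  have "qubit_space Q = (\<Inter>s. (\<lambda>\<psi>. \<psi> $ s) -` (if s \<subseteq> Q then UNIV else {0}))"
    unfolding qubit_space_def set_eq_iff by (simp split: if_split)
  moreover have "closed \<dots>"
    by (intro closed_INT ballI closed_vimage continuous_on_component continuous_on_id) auto
  ultimately show ?thesis by simp
qed

lemma norm_axis_complex: "norm (axis s 1 :: (complex, 'i::finite) vec) = 1"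
proof -
  have "complex_of_real ((norm (axis s 1 :: (complex, 'i) vec))\<^sup>2) = complex_of_real 1"
    by (simp only: cinner_self[symmetric] cinner_axis) (simp add: axis_def)
  then have "(norm (axis s 1 :: (complex, 'i) vec))\<^sup>2 = 1"
    unfolding of_real_eq_iff .
  then show ?thesis
    by (simp add: power2_eq_1_iff)
qed

lemma max_over_cong:
  assumes "\<And>a \<Psi>. a \<in> A \<Longrightarrow> \<Psi> \<in> sys_space (C a) \<Longrightarrow> norm \<Psi> = 1 \<Longrightarrow> f a \<Psi> = g a \<Psi>"
  shows "max_over A C f = max_over A C g"
  unfolding max_over_def
  by (rule arg_cong[of _ _ Greatest], rule ext) (use assms in metis)

text \<open>\<open>GREATEST\<close> has a known value only if a greatest element exists. The values
  form a finite union of continuous images of unit spheres in finite dimension, hence a compact set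
  of reals, on which the complex order is the usual one.\<close>

lemma max_over_attained:
  fixes C :: "'l \<Rightarrow> ('q::finite, 'b, 'k) location" and g :: "'l \<Rightarrow> (complex, 'q set) vec \<Rightarrow> real"
  assumes A: "finite A" "A \<noteq> {}"
    and cont: "\<And>a. a \<in> A \<Longrightarrow> continuous_on (sys_space (C a)) (g a)"
  obtains a \<Psi> where "a \<in> A" "\<Psi> \<in> sys_space (C a)" "norm \<Psi> = 1"
    "max_over A C (\<lambda>a \<Psi>. complex_of_real (g a \<Psi>)) = complex_of_real (g a \<Psi>)"
    "\<And>b \<Phi>. b \<in> A \<Longrightarrow> \<Phi> \<in> sys_space (C b) \<Longrightarrow> norm \<Phi> = 1 \<Longrightarrow> g b \<Phi> \<le> g a \<Psi>"
proof -
  define S where "S a = sys_space (C a) \<inter> sphere 0 1" for a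
  have compact_S: "compact (S a)" for a
    unfolding S_def sys_space_def by (intro closed_Int_compact closed_qubit_space compact_sphere)
  \<comment> \<open>The empty set of qubits is contained in every \<open>qubits\<close>, so the
    all-zero basis state is available at each location, even one without qubits.\<close>
  have "axis {} 1 \<in> S a" for a
    by (simp add: S_def sys_space_def axis_in_qubit_space norm_axis_complex)
  then have nonempty: "(\<Union>a\<in>A. g a ` S a) \<noteq> {}"
    using A(2) by blast
  have "compact (\<Union>a\<in>A. g a ` S a)"
    using A(1) by (intro compact_UN compact_continuous_image compact_S)
      (auto intro!: continuous_on_subset[OF cont] simp: S_def)
  from compact_attains_sup[OF this nonempty]
  obtain m where "m \<in> (\<Union>a\<in>A. g a ` S a)" and m: "\<forall>y\<in>(\<Union>a\<in>A. g a ` S a). y \<le> m"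
    by blast
  then obtain a \<Psi> where a: "a \<in> A" "\<Psi> \<in> S a" "m = g a \<Psi>"
    by blast
  have max: "g b \<Phi> \<le> g a \<Psi>" if "b \<in> A" "\<Phi> \<in> sys_space (C b)" "norm \<Phi> = 1" for b \<Phi>
    using m a that unfolding S_def by auto
  have "max_over A C (\<lambda>a \<Psi>. complex_of_real (g a \<Psi>)) = complex_of_real (g a \<Psi>)"
    unfolding max_over_def
  proof (rule Greatest_equality)
    show "\<exists>b\<in>A. \<exists>\<Phi>\<in>sys_space (C b). norm \<Phi> = 1 \<and> complex_of_real (g a \<Psi>) = complex_of_real (g b \<Phi>)"
      using a by (auto simp: S_def)
    fix z assume "\<exists>b\<in>A. \<exists>\<Phi>\<in>sys_space (C b). norm \<Phi> = 1 \<and> z = complex_of_real (g b \<Phi>)"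
    then show "z \<le> complex_of_real (g a \<Psi>)"
      using max by (auto simp: less_eq_complex_def)
  qed
  then show thesis
    using that a max by (auto simp: S_def)
qed

section \<open>Continuity in the system state of both sides of the bound\<close>

context noisy_loc
begin

lemma product_state_in_L: "\<Psi> \<in> sys_space l \<Longrightarrow> product_state \<Psi> (bath_init l) \<in> L"
  unfolding sys_space_def loc_space_def by (intro product_state_mem W init)

lemma norm_product_state_init: "norm (product_state \<Psi> (bath_init l)) = norm \<Psi>"
  by (simp add: norm_product_state init)

text \<open>The evolution is an isometry, hence Lipschitz with constant 1, and the product state
  depends continuously on its system factor.\<close>

lemma continuous_on_noise:
  "continuous_on (sys_space l) (\<lambda>\<Psi>. (norm (U_int l T (product_state \<Psi> (bath_init l))
      - product_state \<Psi> (bath_init l)))\<^sup>2)"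
proof -
  have "continuous_on L (U_int l T)"
    unfolding U_int_def
    by (rule lipschitz_on_continuous_on[where L = 1], rule lipschitz_onI)
      (simp_all add: dist_norm evol.dist_time_ordered_exp)
  then have "continuous_on (sys_space l) (\<lambda>\<Psi>. U_int l T (product_state \<Psi> (bath_init l)))"
    by (rule continuous_on_compose2[OF _ continuous_on_product_state])
      (use product_state_in_L in auto)
  then show ?thesis
    by (intro continuous_intros continuous_on_product_state)
qed

lemma integrable_H_int: "v \<in> L \<Longrightarrow> (\<lambda>t. H_int l t v) integrable_on {0..T}"
  using T by (intro evol.integrable_H) auto

lemma continuous_on_first_order:
  "continuous_on (sys_space l) (\<lambda>\<Psi>. (norm (integral {0..T}
      (\<lambda>t. H_int l t (product_state \<Psi> (bath_init l)))))\<^sup>2)"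
proof -
  have "continuous_on L (\<lambda>v. integral {0..T} (\<lambda>t. H_int l t v))"
  \<comment> \<open>The constant is the bound \<open>J\<close> integrated over the duration.\<close>
  proof (rule lipschitz_on_continuous_on[where L = "J * T"], rule lipschitz_onI)
    fix u v assume u: "u \<in> L" and v: "v \<in> L"
    have "integral {0..T} (\<lambda>t. H_int l t u) - integral {0..T} (\<lambda>t. H_int l t v) =
        integral {0..T} (\<lambda>t. H_int l t u - H_int l t v)"
      by (intro Henstock_Kurzweil_Integration.integral_diff[symmetric] integrable_H_int u v)
    also have "norm \<dots> \<le> J * norm (u - v) * (T - 0)"
    proof (rule norm_integral_le_const)
      show "(\<lambda>t. H_int l t u - H_int l t v) integrable_on {0..T}"
        by (intro Henstock_Kurzweil_Integration.integrable_diff integrable_H_int u v)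
      fix t assume t: "t \<in> {0..T}"
      have "H_int l t u - H_int l t v = H_int l t (u - v)"
        using clinear_on_more(3)[OF H_int_lin[OF t] L(1) u v] by simp
      then show "norm (H_int l t u - H_int l t v) \<le> J * norm (u - v)"
        using H_int_bound[OF t csubspaceD(5)[OF L(1) u v]] by simp
    qed (rule T)
    finally show "dist (integral {0..T} (\<lambda>t. H_int l t u)) (integral {0..T} (\<lambda>t. H_int l t v))
        \<le> J * T * dist u v"
      by (simp add: dist_norm mult.commute mult.left_commute)
  qed (use evol.nonneg in simp)
  then have "continuous_on (sys_space l)
      (\<lambda>\<Psi>. integral {0..T} (\<lambda>t. H_int l t (product_state \<Psi> (bath_init l))))"
    by (rule continuous_on_compose2[OF _ continuous_on_product_state])
      (use product_state_in_L in auto)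
  then show ?thesis
    by (intro continuous_intros)
qed

end

lemma noisy_circuit_locationD:
  assumes "0 \<le> T" "noisy_circuit T J A C" "a \<in> A"
  obtains F where "noisy_loc T J (C a) F"
proof -
  have *: "noisy_location T (C a)" "op_norm (loc_space (C a)) (H_err (C a)) \<le> J"
    using assms by (auto simp: noisy_circuit_def)
  from *(1) obtain F where "finite F"
    "\<forall>\<psi>\<in>sys_space (C a). continuous_on ({0..T} - F) (\<lambda>t. control (C a) t \<psi>)"
    unfolding noisy_location_def by blast
  with * assms(1) have "noisy_loc T J (C a) F"
    by unfold_locales auto
  then show thesis by (rule that)
qed

text \<open>Stated for every \<open>f\<close> with the right values on admissible states, so that
  each of the four bounds is an instance. The noise and the right-hand side may attain their maxima
  at different locations and states; the pointwise bound is used at the maximiser of the noise and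
  then enlarged.\<close>

theorem noise_le_max_over:
  fixes C :: "'l \<Rightarrow> ('q::finite, 'b::complex_hilbert, 'k) location"
  assumes T: "0 \<le> T" and circ: "noisy_circuit T J A C"
    and \<eta>: "complex_of_real (\<eta>\<^sup>2) =
      max_over A C (\<lambda>a \<Psi>. expect (product_state \<Psi> (bath_init (C a)))
        (\<lambda>v. adj (loc_space (C a)) (U_int (C a) T) (U_int (C a) T v - v) - (U_int (C a) T v - v)))"
    and f: "\<And>a \<Psi>. a \<in> A \<Longrightarrow> \<Psi> \<in> sys_space (C a) \<Longrightarrow> norm \<Psi> = 1 \<Longrightarrow> f a \<Psi> = complex_of_real
      ((norm (integral {0..T} (\<lambda>t. H_int (C a) t (product_state \<Psi> (bath_init (C a))))))\<^sup>2)"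
  shows "complex_of_real (\<eta>\<^sup>2) \<le> max_over A C f + tail_bound (J * T)"
proof -
  define G where "G a \<Psi> = (norm (U_int (C a) T (product_state \<Psi> (bath_init (C a)))
      - product_state \<Psi> (bath_init (C a))))\<^sup>2" for a \<Psi>
  define N where "N a \<Psi> = (norm (integral {0..T}
      (\<lambda>t. H_int (C a) t (product_state \<Psi> (bath_init (C a))))))\<^sup>2" for a \<Psi>
  have A: "finite A" "A \<noteq> {}"
    using circ by (auto simp: noisy_circuit_def)
  have "complex_of_real (\<eta>\<^sup>2) = max_over A C (\<lambda>a \<Psi>. complex_of_real (G a \<Psi>))"
    unfolding \<eta>
  proof (rule max_over_cong)
    fix a \<Psi> assume a: "a \<in> A" and \<Psi>: "\<Psi> \<in> sys_space (C a)"
    obtain F where "noisy_loc T J (C a) F"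
      by (rule noisy_circuit_locationD[OF T circ a])
    then interpret noisy_loc T J "C a" F .
    show "expect (product_state \<Psi> (bath_init (C a)))
        (\<lambda>v. adj (loc_space (C a)) (U_int (C a) T) (U_int (C a) T v - v) - (U_int (C a) T v - v)) =
        complex_of_real (G a \<Psi>)"
      unfolding G_def U_int_def by (intro evol.expect_noise product_state_in_L \<Psi>)
  qed
  moreover obtain a \<Psi> where a: "a \<in> A" "\<Psi> \<in> sys_space (C a)" "norm \<Psi> = 1"
    and max_G: "max_over A C (\<lambda>a \<Psi>. complex_of_real (G a \<Psi>)) = complex_of_real (G a \<Psi>)"
  proof (rule max_over_attained[OF A, of C G])
    fix a assume a: "a \<in> A"
    obtain F where "noisy_loc T J (C a) F"
      by (rule noisy_circuit_locationD[OF T circ a])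
    then interpret noisy_loc T J "C a" F .
    show "continuous_on (sys_space (C a)) (G a)"
      unfolding G_def by (rule continuous_on_noise)
  qed
  ultimately have "\<eta>\<^sup>2 = G a \<Psi>"
    by (simp only: of_real_eq_iff)
  also have "\<dots> \<le> N a \<Psi> + 2 * (exp (J * T) - 1 - J * T - (J * T)\<^sup>2 / 2)"
  proof -
    obtain F where "noisy_loc T J (C a) F"
      by (rule noisy_circuit_locationD[OF T circ a(1)])
    then interpret noisy_loc T J "C a" F .
    show ?thesis
      unfolding G_def N_def U_int_def
      by (rule evol.norm_noise_le) (simp_all add: product_state_in_L norm_product_state_init a)
  qed
  finally have 1: "\<eta>\<^sup>2 \<le> N a \<Psi> + 2 * (exp (J * T) - 1 - J * T - (J * T)\<^sup>2 / 2)" .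
  have cont_N: "continuous_on (sys_space (C a)) (N a)" if a: "a \<in> A" for a
  proof -
    obtain F where "noisy_loc T J (C a) F"
      by (rule noisy_circuit_locationD[OF T circ a])
    then interpret noisy_loc T J "C a" F .
    show ?thesis
      unfolding N_def by (rule continuous_on_first_order)
  qed
  obtain b \<Phi> where max_N: "max_over A C (\<lambda>a \<Psi>. complex_of_real (N a \<Psi>)) = complex_of_real (N b \<Phi>)"
    and le: "\<And>a \<Psi>. a \<in> A \<Longrightarrow> \<Psi> \<in> sys_space (C a) \<Longrightarrow> norm \<Psi> = 1 \<Longrightarrow> N a \<Psi> \<le> N b \<Phi>"
    by (rule max_over_attained[OF A cont_N]) blast+
  have "max_over A C f = complex_of_real (N b \<Phi>)"
    unfolding max_N[symmetric] by (rule max_over_cong) (simp add: f N_def)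
  then show ?thesis
    using 1 le[OF a] by (simp add: tail_bound_def less_eq_complex_def del: of_real_power)
qed

section \<open>Spectral functions\<close>

abbreviation phase :: "real \<Rightarrow> complex" where
  "phase x \<equiv> exp (- \<i> * complex_of_real x)"

lemma norm_phase [simp]: "norm (phase x) = 1"
  by (simp add: norm_exp_eq_Re)

text \<open>The phase has modulus 1, so the absolute value of the integrand factorises and is
  integrable on the product. The sign \<open>\<sigma>\<close> serves the two times, which enter the
  phase with opposite signs.\<close>

lemma Fubini_phase:
  fixes \<sigma> :: real and h F :: "real \<Rightarrow> complex"
  assumes M: "sigma_finite_measure M" "sets M = sets borel"
    and F: "integrable M F" and h: "integrable lborel h"
  defines "f \<equiv> \<lambda>(\<omega>, t). phase (\<sigma> * \<omega> * t) * h t * F \<omega>"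
  shows "integrable (M \<Otimes>\<^sub>M lborel) f"
    and "integrable M (\<lambda>\<omega>. (\<integral>t. phase (\<sigma> * \<omega> * t) * h t \<partial>lborel) * F \<omega>)"
    and "integrable lborel (\<lambda>t. h t * (\<integral>\<omega>. phase (\<sigma> * \<omega> * t) * F \<omega> \<partial>M))"
    and "(\<integral>t. h t * (\<integral>\<omega>. phase (\<sigma> * \<omega> * t) * F \<omega> \<partial>M) \<partial>lborel) =
      (\<integral>\<omega>. (\<integral>t. phase (\<sigma> * \<omega> * t) * h t \<partial>lborel) * F \<omega> \<partial>M)"
proof -
  interpret M: sigma_finite_measure M by fact
  interpret P: pair_sigma_finite M lborel
    by unfold_locales
  have [measurable]: "F \<in> borel_measurable M" "h \<in> borel_measurable borel"
    using F h by auto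
  have [measurable]: "(\<lambda>\<omega>. \<omega>) \<in> borel_measurable M"
    using measurable_ident_sets[OF M(2)] by simp
  have meas: "f \<in> borel_measurable (M \<Otimes>\<^sub>M lborel)"
    unfolding f_def by measurable
  have norm_f: "norm (f (\<omega>, t)) = norm (h t) * norm (F \<omega>)" for \<omega> t
    by (simp add: f_def norm_mult)
  have h_phase: "integrable lborel (\<lambda>t. phase (\<sigma> * \<omega> * t) * h t)" for \<omega>
    by (rule Bochner_Integration.integrable_bound[OF h]) (auto simp: norm_mult)
  show int: "integrable (M \<Otimes>\<^sub>M lborel) f"
  proof (rule P.Fubini_integrable[OF meas])
    show "integrable M (\<lambda>\<omega>. \<integral>t. norm (f (\<omega>, t)) \<partial>lborel)"
      unfolding norm_f using F by simp
    show "AE \<omega> in M. integrable lborel (\<lambda>t. f (\<omega>, t))"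
      using h_phase by (simp add: f_def)
  qed
  have 1: "(\<integral>t. f (\<omega>, t) \<partial>lborel) = (\<integral>t. phase (\<sigma> * \<omega> * t) * h t \<partial>lborel) * F \<omega>" for \<omega>
    by (simp add: f_def)
  have 2: "(\<integral>\<omega>. f (\<omega>, t) \<partial>M) = h t * (\<integral>\<omega>. phase (\<sigma> * \<omega> * t) * F \<omega> \<partial>M)" for t
  proof -
    have "(\<integral>\<omega>. f (\<omega>, t) \<partial>M) = (\<integral>\<omega>. h t * (phase (\<sigma> * \<omega> * t) * F \<omega>) \<partial>M)"
      by (simp only: f_def prod.case ac_simps)
    then show ?thesis
      by (simp only: integral_mult_right_zero)
  qed
  show "integrable M (\<lambda>\<omega>. (\<integral>t. phase (\<sigma> * \<omega> * t) * h t \<partial>lborel) * F \<omega>)"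
    using P.integrable_fst'[OF int] unfolding 1 .
  show "integrable lborel (\<lambda>t. h t * (\<integral>\<omega>. phase (\<sigma> * \<omega> * t) * F \<omega> \<partial>M))"
    using P.integrable_snd[of "\<lambda>\<omega> t. f (\<omega>, t)"] int unfolding 2 by simp
  show "(\<integral>t. h t * (\<integral>\<omega>. phase (\<sigma> * \<omega> * t) * F \<omega> \<partial>M) \<partial>lborel) =
      (\<integral>\<omega>. (\<integral>t. phase (\<sigma> * \<omega> * t) * h t \<partial>lborel) * F \<omega> \<partial>M)"
    using P.Fubini_integral[of "\<lambda>\<omega> t. f (\<omega>, t)"] int unfolding 1 2 by simp
qed

definition fourier :: "real \<Rightarrow> (real \<Rightarrow> complex) \<Rightarrow> real \<Rightarrow> complex" where
  "fourier T h \<omega> = integral {0..T} (\<lambda>t. phase (\<omega> * t) * h t)"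

text \<open>Extending a piecewise continuous function by zero turns its integrals over \<open>[0, T]\<close> into Lebesgue
  integrals.\<close>

locale piecewise_continuous =
  fixes T :: real and F :: "real set" and h :: "real \<Rightarrow> complex"
  assumes F: "finite F" and cont: "continuous_on ({0..T} - F) h"
    and bounded: "\<exists>B. \<forall>t\<in>{0..T}. norm (h t) \<le> B"
begin

text \<open>It vanishes also on \<open>F\<close>, where \<open>h\<close> may be discontinuous: this
  gives Borel measurability at the cost of finitely many altered values.\<close>

definition h0 :: "real \<Rightarrow> complex" where
  "h0 t = indicator ({0..T} - F) t *\<^sub>R h t"

lemma integrable_h0: "integrable lborel h0"
proof -
  obtain B where B: "\<And>t. t \<in> {0..T} \<Longrightarrow> norm (h t) \<le> B"
    using bounded by blast
  have S: "{0..T} - F \<in> sets borel"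
    using F by (intro sets.Diff) (auto simp: finite_imp_closed borel_closed)
  have "integrable lborel (\<lambda>t. B * indicator {0..T} t :: real)"
    by (intro integrable_mult_right integrable_real_indicator emeasure_bounded_finite bounded_closed_interval) auto
  then show ?thesis
  proof (rule Bochner_Integration.integrable_bound)
    show "h0 \<in> borel_measurable lborel"
      using borel_measurable_continuous_on_indicator[OF S cont] by (simp add: h0_def[abs_def])
    show "AE t in lborel. norm (h0 t) \<le> norm (B * indicator {0..T} t :: real)"
    proof (rule AE_I2)
      fix t
      show "norm (h0 t) \<le> norm (B * indicator {0..T} t :: real)"
        using B[of t] by (auto simp: h0_def indicator_def)
    qed
  qed
qed

text \<open>The bridge from Lebesgue integrals on the line to gauge integrals on
  \<open>{0..T}\<close>; the values on \<open>F\<close> are restored because a finite set does not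
  affect the integral.\<close>

lemma has_integral_h0:
  assumes "integrable lborel (\<lambda>t. h0 t * c t)"
  shows "((\<lambda>t. h t * c t) has_integral (\<integral>t. h0 t * c t \<partial>lborel)) {0..T}"
proof -
  have "((\<lambda>t. h0 t * c t) has_integral (\<integral>t. h0 t * c t \<partial>lborel)) UNIV"
    by (rule has_integral_integral_lborel[OF assms])
  moreover have "(\<lambda>t. h0 t * c t) = (\<lambda>t. if t \<in> {0..T} then h0 t * c t else 0)"
    by (auto simp: h0_def fun_eq_iff)
  ultimately have "((\<lambda>t. h0 t * c t) has_integral (\<integral>t. h0 t * c t \<partial>lborel)) {0..T}"
    using has_integral_restrict_UNIV[of "{0..T}" "\<lambda>t. h0 t * c t"] by simp
  then show ?thesis
    by (rule has_integral_spike_finite[OF F, rotated]) (auto simp: h0_def)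
qed

lemma fourier_eq: "fourier T h \<omega> = (\<integral>t. phase (\<omega> * t) * h0 t \<partial>lborel)"
proof -
  have "h0 \<in> borel_measurable borel"
    using integrable_h0 by auto
  then have "integrable lborel (\<lambda>t. h0 t * phase (\<omega> * t))"
    by (intro Bochner_Integration.integrable_bound[OF integrable_h0]) (auto simp: norm_mult)
  from integral_unique[OF has_integral_h0[OF this]] show ?thesis
    by (simp add: fourier_def mult.commute)
qed

lemma integrable_phase_times: "(\<lambda>t. phase (\<omega> * t) * h t) integrable_on {0..T}"
proof -
  obtain B where B: "\<And>t. t \<in> {0..T} \<Longrightarrow> norm (h t) \<le> B"
    using bounded by blast
  show ?thesis
    by (rule integrable_piecewise_continuous[OF F, where B = B])
      (use B in \<open>auto intro!: continuous_intros cont simp: norm_mult\<close>)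
qed

lemma measurable_fourier: "fourier T h \<in> borel_measurable borel"
proof -
  have [measurable]: "h0 \<in> borel_measurable borel"
    using integrable_h0 by auto
  show ?thesis
    unfolding fourier_eq[abs_def] by measurable
qed

lemma bounded_fourier: "\<exists>B. \<forall>\<omega>. norm (fourier T h \<omega>) \<le> B"
proof (intro exI allI)
  fix \<omega>
  have "norm (fourier T h \<omega>) \<le> (\<integral>t. norm (phase (\<omega> * t) * h0 t) \<partial>lborel)"
    unfolding fourier_eq by (rule integral_norm_bound)
  then show "norm (fourier T h \<omega>) \<le> (\<integral>t. norm (h0 t) \<partial>lborel)"
    by (simp add: norm_mult)
qed

text \<open>\<open>G\<close> is kept general since it is first the spectral weight times a phase,
  and later the spectral weight times a Fourier transform.\<close>

lemma Fubini_fourier: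
  assumes "sigma_finite_measure M" "sets M = sets borel" "integrable M G"
  shows "((\<lambda>t. h t * (\<integral>\<omega>. phase (\<sigma> * \<omega> * t) * G \<omega> \<partial>M)) has_integral
      (\<integral>\<omega>. fourier T h (\<sigma> * \<omega>) * G \<omega> \<partial>M)) {0..T}"
    and "integrable M (\<lambda>\<omega>. fourier T h (\<sigma> * \<omega>) * G \<omega>)"
proof -
  note F = Fubini_phase[OF assms integrable_h0, of \<sigma>]
  show "integrable M (\<lambda>\<omega>. fourier T h (\<sigma> * \<omega>) * G \<omega>)"
    using F(2) by (simp add: fourier_eq)
  show "((\<lambda>t. h t * (\<integral>\<omega>. phase (\<sigma> * \<omega> * t) * G \<omega> \<partial>M)) has_integral
      (\<integral>\<omega>. fourier T h (\<sigma> * \<omega>) * G \<omega> \<partial>M)) {0..T}"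
    using has_integral_h0[OF F(3)] F(4) by (simp add: fourier_eq)
qed

end

lemma integrable_phase_mult:
  fixes G :: "real \<Rightarrow> complex"
  assumes "sets M = sets borel" "integrable M G"
  shows "integrable M (\<lambda>\<omega>. phase (\<sigma> * \<omega> * t) * G \<omega>)"
proof (rule Bochner_Integration.integrable_bound[OF assms(2)])
  have [measurable]: "(\<lambda>\<omega>. \<omega>) \<in> borel_measurable M"
    using measurable_ident_sets[OF assms(1)] by simp
  show "(\<lambda>\<omega>. phase (\<sigma> * \<omega> * t) * G \<omega>) \<in> borel_measurable M"
    using assms(2) by measurable
qed (simp add: norm_mult)

section \<open>Delta combs\<close>

lemma integral_finite_range:
  fixes s k :: "real \<Rightarrow> complex"
  assumes M: "sets M = sets borel" and k: "integrable M k"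
    and s: "s \<in> borel_measurable borel" "finite (range s)"
  shows "(\<integral>\<omega>. s \<omega> * k \<omega> \<partial>M) = (\<Sum>v\<in>range s. v * (\<integral>\<omega>\<in>s -` {v}. k \<omega> \<partial>M))"
    and "integrable M (\<lambda>\<omega>. s \<omega> * k \<omega>)"
proof -
  have eq: "s \<omega> * k \<omega> = (\<Sum>v\<in>range s. v * (indicator (s -` {v}) \<omega> *\<^sub>R k \<omega>))" for \<omega>
  proof -
    have "(\<Sum>v\<in>range s. v * (indicator (s -` {v}) \<omega> *\<^sub>R k \<omega>)) =
        (\<Sum>v\<in>range s. if v = s \<omega> then v * k \<omega> else 0)"
      by (rule sum.cong) (auto simp: indicator_def)
    also have "\<dots> = s \<omega> * k \<omega>"
      using s(2) by (simp add: sum.delta)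
    finally show ?thesis by simp
  qed
  have "s -` {v} \<in> sets M" for v
    using measurable_sets[OF s(1), of "{v}"] by (simp add: M)
  then have int: "integrable M (\<lambda>\<omega>. v * (indicator (s -` {v}) \<omega> *\<^sub>R k \<omega>))" for v
    by (intro integrable_mult_right integrable_mult_indicator k)
  show "integrable M (\<lambda>\<omega>. s \<omega> * k \<omega>)"
    unfolding eq by (intro Bochner_Integration.integrable_sum int)
  show "(\<integral>\<omega>. s \<omega> * k \<omega> \<partial>M) = (\<Sum>v\<in>range s. v * (\<integral>\<omega>\<in>s -` {v}. k \<omega> \<partial>M))"
    unfolding eq set_lebesgue_integral_def
    by (subst Bochner_Integration.integral_sum[OF int]) (simp only: integral_mult_right_zero)
qed

lemma summable_bounded_times:
  fixes c g :: "'i \<Rightarrow> complex"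
  assumes c: "(\<lambda>i. norm (c i)) summable_on I" and g: "\<And>i. norm (g i) \<le> B"
  shows "(\<lambda>i. c i * g i) summable_on I" "(\<lambda>i. norm (c i * g i)) summable_on I"
    "norm (\<Sum>\<^sub>\<infinity>i\<in>I. c i * g i) \<le> (\<Sum>\<^sub>\<infinity>i\<in>I. norm (c i)) * B"
proof -
  have cB: "(\<lambda>i. norm (c i) * B) summable_on I"
    by (rule summable_on_cmult_left[OF c])
  have le: "norm (c i * g i) \<le> norm (c i) * B" for i
    by (simp add: norm_mult mult_left_mono g)
  show n: "(\<lambda>i. norm (c i * g i)) summable_on I"
    by (rule summable_on_comparison_test[OF cB]) (use le in auto)
  then show "(\<lambda>i. c i * g i) summable_on I"
    by (rule abs_summable_summable)
  have "norm (\<Sum>\<^sub>\<infinity>i\<in>I. c i * g i) \<le> (\<Sum>\<^sub>\<infinity>i\<in>I. norm (c i * g i))"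
    by (rule norm_infsum_bound[OF n])
  also have "\<dots> \<le> (\<Sum>\<^sub>\<infinity>i\<in>I. norm (c i) * B)"
    by (rule infsum_mono[OF n cB le])
  also have "\<dots> = (\<Sum>\<^sub>\<infinity>i\<in>I. norm (c i)) * B"
    by (rule infsum_cmult_left') 
  finally show "norm (\<Sum>\<^sub>\<infinity>i\<in>I. c i * g i) \<le> (\<Sum>\<^sub>\<infinity>i\<in>I. norm (c i)) * B" .
qed

lemma infsum_finite_sum:
  fixes f :: "'v \<Rightarrow> 'i \<Rightarrow> complex"
  assumes "\<And>v. v \<in> V \<Longrightarrow> f v summable_on I"
  shows "(\<lambda>i. \<Sum>v\<in>V. f v i) summable_on I"
    and "(\<Sum>\<^sub>\<infinity>i\<in>I. \<Sum>v\<in>V. f v i) = (\<Sum>v\<in>V. \<Sum>\<^sub>\<infinity>i\<in>I. f v i)"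
proof -
  have "(\<lambda>i. \<Sum>v\<in>V. f v i) summable_on I \<and>
      (\<Sum>\<^sub>\<infinity>i\<in>I. \<Sum>v\<in>V. f v i) = (\<Sum>v\<in>V. \<Sum>\<^sub>\<infinity>i\<in>I. f v i)"
    using assms
    by (induction V rule: infinite_finite_induct) (simp_all add: summable_on_add infsum_add)
  then show "(\<lambda>i. \<Sum>v\<in>V. f v i) summable_on I"
    "(\<Sum>\<^sub>\<infinity>i\<in>I. \<Sum>v\<in>V. f v i) = (\<Sum>v\<in>V. \<Sum>\<^sub>\<infinity>i\<in>I. f v i)"
    by blast+
qed

text \<open>The level sets of \<open>s\<close> are Borel sets, to which \<open>is_delta_comb\<close>
  applies directly; summing over the levels then regroups the comb by index.\<close>

lemma delta_comb_finite_range: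
  assumes M: "sets M = sets borel" and k: "integrable M k" and comb: "is_delta_comb M k I c w"
    and s: "s \<in> borel_measurable borel" "finite (range s)"
  shows "(\<integral>\<omega>. s \<omega> * k \<omega> \<partial>M) = 2 * complex_of_real pi * (\<Sum>\<^sub>\<infinity>i\<in>I. c i * s (w i))"
proof -
  have c: "(\<lambda>i. norm (c i)) summable_on I"
    and cI: "\<And>E. E \<in> sets borel \<Longrightarrow>
      (\<integral>\<omega>\<in>E. k \<omega> \<partial>M) = 2 * complex_of_real pi * (\<Sum>\<^sub>\<infinity>i\<in>{i\<in>I. w i \<in> E}. c i)"
    using comb by (auto simp: is_delta_comb_def)
  have sets: "s -` {v} \<in> sets borel" for v
    using measurable_sets[OF s(1), of "{v}"] by simp
  \<comment> \<open>Cutting off by a zero factor lets all levels share the index set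
    \<open>I\<close>, so that the finite sum over levels can be exchanged with the infinite
    one.\<close>
  define d where "d v i = c i * (if s (w i) = v then v else 0)" for v i
  have "(\<integral>\<omega>. s \<omega> * k \<omega> \<partial>M) = (\<Sum>v\<in>range s. v * (2 * complex_of_real pi * (\<Sum>\<^sub>\<infinity>i\<in>{i\<in>I. w i \<in> s -` {v}}. c i)))"
    unfolding integral_finite_range(1)[OF M k s] cI[OF sets] ..
  also have "\<dots> = 2 * complex_of_real pi * (\<Sum>v\<in>range s. \<Sum>\<^sub>\<infinity>i\<in>I. d v i)"
    unfolding sum_distrib_left
  proof (rule sum.cong[OF refl])
    fix v
    have "(\<Sum>\<^sub>\<infinity>i\<in>I. d v i) = (\<Sum>\<^sub>\<infinity>i\<in>{i\<in>I. w i \<in> s -` {v}}. v * c i)"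
      by (rule infsum_cong_neutral) (auto simp: d_def)
    also have "\<dots> = v * (\<Sum>\<^sub>\<infinity>i\<in>{i\<in>I. w i \<in> s -` {v}}. c i)"
      by (rule infsum_cmult_right')
    finally show "v * (2 * complex_of_real pi * (\<Sum>\<^sub>\<infinity>i\<in>{i\<in>I. w i \<in> s -` {v}}. c i)) =
        2 * complex_of_real pi * (\<Sum>\<^sub>\<infinity>i\<in>I. d v i)"
      by simp
  qed
  also have "(\<Sum>v\<in>range s. \<Sum>\<^sub>\<infinity>i\<in>I. d v i) = (\<Sum>\<^sub>\<infinity>i\<in>I. \<Sum>v\<in>range s. d v i)"
  proof (rule infsum_finite_sum(2)[symmetric])
    fix v
    show "d v summable_on I"
      unfolding d_def by (rule summable_bounded_times(1)[OF c, where B = "norm v"]) simp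
  qed
  also have "\<dots> = (\<Sum>\<^sub>\<infinity>i\<in>I. c i * s (w i))"
    using s(2) by (intro infsum_cong) (simp add: d_def flip: sum_distrib_left)
  finally show ?thesis .
qed

text \<open>Real and imaginary parts are rounded down to multiples of \<open>e / 2\<close>. Each
  rounding costs at most \<open>e / 2\<close>, and boundedness of \<open>g\<close> leaves finitely
  many multiples.\<close>

lemma finite_range_approximation:
  fixes g :: "real \<Rightarrow> complex"
  assumes g: "g \<in> borel_measurable borel" "\<And>\<omega>. norm (g \<omega>) \<le> B" and e: "0 < e"
  obtains s where "s \<in> borel_measurable borel" "finite (range s)" "\<And>\<omega>. norm (g \<omega> - s \<omega>) \<le> e"
proof -
  define r where "r x = e / 2 * real_of_int \<lfloor>2 / e * x\<rfloor>" for x :: real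
  define s where "s \<omega> = complex_of_real (r (Re (g \<omega>))) + \<i> * complex_of_real (r (Im (g \<omega>)))" for \<omega>
  have [measurable]: "g \<in> borel_measurable borel" by fact
  have r: "\<bar>x - r x\<bar> \<le> e / 2" for x
  proof -
    define y where "y = 2 / e * x - real_of_int \<lfloor>2 / e * x\<rfloor>"
    have "x - r x = e / 2 * y"
      using e by (simp add: y_def r_def field_simps)
    moreover have "0 \<le> y" "y \<le> 1"
      unfolding y_def by linarith+
    then have "0 \<le> e / 2 * y" "e / 2 * y \<le> e / 2 * 1"
      using e by (intro mult_nonneg_nonneg mult_left_mono; simp)+
    ultimately show ?thesis
      by simp
  qed
  have "finite (r ` {- B..B})"
  proof (rule finite_subset)
    show "r ` {- B..B} \<subseteq> (\<lambda>n. e / 2 * real_of_int n) ` {\<lfloor>2 / e * (- B)\<rfloor>..\<lfloor>2 / e * B\<rfloor>}"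
    proof
      fix y assume "y \<in> r ` {- B..B}"
      then obtain x where x: "x \<in> {- B..B}" "y = r x" by blast
      have "2 / e * (- B) \<le> 2 / e * x" "2 / e * x \<le> 2 / e * B"
        using x e by (intro mult_left_mono; simp)+
      then have "\<lfloor>2 / e * x\<rfloor> \<in> {\<lfloor>2 / e * (- B)\<rfloor>..\<lfloor>2 / e * B\<rfloor>}"
        by (intro atLeastAtMost_iff[THEN iffD2] conjI floor_mono)
      then show "y \<in> (\<lambda>n. e / 2 * real_of_int n) ` {\<lfloor>2 / e * (- B)\<rfloor>..\<lfloor>2 / e * B\<rfloor>}"
        using x by (auto simp: r_def)
    qed
  qed simp
  then have "finite ((\<lambda>(a, b). complex_of_real a + \<i> * complex_of_real b) ` (r ` {- B..B} \<times> r ` {- B..B}))"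
    by simp
  moreover have "range s \<subseteq> (\<lambda>(a, b). complex_of_real a + \<i> * complex_of_real b) ` (r ` {- B..B} \<times> r ` {- B..B})"
  proof
    fix y assume "y \<in> range s"
    then obtain \<omega> where y: "y = s \<omega>" by blast
    have "\<bar>Re (g \<omega>)\<bar> \<le> B" "\<bar>Im (g \<omega>)\<bar> \<le> B"
      using g(2)[of \<omega>] abs_Re_le_cmod[of "g \<omega>"] abs_Im_le_cmod[of "g \<omega>"] by linarith+
    then have "r (Re (g \<omega>)) \<in> r ` {- B..B}" "r (Im (g \<omega>)) \<in> r ` {- B..B}"
      by (intro imageI; simp add: abs_le_iff)+
    then show "y \<in> (\<lambda>(a, b). complex_of_real a + \<i> * complex_of_real b) ` (r ` {- B..B} \<times> r ` {- B..B})"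
      unfolding y s_def by (intro image_eqI[of _ _ "(r (Re (g \<omega>)), r (Im (g \<omega>)))"]) auto
  qed
  ultimately have "finite (range s)"
    by (rule rev_finite_subset)
  moreover have "s \<in> borel_measurable borel"
    unfolding s_def r_def by measurable
  moreover have "norm (g \<omega> - s \<omega>) \<le> e" for \<omega>
  proof -
    have "norm (g \<omega> - s \<omega>) \<le> \<bar>Re (g \<omega> - s \<omega>)\<bar> + \<bar>Im (g \<omega> - s \<omega>)\<bar>"
      by (rule cmod_le)
    also have "\<dots> \<le> e"
      using r[of "Re (g \<omega>)"] r[of "Im (g \<omega>)"] by (simp add: s_def)
    finally show ?thesis .
  qed
  ultimately show thesis using that by blast
qed

text \<open>Both sides depend on \<open>g\<close> continuously in the uniform norm and agree on
  functions of finite range.\<close>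

lemma delta_comb_integral:
  fixes g k :: "real \<Rightarrow> complex"
  assumes M: "sets M = sets borel" and k: "integrable M k" and comb: "is_delta_comb M k I c w"
    and g: "g \<in> borel_measurable borel" "\<And>\<omega>. norm (g \<omega>) \<le> B"
  shows "(\<integral>\<omega>. g \<omega> * k \<omega> \<partial>M) = 2 * complex_of_real pi * (\<Sum>\<^sub>\<infinity>i\<in>I. c i * g (w i))"
    and "integrable M (\<lambda>\<omega>. g \<omega> * k \<omega>)"
proof -
  have c: "(\<lambda>i. norm (c i)) summable_on I"
    using comb by (simp add: is_delta_comb_def)
  have gM: "g \<in> borel_measurable M"
    using g(1) measurable_cong_sets[OF M refl] by blast
  have int: "integrable M (\<lambda>\<omega>. u \<omega> * k \<omega>)"
    if "u \<in> borel_measurable M" "\<And>\<omega>. norm (u \<omega>) \<le> D" for u :: "real \<Rightarrow> complex" and D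
    using integrable_mult_right[OF integrable_norm[OF k], of D] 
  proof (rule Bochner_Integration.integrable_bound)
    show "AE \<omega> in M. norm (u \<omega> * k \<omega>) \<le> norm (D * norm (k \<omega>))"
      using that(2) order_trans[OF norm_ge_zero that(2)]
      by (auto simp: norm_mult intro!: mult_right_mono)
  qed (use that k in measurable)
  show "integrable M (\<lambda>\<omega>. g \<omega> * k \<omega>)"
    by (rule int[OF gM g(2)])
  let ?D = "(\<integral>\<omega>. g \<omega> * k \<omega> \<partial>M) - 2 * complex_of_real pi * (\<Sum>\<^sub>\<infinity>i\<in>I. c i * g (w i))"
  \<comment> \<open>Total variation of the measure plus the total weight of the comb: a uniform
    error \<open>e\<close> in \<open>g\<close> changes the two sides together by at most
    \<open>e * ?K\<close>.\<close>
  let ?K = "(\<integral>\<omega>. norm (k \<omega>) \<partial>M) + 2 * pi * (\<Sum>\<^sub>\<infinity>i\<in>I. norm (c i))"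
  have K: "0 \<le> ?K"
    by (intro add_nonneg_nonneg mult_nonneg_nonneg infsum_nonneg Bochner_Integration.integral_nonneg) auto
  have le: "norm ?D \<le> e * ?K" if e: "0 < e" for e
  proof -
    obtain s where s: "s \<in> borel_measurable borel" "finite (range s)" "\<And>\<omega>. norm (g \<omega> - s \<omega>) \<le> e"
      using finite_range_approximation[OF g e] by blast
    have sM: "s \<in> borel_measurable M"
      using s(1) measurable_cong_sets[OF M refl] by blast
    have intd: "integrable M (\<lambda>\<omega>. (g \<omega> - s \<omega>) * k \<omega>)"
      by (rule int[OF _ s(3)]) (use gM sM in measurable)
    have ints: "integrable M (\<lambda>\<omega>. s \<omega> * k \<omega>)"
      by (rule integral_finite_range(2)[OF M k s(1,2)])
    have sb: "\<And>\<omega>. norm (s \<omega>) \<le> B + e"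
      using norm_triangle_ineq2[of "s _" "g _"] g(2) s(3) by (smt (verit) norm_minus_commute)
    have "(\<integral>\<omega>. g \<omega> * k \<omega> \<partial>M) = (\<integral>\<omega>. (g \<omega> - s \<omega>) * k \<omega> + s \<omega> * k \<omega> \<partial>M)"
      by (simp add: algebra_simps)
    also have "\<dots> = (\<integral>\<omega>. (g \<omega> - s \<omega>) * k \<omega> \<partial>M) + (\<integral>\<omega>. s \<omega> * k \<omega> \<partial>M)"
      by (rule Bochner_Integration.integral_add[OF intd ints])
    finally have 1: "(\<integral>\<omega>. g \<omega> * k \<omega> \<partial>M) = (\<integral>\<omega>. (g \<omega> - s \<omega>) * k \<omega> \<partial>M) +
        2 * complex_of_real pi * (\<Sum>\<^sub>\<infinity>i\<in>I. c i * s (w i))"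
      unfolding delta_comb_finite_range[OF M k comb s(1,2)] .
    have "(\<Sum>\<^sub>\<infinity>i\<in>I. c i * g (w i)) = (\<Sum>\<^sub>\<infinity>i\<in>I. c i * (g (w i) - s (w i)) + c i * s (w i))"
      by (simp add: right_diff_distrib)
    also have "\<dots> = (\<Sum>\<^sub>\<infinity>i\<in>I. c i * (g (w i) - s (w i))) + (\<Sum>\<^sub>\<infinity>i\<in>I. c i * s (w i))"
      by (rule infsum_add) (rule summable_bounded_times(1)[OF c], rule s(3) sb)+
    finally have "?D = (\<integral>\<omega>. (g \<omega> - s \<omega>) * k \<omega> \<partial>M) -
        2 * complex_of_real pi * (\<Sum>\<^sub>\<infinity>i\<in>I. c i * (g (w i) - s (w i)))"
      using 1 by (simp add: algebra_simps)
    also have "norm \<dots> \<le> norm (\<integral>\<omega>. (g \<omega> - s \<omega>) * k \<omega> \<partial>M) +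
        norm (2 * complex_of_real pi * (\<Sum>\<^sub>\<infinity>i\<in>I. c i * (g (w i) - s (w i))))"
      by (rule norm_triangle_ineq4)
    also have "\<dots> \<le> e * (\<integral>\<omega>. norm (k \<omega>) \<partial>M) + 2 * pi * ((\<Sum>\<^sub>\<infinity>i\<in>I. norm (c i)) * e)"
    proof (rule add_mono)
      have "norm (\<integral>\<omega>. (g \<omega> - s \<omega>) * k \<omega> \<partial>M) \<le> (\<integral>\<omega>. norm ((g \<omega> - s \<omega>) * k \<omega>) \<partial>M)"
        by (rule integral_norm_bound)
      also have "\<dots> \<le> (\<integral>\<omega>. e * norm (k \<omega>) \<partial>M)"
      proof (rule integral_mono)
        show "integrable M (\<lambda>\<omega>. norm ((g \<omega> - s \<omega>) * k \<omega>))"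
          by (rule integrable_norm[OF intd])
        show "integrable M (\<lambda>\<omega>. e * norm (k \<omega>))"
          by (rule integrable_mult_right[OF integrable_norm[OF k]])
      qed (simp add: norm_mult mult_right_mono s(3))
      finally show "norm (\<integral>\<omega>. (g \<omega> - s \<omega>) * k \<omega> \<partial>M) \<le> e * (\<integral>\<omega>. norm (k \<omega>) \<partial>M)"
        by simp
      have "norm (\<Sum>\<^sub>\<infinity>i\<in>I. c i * (g (w i) - s (w i))) \<le> (\<Sum>\<^sub>\<infinity>i\<in>I. norm (c i)) * e"
        by (rule summable_bounded_times(3)[OF c]) (rule s(3))
      then show "norm (2 * complex_of_real pi * (\<Sum>\<^sub>\<infinity>i\<in>I. c i * (g (w i) - s (w i)))) \<le>
          2 * pi * ((\<Sum>\<^sub>\<infinity>i\<in>I. norm (c i)) * e)"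
        by (simp add: norm_mult)
    qed
    finally show ?thesis
      by (simp add: algebra_simps)
  qed
  have "norm ?D \<le> 0"
  proof (rule field_le_epsilon)
    fix e :: real assume e: "0 < e"
    \<comment> \<open>The \<open>+ 1\<close> covers the case that \<open>?K\<close> is 0.\<close>
    have "norm ?D \<le> e / (?K + 1) * ?K"
      using K e by (intro le) auto
    also have "\<dots> \<le> e"
      using K e by (simp add: field_simps)
    finally show "norm ?D \<le> 0 + e" by simp
  qed
  then show "(\<integral>\<omega>. g \<omega> * k \<omega> \<partial>M) = 2 * complex_of_real pi * (\<Sum>\<^sub>\<infinity>i\<in>I. c i * g (w i))"
    by simp
qed

section \<open>The noise in the frequency domain\<close>

context noisy_loc
begin

text \<open>With \<open>\<phi>\<close> the image of the state under the operator at the second time,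
  this inserts the computational basis: the two times separate into products of scalar functions, to
  which the scalar Fubini lemmas apply.\<close>

lemma cinner_S_int_expand:
  assumes t: "t\<^sub>1 \<in> {0..T}" and \<alpha>: "\<alpha> \<in> labels l" and \<phi>: "\<phi> \<in> qubit_space Q"
  shows "cinner \<Psi> (S_int l \<alpha> t\<^sub>1 \<phi>) = (\<Sum>s\<in>Pow Q. cinner \<Psi> (S_int l \<alpha> t\<^sub>1 (axis s 1)) * \<phi> $ s)"
  by (subst clinear_on_qubit_expand[OF S_int_lin[OF \<alpha> t] \<phi>])
    (simp add: cinner.sum_right cinner_scaleC_right mult.commute)

lemma piecewise_continuous_bra:
  assumes \<alpha>: "\<alpha> \<in> labels l" and \<phi>: "\<phi> \<in> qubit_space Q"
  shows "piecewise_continuous T F (\<lambda>t. cinner \<Psi> (S_int l \<alpha> t \<phi>))"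
proof
  show "continuous_on ({0..T} - F) (\<lambda>t. cinner \<Psi> (S_int l \<alpha> t \<phi>))"
    by (intro cinner.continuous_on continuous_on_const S_int_cont \<alpha> \<phi>)
  show "\<exists>B. \<forall>t\<in>{0..T}. norm (cinner \<Psi> (S_int l \<alpha> t \<phi>)) \<le> B"
  proof (intro exI ballI)
    fix t assume t: "t \<in> {0..T}"
    have "norm (cinner \<Psi> (S_int l \<alpha> t \<phi>)) \<le> norm \<Psi> * norm (S_int l \<alpha> t \<phi>)"
      by (rule norm_cinner_le)
    also have "\<dots> \<le> norm \<Psi> * (op_norm (qubit_space Q) (sys_op l \<alpha>) * norm \<phi>)"
      by (intro mult_left_mono S_int_bound \<alpha> t \<phi>) simp
    finally show "norm (cinner \<Psi> (S_int l \<alpha> t \<phi>)) \<le>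
        norm \<Psi> * (op_norm (qubit_space Q) (sys_op l \<alpha>) * norm \<phi>)" .
  qed
qed (rule F)

lemma piecewise_continuous_ket:
  assumes "\<beta> \<in> labels l" "\<phi> \<in> qubit_space Q"
  shows "piecewise_continuous T F (\<lambda>t. S_int l \<beta> t \<phi> $ s)"
  using piecewise_continuous_bra[OF assms, of "axis s 1"] by (simp add: cinner_axis)

lemma integrable_phase_S_int:
  assumes \<alpha>: "\<alpha> \<in> labels l" and \<phi>: "\<phi> \<in> qubit_space Q"
  shows "(\<lambda>t. phase (\<omega> * t) *\<^sub>C S_int l \<alpha> t \<phi>) integrable_on {0..T}"
proof (rule integrable_piecewise_continuous[OF F])
  show "continuous_on ({0..T} - F) (\<lambda>t. phase (\<omega> * t) *\<^sub>C S_int l \<alpha> t \<phi>)"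
    by (intro scaleC.continuous_on S_int_cont \<alpha> \<phi>) (intro continuous_intros)
  fix t assume "t \<in> {0..T} - F"
  then show "norm (phase (\<omega> * t) *\<^sub>C S_int l \<alpha> t \<phi>) \<le> op_norm (qubit_space Q) (sys_op l \<alpha>) * norm \<phi>"
    using S_int_bound[OF \<alpha> _ \<phi>, of t] by (simp add: norm_scaleC)
qed

lemma cinner_S_fourier:
  assumes \<alpha>: "\<alpha> \<in> labels l" and \<phi>: "\<phi> \<in> qubit_space Q"
  shows "cinner \<Psi> (S_fourier l T \<alpha> \<omega> \<phi>) = fourier T (\<lambda>t. cinner \<Psi> (S_int l \<alpha> t \<phi>)) \<omega>"
  using integral_linear[OF integrable_phase_S_int[OF \<alpha> \<phi>, of \<omega>] cinner.bounded_linear_right[of \<Psi>]]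
  by (simp add: S_fourier_def fourier_def o_def cinner_scaleC_right)

lemma S_fourier_mem:
  assumes \<alpha>: "\<alpha> \<in> labels l" and \<phi>: "\<phi> \<in> qubit_space Q"
  shows "S_fourier l T \<alpha> \<omega> \<phi> \<in> qubit_space Q"
  unfolding S_fourier_def
  by (intro integral_in_subspace csubspace_imp_subspace closed_qubit_space csubspace_qubit_space
      csubspaceD(3)[OF csubspace_qubit_space] S_int_mem \<alpha> \<phi>)

text \<open>The basis is inserted under the time integral of the left factor, where linearity of
  \<open>S_int\<close> is at hand.\<close>

lemma expect_S_fourier:
  assumes \<alpha>: "\<alpha> \<in> labels l" and \<beta>: "\<beta> \<in> labels l" and \<Psi>: "\<Psi> \<in> qubit_space Q"
  shows "expect \<Psi> (\<lambda>\<psi>. S_fourier l T \<alpha> \<omega> (S_fourier l T \<beta> (- \<omega>) \<psi>)) =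
    (\<Sum>s\<in>Pow Q. fourier T (\<lambda>t. cinner \<Psi> (S_int l \<alpha> t (axis s 1))) \<omega> *
      fourier T (\<lambda>t. S_int l \<beta> t \<Psi> $ s) (- \<omega>))"
proof -
  let ?\<phi> = "S_fourier l T \<beta> (- \<omega>) \<Psi>"
  have \<phi>: "?\<phi> \<in> qubit_space Q"
    by (rule S_fourier_mem[OF \<beta> \<Psi>])
  have nth: "?\<phi> $ s = fourier T (\<lambda>t. S_int l \<beta> t \<Psi> $ s) (- \<omega>)" for s
    using cinner_S_fourier[OF \<beta> \<Psi>, of "axis s 1"] by (simp add: cinner_axis)
  have int: "(\<lambda>t. phase (\<omega> * t) * cinner \<Psi> (S_int l \<alpha> t (axis s 1)) * ?\<phi> $ s) integrable_on {0..T}"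
    if "s \<in> Pow Q" for s
    using piecewise_continuous.integrable_phase_times[OF piecewise_continuous_bra[OF \<alpha> axis_in_qubit_space]] that
    by (intro integrable_on_mult_left) auto
  have "expect \<Psi> (\<lambda>\<psi>. S_fourier l T \<alpha> \<omega> (S_fourier l T \<beta> (- \<omega>) \<psi>)) =
      integral {0..T} (\<lambda>t. phase (\<omega> * t) * cinner \<Psi> (S_int l \<alpha> t ?\<phi>))"
    unfolding expect_def cinner_S_fourier[OF \<alpha> \<phi>] fourier_def ..
  also have "\<dots> = integral {0..T} (\<lambda>t. \<Sum>s\<in>Pow Q. phase (\<omega> * t) * cinner \<Psi> (S_int l \<alpha> t (axis s 1)) * ?\<phi> $ s)"
    by (rule Henstock_Kurzweil_Integration.integral_cong)
      (simp add: cinner_S_int_expand[OF _ \<alpha> \<phi>] sum_distrib_left mult.assoc)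
  also have "\<dots> = (\<Sum>s\<in>Pow Q. integral {0..T} (\<lambda>t. phase (\<omega> * t) * cinner \<Psi> (S_int l \<alpha> t (axis s 1)) * ?\<phi> $ s))"
    by (rule Henstock_Kurzweil_Integration.integral_sum) (use int in auto)
  also have "\<dots> = (\<Sum>s\<in>Pow Q. fourier T (\<lambda>t. cinner \<Psi> (S_int l \<alpha> t (axis s 1))) \<omega> * ?\<phi> $ s)"
    by (simp add: fourier_def)
  finally show ?thesis
    by (simp add: nth)
qed

text \<open>These are the properties that \<open>delta_comb_integral\<close> demands of the function
  integrated against the comb.\<close>

lemma measurable_expect_S_fourier:
  assumes \<alpha>: "\<alpha> \<in> labels l" and \<beta>: "\<beta> \<in> labels l" and \<Psi>: "\<Psi> \<in> qubit_space Q"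
  shows "(\<lambda>\<omega>. expect \<Psi> (\<lambda>\<psi>. S_fourier l T \<alpha> \<omega> (S_fourier l T \<beta> (- \<omega>) \<psi>))) \<in> borel_measurable borel"
    and "\<exists>B. \<forall>\<omega>. norm (expect \<Psi> (\<lambda>\<psi>. S_fourier l T \<alpha> \<omega> (S_fourier l T \<beta> (- \<omega>) \<psi>))) \<le> B"
proof -
  let ?g = "\<lambda>s. fourier T (\<lambda>t. cinner \<Psi> (S_int l \<alpha> t (axis s 1)))"
  let ?h = "\<lambda>s. fourier T (\<lambda>t. S_int l \<beta> t \<Psi> $ s)"
  have g: "?g s \<in> borel_measurable borel" "\<exists>B. \<forall>\<omega>. norm (?g s \<omega>) \<le> B" if "s \<in> Pow Q" for s
    using piecewise_continuous_bra[OF \<alpha> axis_in_qubit_space, of s \<Psi>] that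
    by (auto intro: piecewise_continuous.measurable_fourier piecewise_continuous.bounded_fourier)
  have h: "?h s \<in> borel_measurable borel" "\<exists>B. \<forall>\<omega>. norm (?h s \<omega>) \<le> B" for s
    using piecewise_continuous_ket[OF \<beta> \<Psi>, of s]
    by (auto intro: piecewise_continuous.measurable_fourier piecewise_continuous.bounded_fourier)
  have "(\<lambda>\<omega>. ?h s (- \<omega>)) \<in> borel_measurable borel" for s
    by (rule measurable_compose[OF _ h(1)]) simp
  then show "(\<lambda>\<omega>. expect \<Psi> (\<lambda>\<psi>. S_fourier l T \<alpha> \<omega> (S_fourier l T \<beta> (- \<omega>) \<psi>))) \<in> borel_measurable borel"
    unfolding expect_S_fourier[OF assms]
    by (intro borel_measurable_sum borel_measurable_times g(1)) auto
  obtain Bg where Bg: "\<And>s \<omega>. s \<in> Pow Q \<Longrightarrow> norm (?g s \<omega>) \<le> Bg s"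
    using g(2) by metis
  obtain Bh where Bh: "\<And>s \<omega>. norm (?h s \<omega>) \<le> Bh s"
    using h(2) by metis
  show "\<exists>B. \<forall>\<omega>. norm (expect \<Psi> (\<lambda>\<psi>. S_fourier l T \<alpha> \<omega> (S_fourier l T \<beta> (- \<omega>) \<psi>))) \<le> B"
  proof (intro exI allI)
    fix \<omega>
    show "norm (expect \<Psi> (\<lambda>\<psi>. S_fourier l T \<alpha> \<omega> (S_fourier l T \<beta> (- \<omega>) \<psi>))) \<le> (\<Sum>s\<in>Pow Q. Bg s * Bh s)"
      unfolding expect_S_fourier[OF assms]
    proof (rule sum_norm_le)
      fix s assume s: "s \<in> Pow Q"
      show "norm (?g s \<omega> * ?h s (- \<omega>)) \<le> Bg s * Bh s"
        unfolding norm_mult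
        by (intro mult_mono Bg[OF s] Bh norm_ge_zero order_trans[OF norm_ge_zero Bg[OF s]])
    qed
  qed
qed

text \<open>The frequency integral is exchanged with one time integral after the other:
  \<open>t\<^sub>2\<close> with the phase of \<open>t\<^sub>1\<close> absorbed into the weight, then
  \<open>t\<^sub>1\<close>.\<close>

lemma spectral_integral_eq:
  assumes stat: "stationary_correlations T l M K" and \<Psi>: "\<Psi> \<in> qubit_space Q"
  shows "spectral_integral M (\<lambda>\<omega>. \<Sum>\<alpha>\<in>labels l. \<Sum>\<beta>\<in>labels l.
        expect \<Psi> (\<lambda>\<psi>. S_fourier l T \<alpha> \<omega> (S_fourier l T \<beta> (- \<omega>) \<psi>)) * K \<alpha> \<beta> \<omega>) =
    integral {0..T} (\<lambda>t\<^sub>1. integral {0..T} (\<lambda>t\<^sub>2. \<Sum>\<alpha>\<in>labels l. \<Sum>\<beta>\<in>labels l.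
        expect \<Psi> (\<lambda>\<psi>. S_int l \<alpha> t\<^sub>1 (S_int l \<beta> t\<^sub>2 \<psi>)) *
        expect (bath_init l) (\<lambda>\<phi>. B_int l \<alpha> t\<^sub>1 (B_int l \<beta> t\<^sub>2 \<phi>))))"
proof -
  define g where "g \<alpha> s t = cinner \<Psi> (S_int l \<alpha> t (axis s 1))" for \<alpha> s t
  define h where "h \<beta> s t = S_int l \<beta> t \<Psi> $ s" for \<beta> s t
  define k where "k \<alpha> \<beta> \<omega> = K \<alpha> \<beta> \<omega> / (2 * complex_of_real pi)" for \<alpha> \<beta> \<omega>
  \<comment> \<open>The frequency weight that is left once the integral over
    \<open>t\<^sub>2\<close> has been carried out.\<close>
  let ?h' = "\<lambda>\<alpha> \<beta> s \<omega>. fourier T (h \<beta> s) (- \<omega>) * k \<alpha> \<beta> \<omega>"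
  let ?C = "\<lambda>\<alpha> \<beta> t\<^sub>1 t\<^sub>2. expect (bath_init l) (\<lambda>\<phi>. B_int l \<alpha> t\<^sub>1 (B_int l \<beta> t\<^sub>2 \<phi>))"
  have pg: "piecewise_continuous T F (g \<alpha> s)" if "\<alpha> \<in> labels l" "s \<in> Pow Q" for \<alpha> s
    unfolding g_def using that by (intro piecewise_continuous_bra axis_in_qubit_space) auto
  have ph: "piecewise_continuous T F (h \<beta> s)" if "\<beta> \<in> labels l" for \<beta> s
    unfolding h_def using that by (intro piecewise_continuous_ket \<Psi>)
  have M: "sigma_finite_measure M" "sets M = sets borel" "integrable M (k \<alpha> \<beta>)"
    if "\<alpha> \<in> labels l" "\<beta> \<in> labels l" for \<alpha> \<beta>
    using stat that unfolding stationary_correlations_def spectral_function_def k_def by auto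
  \<comment> \<open>The phase of the time difference splits in two; the explicit factors
    \<open>- 1\<close> and \<open>1\<close> are the values of \<open>\<sigma>\<close> in the Fubini
    lemmas and become the arguments \<open>- \<omega>\<close> and \<open>\<omega>\<close> of the
    Fourier transforms.\<close>
  have C: "?C \<alpha> \<beta> t\<^sub>1 t\<^sub>2 = (\<integral>\<omega>. phase (- 1 * \<omega> * t\<^sub>2) * (phase (1 * \<omega> * t\<^sub>1) * k \<alpha> \<beta> \<omega>) \<partial>M)"
    if "\<alpha> \<in> labels l" "\<beta> \<in> labels l" "t\<^sub>1 \<in> {0..T}" "t\<^sub>2 \<in> {0..T}" for \<alpha> \<beta> t\<^sub>1 t\<^sub>2
  proof -
    have "phase (\<omega> * (t\<^sub>1 - t\<^sub>2)) = phase (- 1 * \<omega> * t\<^sub>2) * phase (1 * \<omega> * t\<^sub>1)" for \<omega>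
      by (simp add: exp_add[symmetric] algebra_simps)
    then show ?thesis
      using stat that unfolding stationary_correlations_def spectral_integral_def k_def
      by (simp add: mult.assoc)
  qed
  have S: "expect \<Psi> (\<lambda>\<psi>. S_int l \<alpha> t\<^sub>1 (S_int l \<beta> t\<^sub>2 \<psi>)) = (\<Sum>s\<in>Pow Q. g \<alpha> s t\<^sub>1 * h \<beta> s t\<^sub>2)"
    if "\<alpha> \<in> labels l" "\<beta> \<in> labels l" "t\<^sub>1 \<in> {0..T}" "t\<^sub>2 \<in> {0..T}" for \<alpha> \<beta> t\<^sub>1 t\<^sub>2
    unfolding expect_def g_def h_def using that by (intro cinner_S_int_expand S_int_mem \<Psi>)
  have inner_int: "integral {0..T} (\<lambda>t\<^sub>2. \<Sum>\<alpha>\<in>labels l. \<Sum>\<beta>\<in>labels l.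
        expect \<Psi> (\<lambda>\<psi>. S_int l \<alpha> t\<^sub>1 (S_int l \<beta> t\<^sub>2 \<psi>)) * ?C \<alpha> \<beta> t\<^sub>1 t\<^sub>2) =
      (\<Sum>\<alpha>\<in>labels l. \<Sum>\<beta>\<in>labels l. \<Sum>s\<in>Pow Q.
        g \<alpha> s t\<^sub>1 * (\<integral>\<omega>. phase (1 * \<omega> * t\<^sub>1) * ?h' \<alpha> \<beta> s \<omega> \<partial>M))"
    if t: "t\<^sub>1 \<in> {0..T}" for t\<^sub>1
  proof -
    have "((\<lambda>t\<^sub>2. \<Sum>\<alpha>\<in>labels l. \<Sum>\<beta>\<in>labels l. \<Sum>s\<in>Pow Q. g \<alpha> s t\<^sub>1 *
          (h \<beta> s t\<^sub>2 * (\<integral>\<omega>. phase (- 1 * \<omega> * t\<^sub>2) * (phase (1 * \<omega> * t\<^sub>1) * k \<alpha> \<beta> \<omega>) \<partial>M))) has_integral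
        (\<Sum>\<alpha>\<in>labels l. \<Sum>\<beta>\<in>labels l. \<Sum>s\<in>Pow Q. g \<alpha> s t\<^sub>1 *
          (\<integral>\<omega>. fourier T (h \<beta> s) (- 1 * \<omega>) * (phase (1 * \<omega> * t\<^sub>1) * k \<alpha> \<beta> \<omega>) \<partial>M))) {0..T}"
      by (intro has_integral_sum has_integral_mult_right labels finite_Pow_iff[THEN iffD2] finite
          piecewise_continuous.Fubini_fourier(1)[OF ph] integrable_phase_mult M)
    then have "((\<lambda>t\<^sub>2. \<Sum>\<alpha>\<in>labels l. \<Sum>\<beta>\<in>labels l.
          expect \<Psi> (\<lambda>\<psi>. S_int l \<alpha> t\<^sub>1 (S_int l \<beta> t\<^sub>2 \<psi>)) * ?C \<alpha> \<beta> t\<^sub>1 t\<^sub>2) has_integral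
        (\<Sum>\<alpha>\<in>labels l. \<Sum>\<beta>\<in>labels l. \<Sum>s\<in>Pow Q. g \<alpha> s t\<^sub>1 *
          (\<integral>\<omega>. fourier T (h \<beta> s) (- 1 * \<omega>) * (phase (1 * \<omega> * t\<^sub>1) * k \<alpha> \<beta> \<omega>) \<partial>M))) {0..T}"
      by (rule has_integral_eq[rotated])
        (use t in \<open>auto simp: S C sum_distrib_right mult.assoc intro!: sum.cong\<close>)
    from integral_unique[OF this] show ?thesis
      by (simp add: mult.left_commute)
  qed
  have "((\<lambda>t\<^sub>1. \<Sum>\<alpha>\<in>labels l. \<Sum>\<beta>\<in>labels l. \<Sum>s\<in>Pow Q.
        g \<alpha> s t\<^sub>1 * (\<integral>\<omega>. phase (1 * \<omega> * t\<^sub>1) * ?h' \<alpha> \<beta> s \<omega> \<partial>M)) has_integral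
      (\<Sum>\<alpha>\<in>labels l. \<Sum>\<beta>\<in>labels l. \<Sum>s\<in>Pow Q.
        (\<integral>\<omega>. fourier T (g \<alpha> s) (1 * \<omega>) * ?h' \<alpha> \<beta> s \<omega> \<partial>M))) {0..T}"
    using piecewise_continuous.Fubini_fourier(2)[OF ph M, where \<sigma> = "- 1"]
    by (intro has_integral_sum labels finite piecewise_continuous.Fubini_fourier(1)[OF pg] M) simp_all
  then have "((\<lambda>t\<^sub>1. integral {0..T} (\<lambda>t\<^sub>2. \<Sum>\<alpha>\<in>labels l. \<Sum>\<beta>\<in>labels l.
        expect \<Psi> (\<lambda>\<psi>. S_int l \<alpha> t\<^sub>1 (S_int l \<beta> t\<^sub>2 \<psi>)) * ?C \<alpha> \<beta> t\<^sub>1 t\<^sub>2)) has_integral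
      (\<Sum>\<alpha>\<in>labels l. \<Sum>\<beta>\<in>labels l. \<Sum>s\<in>Pow Q.
        (\<integral>\<omega>. fourier T (g \<alpha> s) (1 * \<omega>) * ?h' \<alpha> \<beta> s \<omega> \<partial>M))) {0..T}"
    by (rule has_integral_eq[rotated]) (simp only: inner_int)
  note total = integral_unique[OF this]
  have int: "integrable M (\<lambda>\<omega>. fourier T (g \<alpha> s) \<omega> * ?h' \<alpha> \<beta> s \<omega>)"
    if "\<alpha> \<in> labels l" "\<beta> \<in> labels l" "s \<in> Pow Q" for \<alpha> \<beta> s
  proof -
    have "integrable M (?h' \<alpha> \<beta> s)"
      using piecewise_continuous.Fubini_fourier(2)[OF ph[OF that(2)] M[OF that(1,2)], where \<sigma> = "- 1"] by simp
    from piecewise_continuous.Fubini_fourier(2)[OF pg[OF that(1,3)] M(1,2)[OF that(1,2)] this, where \<sigma> = 1]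
    show ?thesis by simp
  qed
  have "spectral_integral M (\<lambda>\<omega>. \<Sum>\<alpha>\<in>labels l. \<Sum>\<beta>\<in>labels l.
        expect \<Psi> (\<lambda>\<psi>. S_fourier l T \<alpha> \<omega> (S_fourier l T \<beta> (- \<omega>) \<psi>)) * K \<alpha> \<beta> \<omega>) =
      (\<integral>\<omega>. (\<Sum>\<alpha>\<in>labels l. \<Sum>\<beta>\<in>labels l. \<Sum>s\<in>Pow Q. fourier T (g \<alpha> s) \<omega> * ?h' \<alpha> \<beta> s \<omega>) \<partial>M)"
    unfolding spectral_integral_def
    by (rule Bochner_Integration.integral_cong)
      (simp_all add: expect_S_fourier[OF _ _ \<Psi>] g_def[abs_def] h_def[abs_def] k_def sum_divide_distrib sum_distrib_right
        mult.assoc)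
  also have "\<dots> = (\<Sum>\<alpha>\<in>labels l. \<Sum>\<beta>\<in>labels l. \<Sum>s\<in>Pow Q.
      (\<integral>\<omega>. fourier T (g \<alpha> s) \<omega> * ?h' \<alpha> \<beta> s \<omega> \<partial>M))"
    by (intro trans[OF Bochner_Integration.integral_sum] sum.cong refl
        Bochner_Integration.integrable_sum int)
  finally show ?thesis
    using total by simp
qed

lemma delta_comb_sum_eq:
  assumes stat: "stationary_correlations T l M K" and \<Psi>: "\<Psi> \<in> qubit_space Q"
    and comb: "\<forall>\<alpha>\<in>labels l. \<forall>\<beta>\<in>labels l. is_delta_comb M (K \<alpha> \<beta>) I (J2 \<alpha> \<beta>) w"
  shows "(\<Sum>\<^sub>\<infinity>i\<in>I. \<Sum>\<alpha>\<in>labels l. \<Sum>\<beta>\<in>labels l. J2 \<alpha> \<beta> i *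
        expect \<Psi> (\<lambda>\<psi>. S_fourier l T \<alpha> (w i) (S_fourier l T \<beta> (- w i) \<psi>))) =
    spectral_integral M (\<lambda>\<omega>. \<Sum>\<alpha>\<in>labels l. \<Sum>\<beta>\<in>labels l.
        expect \<Psi> (\<lambda>\<psi>. S_fourier l T \<alpha> \<omega> (S_fourier l T \<beta> (- \<omega>) \<psi>)) * K \<alpha> \<beta> \<omega>)"
proof -
  define X where "X \<alpha> \<beta> \<omega> = expect \<Psi> (\<lambda>\<psi>. S_fourier l T \<alpha> \<omega> (S_fourier l T \<beta> (- \<omega>) \<psi>))" for \<alpha> \<beta> \<omega>
  have X: "X \<alpha> \<beta> \<in> borel_measurable borel" "\<exists>B. \<forall>\<omega>. norm (X \<alpha> \<beta> \<omega>) \<le> B"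
    if "\<alpha> \<in> labels l" "\<beta> \<in> labels l" for \<alpha> \<beta>
    unfolding X_def[abs_def] using that by (rule measurable_expect_S_fourier[OF _ _ \<Psi>])+
  have M: "sets M = sets borel" "integrable M (K \<alpha> \<beta>)"
    if "\<alpha> \<in> labels l" "\<beta> \<in> labels l" for \<alpha> \<beta>
    using stat that unfolding stationary_correlations_def spectral_function_def by auto
  have summable: "(\<lambda>i. J2 \<alpha> \<beta> i * X \<alpha> \<beta> (w i)) summable_on I"
    and eq: "(\<integral>\<omega>. X \<alpha> \<beta> \<omega> * K \<alpha> \<beta> \<omega> \<partial>M) = 2 * complex_of_real pi * (\<Sum>\<^sub>\<infinity>i\<in>I. J2 \<alpha> \<beta> i * X \<alpha> \<beta> (w i))"
    and int: "integrable M (\<lambda>\<omega>. X \<alpha> \<beta> \<omega> * K \<alpha> \<beta> \<omega>)"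
    if "\<alpha> \<in> labels l" "\<beta> \<in> labels l" for \<alpha> \<beta>
  proof -
    note X = X[OF that]
    obtain B where B: "\<And>\<omega>. norm (X \<alpha> \<beta> \<omega>) \<le> B"
      using X(2) by blast
    have c: "is_delta_comb M (K \<alpha> \<beta>) I (J2 \<alpha> \<beta>) w"
      using comb that by blast
    show "(\<lambda>i. J2 \<alpha> \<beta> i * X \<alpha> \<beta> (w i)) summable_on I"
      by (rule summable_bounded_times(1)[OF _ B]) (use c in \<open>simp add: is_delta_comb_def\<close>)
    show "(\<integral>\<omega>. X \<alpha> \<beta> \<omega> * K \<alpha> \<beta> \<omega> \<partial>M) = 2 * complex_of_real pi * (\<Sum>\<^sub>\<infinity>i\<in>I. J2 \<alpha> \<beta> i * X \<alpha> \<beta> (w i))"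
      "integrable M (\<lambda>\<omega>. X \<alpha> \<beta> \<omega> * K \<alpha> \<beta> \<omega>)"
      by (rule delta_comb_integral[OF M[OF that] c X(1) B])+
  qed
  have "(\<Sum>\<^sub>\<infinity>i\<in>I. \<Sum>\<alpha>\<in>labels l. \<Sum>\<beta>\<in>labels l. J2 \<alpha> \<beta> i * X \<alpha> \<beta> (w i)) =
      (\<Sum>\<alpha>\<in>labels l. \<Sum>\<^sub>\<infinity>i\<in>I. \<Sum>\<beta>\<in>labels l. J2 \<alpha> \<beta> i * X \<alpha> \<beta> (w i))"
    by (intro infsum_finite_sum(2) infsum_finite_sum(1) summable)
  also have "\<dots> = (\<Sum>\<alpha>\<in>labels l. \<Sum>\<beta>\<in>labels l. \<Sum>\<^sub>\<infinity>i\<in>I. J2 \<alpha> \<beta> i * X \<alpha> \<beta> (w i))"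
    by (intro sum.cong refl infsum_finite_sum(2) summable)
  \<comment> \<open>The factor \<open>2 * pi\<close> in the comb cancels against the denominator of
    \<open>spectral_integral\<close>.\<close>
  also have "\<dots> = (\<Sum>\<alpha>\<in>labels l. \<Sum>\<beta>\<in>labels l. (\<integral>\<omega>. X \<alpha> \<beta> \<omega> * K \<alpha> \<beta> \<omega> \<partial>M) / (2 * complex_of_real pi))"
    by (intro sum.cong refl) (simp add: eq)
  also have "\<dots> = spectral_integral M (\<lambda>\<omega>. \<Sum>\<alpha>\<in>labels l. \<Sum>\<beta>\<in>labels l. X \<alpha> \<beta> \<omega> * K \<alpha> \<beta> \<omega>)"
    by (simp add: spectral_integral_def sum_divide_distrib int Bochner_Integration.integral_sum)
  finally show ?thesis
    by (simp add: X_def)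
qed

end

theorem mainTheorem7:
  fixes T J \<eta> :: real
    and A :: "'l set"
    and C :: "'l \<Rightarrow> ('q::finite, 'b::complex_hilbert, 'k) location"
  assumes "0 \<le> T"
    and "noisy_circuit T J A C"
    and "0 \<le> \<eta>"
    and "complex_of_real (\<eta>\<^sup>2) =
      max_over A C (\<lambda>a \<Psi>. expect (product_state \<Psi> (bath_init (C a)))
        (\<lambda>v. adj (loc_space (C a)) (U_int (C a) T) (U_int (C a) T v - v) - (U_int (C a) T v - v)))"
  shows "(\<forall>a\<in>A. \<forall>t\<in>{0..T}.
        op_norm (loc_space (C a)) (H_int (C a) t) = op_norm (loc_space (C a)) (H_err (C a))) \<and>
    complex_of_real (\<eta>\<^sup>2) =
      max_over A C (\<lambda>a \<Psi>. expect (product_state \<Psi> (bath_init (C a)))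
        (\<lambda>v. 2 *\<^sub>C v - U_int (C a) T v - adj (loc_space (C a)) (U_int (C a) T) v)) \<and>
    complex_of_real (\<eta>\<^sup>2) \<le>
      max_over A C (\<lambda>a \<Psi>. integral {0..T} (\<lambda>t\<^sub>1. integral {0..T} (\<lambda>t\<^sub>2.
        expect (product_state \<Psi> (bath_init (C a))) (\<lambda>v. H_int (C a) t\<^sub>1 (H_int (C a) t\<^sub>2 v)))))
      + tail_bound (J * T) \<and>
    complex_of_real (\<eta>\<^sup>2) \<le>
      max_over A C (\<lambda>a \<Psi>. integral {0..T} (\<lambda>t\<^sub>1. integral {0..T} (\<lambda>t\<^sub>2.
        \<Sum>\<alpha>\<in>labels (C a). \<Sum>\<beta>\<in>labels (C a).
          expect \<Psi> (\<lambda>\<psi>. S_int (C a) \<alpha> t\<^sub>1 (S_int (C a) \<beta> t\<^sub>2 \<psi>)) *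
          expect (bath_init (C a)) (\<lambda>\<phi>. B_int (C a) \<alpha> t\<^sub>1 (B_int (C a) \<beta> t\<^sub>2 \<phi>)))))
      + tail_bound (J * T) \<and>
    (\<forall>(M :: 'l \<Rightarrow> real measure) (K :: 'l \<Rightarrow> 'k \<Rightarrow> 'k \<Rightarrow> real \<Rightarrow> complex).
      (\<forall>a\<in>A. stationary_correlations T (C a) (M a) (K a)) \<longrightarrow>
        complex_of_real (\<eta>\<^sup>2) \<le>
          max_over A C (\<lambda>a \<Psi>. spectral_integral (M a) (\<lambda>\<omega>.
            \<Sum>\<alpha>\<in>labels (C a). \<Sum>\<beta>\<in>labels (C a).
              expect \<Psi> (\<lambda>\<psi>. S_fourier (C a) T \<alpha> \<omega> (S_fourier (C a) T \<beta> (- \<omega>) \<psi>)) *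
              K a \<alpha> \<beta> \<omega>))
          + tail_bound (J * T) \<and>
        (\<forall>(I :: 'l \<Rightarrow> 'i set) (\<omega> :: 'l \<Rightarrow> 'i \<Rightarrow> real) (J2 :: 'l \<Rightarrow> 'k \<Rightarrow> 'k \<Rightarrow> 'i \<Rightarrow> complex).
          (\<forall>a\<in>A. \<forall>\<alpha>\<in>labels (C a). \<forall>\<beta>\<in>labels (C a).
             is_delta_comb (M a) (K a \<alpha> \<beta>) (I a) (J2 a \<alpha> \<beta>) (\<omega> a)) \<longrightarrow>
          complex_of_real (\<eta>\<^sup>2) \<le>
            max_over A C (\<lambda>a \<Psi>. \<Sum>\<^sub>\<infinity>i\<in>I a. \<Sum>\<alpha>\<in>labels (C a). \<Sum>\<beta>\<in>labels (C a).
              J2 a \<alpha> \<beta> i *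
              expect \<Psi> (\<lambda>\<psi>. S_fourier (C a) T \<alpha> (\<omega> a i) (S_fourier (C a) T \<beta> (- \<omega> a i) \<psi>)))
            + tail_bound (J * T)))"
proof -
  note T = assms(1) and circ = assms(2) and \<eta> = assms(4)
  let ?N = "\<lambda>a \<Psi>. complex_of_real
    ((norm (integral {0..T} (\<lambda>t. H_int (C a) t (product_state \<Psi> (bath_init (C a))))))\<^sup>2)"
  let ?corr = "\<lambda>a \<Psi>. integral {0..T} (\<lambda>t\<^sub>1. integral {0..T} (\<lambda>t\<^sub>2.
        \<Sum>\<alpha>\<in>labels (C a). \<Sum>\<beta>\<in>labels (C a).
          expect \<Psi> (\<lambda>\<psi>. S_int (C a) \<alpha> t\<^sub>1 (S_int (C a) \<beta> t\<^sub>2 \<psi>)) *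
          expect (bath_init (C a)) (\<lambda>\<phi>. B_int (C a) \<alpha> t\<^sub>1 (B_int (C a) \<beta> t\<^sub>2 \<phi>))))"
  note le = noise_le_max_over[OF T circ \<eta>]
  have HH: "integral {0..T} (\<lambda>t\<^sub>1. integral {0..T} (\<lambda>t\<^sub>2.
        expect (product_state \<Psi> (bath_init (C a))) (\<lambda>v. H_int (C a) t\<^sub>1 (H_int (C a) t\<^sub>2 v)))) = ?N a \<Psi>"
    and corr: "?corr a \<Psi> = ?N a \<Psi>"
    if a: "a \<in> A" and \<Psi>: "\<Psi> \<in> sys_space (C a)" for a \<Psi>
  proof -
    obtain F where "noisy_loc T J (C a) F"
      by (rule noisy_circuit_locationD[OF T circ a])
    then interpret noisy_loc T J "C a" F .
    show HH: "integral {0..T} (\<lambda>t\<^sub>1. integral {0..T} (\<lambda>t\<^sub>2.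
        expect (product_state \<Psi> (bath_init (C a))) (\<lambda>v. H_int (C a) t\<^sub>1 (H_int (C a) t\<^sub>2 v)))) = ?N a \<Psi>"
      by (rule expect_H_H_integral[OF product_state_in_L[OF \<Psi>]])
    have "?corr a \<Psi> = integral {0..T} (\<lambda>t\<^sub>1. integral {0..T} (\<lambda>t\<^sub>2.
        expect (product_state \<Psi> (bath_init (C a))) (\<lambda>v. H_int (C a) t\<^sub>1 (H_int (C a) t\<^sub>2 v))))"
      using \<Psi> unfolding sys_space_def
      by (intro Henstock_Kurzweil_Integration.integral_cong expect_H_H[symmetric])
    then show "?corr a \<Psi> = ?N a \<Psi>"
      by (simp only: HH)
  qed
  have spectral: "spectral_integral M (\<lambda>\<omega>. \<Sum>\<alpha>\<in>labels (C a). \<Sum>\<beta>\<in>labels (C a).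
        expect \<Psi> (\<lambda>\<psi>. S_fourier (C a) T \<alpha> \<omega> (S_fourier (C a) T \<beta> (- \<omega>) \<psi>)) * K \<alpha> \<beta> \<omega>) = ?N a \<Psi>"
    if a: "a \<in> A" and \<Psi>: "\<Psi> \<in> sys_space (C a)" and stat: "stationary_correlations T (C a) M K"
    for a \<Psi> M K
  proof -
    obtain F where "noisy_loc T J (C a) F"
      by (rule noisy_circuit_locationD[OF T circ a])
    then interpret noisy_loc T J "C a" F .
    show ?thesis
      using spectral_integral_eq[OF stat, of \<Psi>] corr[OF a \<Psi>] \<Psi> by (simp add: sys_space_def)
  qed
  have comb: "(\<Sum>\<^sub>\<infinity>i\<in>I. \<Sum>\<alpha>\<in>labels (C a). \<Sum>\<beta>\<in>labels (C a). J2 \<alpha> \<beta> i *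
        expect \<Psi> (\<lambda>\<psi>. S_fourier (C a) T \<alpha> (w i) (S_fourier (C a) T \<beta> (- w i) \<psi>))) = ?N a \<Psi>"
    if a: "a \<in> A" and \<Psi>: "\<Psi> \<in> sys_space (C a)" and stat: "stationary_correlations T (C a) M K"
      and comb: "\<forall>\<alpha>\<in>labels (C a). \<forall>\<beta>\<in>labels (C a). is_delta_comb M (K \<alpha> \<beta>) I (J2 \<alpha> \<beta>) w"
    for a \<Psi> M K J2 w and I :: "'i set"
  proof -
    obtain F where "noisy_loc T J (C a) F"
      by (rule noisy_circuit_locationD[OF T circ a])
    then interpret noisy_loc T J "C a" F .
    show ?thesis
      using delta_comb_sum_eq[OF stat, of \<Psi>] spectral[OF a \<Psi> stat] comb \<Psi>
      by (simp add: sys_space_def)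
  qed
  show ?thesis
  proof (intro conjI allI impI ballI)
    fix a t assume a: "a \<in> A" and t: "t \<in> {0..T}"
    obtain F where "noisy_loc T J (C a) F"
      by (rule noisy_circuit_locationD[OF T circ a])
    then interpret noisy_loc T J "C a" F .
    show "op_norm (loc_space (C a)) (H_int (C a) t) = op_norm (loc_space (C a)) (H_err (C a))"
      by (rule op_norm_H_int[OF t])
  next
    show "complex_of_real (\<eta>\<^sup>2) =
      max_over A C (\<lambda>a \<Psi>. expect (product_state \<Psi> (bath_init (C a)))
        (\<lambda>v. 2 *\<^sub>C v - U_int (C a) T v - adj (loc_space (C a)) (U_int (C a) T) v))"
      unfolding \<eta>
    proof (rule max_over_cong)
      fix a \<Psi> assume a: "a \<in> A" and \<Psi>: "\<Psi> \<in> sys_space (C a)"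
      obtain F where "noisy_loc T J (C a) F"
        by (rule noisy_circuit_locationD[OF T circ a])
      then interpret noisy_loc T J "C a" F .
      show "expect (product_state \<Psi> (bath_init (C a)))
          (\<lambda>v. adj (loc_space (C a)) (U_int (C a) T) (U_int (C a) T v - v) - (U_int (C a) T v - v)) =
        expect (product_state \<Psi> (bath_init (C a)))
          (\<lambda>v. 2 *\<^sub>C v - U_int (C a) T v - adj (loc_space (C a)) (U_int (C a) T) v)"
        using evol.expect_noise[OF product_state_in_L[OF \<Psi>]] unfolding U_int_def by simp
    qed
  next
    fix M K I \<omega> J2
    assume stat: "\<forall>a\<in>A. stationary_correlations T (C a) (M a) (K a)"
      and combs: "\<forall>a\<in>A. \<forall>\<alpha>\<in>labels (C a). \<forall>\<beta>\<in>labels (C a).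
        is_delta_comb (M a) (K a \<alpha> \<beta>) (I a :: 'i set) (J2 a \<alpha> \<beta>) (\<omega> a)"
    show "complex_of_real (\<eta>\<^sup>2) \<le>
      max_over A C (\<lambda>a \<Psi>. \<Sum>\<^sub>\<infinity>i\<in>I a. \<Sum>\<alpha>\<in>labels (C a). \<Sum>\<beta>\<in>labels (C a).
        J2 a \<alpha> \<beta> i *
        expect \<Psi> (\<lambda>\<psi>. S_fourier (C a) T \<alpha> (\<omega> a i) (S_fourier (C a) T \<beta> (- \<omega> a i) \<psi>)))
      + tail_bound (J * T)"
      by (rule le) (rule comb, (use stat combs in blast)+)
  \<comment> \<open>The bounds left over are the one with the Hamiltonians, the factorised one and
    the spectral one.\<close>
  qed (rule le; simp only: HH corr spectral)+
qed

end
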